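(* Let $(M,g,J)$ be a smooth, connected, closed almost-Hermitian manifold of real dimension $n=2N$, with holomorphic sectional curvature function $H$, scalar curvature $s$ and $*$-scalar curvature $s^*$. Then for all $p\in M$, $$\int_{S_p(M)} H\,\omega_2 = \frac{3s^*(p)+s(p)}{4N(N+1)}\,\mathrm{Vol}(\mathbb{S}^{n-1}),$$ where $S_p(M)$ is the unit sphere in $(T_pM,g_p)$, $\omega_2$ is its standard volume form as a round sphere of radius $1$, and $\mathrm{Vol}(\mathbb{S}^{n-1})$ is the volume of the round unit sphere $\mathbb{S}^{n-1}$.
   Context: Almost-Hermitian: $J$ is an almost complex structure with $g(JX,JY)=g(X,Y)$ (no integrability or Kähler condition is assumed). Curvature convention: $R_{WXYZ}=R(W,X,Y,Z)=g(\nabla_{[W,X]}Y-[\nabla_W,\nabla_X]Y,Z)$, with $\nabla$ the Levi-Civita connection, so that the sectional curvature is $\mathrm{sec}(x,y)=\dfrac{R(x,y,x,y)}{\|x\|^2\|y\|^2-g(x,y)^2}$. Holomorphic sectional curvature: for a unit vector $x\in T_pM$, $H(x)=R(x,Jx,x,Jx)$. For an orthonormal basis $e_1,\dots,e_n$ of $T_pM$, a starred index denotes application of $J$: $e_{i^*}=Je_i$. The $*$-Ricci tensor is $R^*_{ij}=\sum_{a=1}^n R_{a\,i^*\,j\,a^*}=\sum_{a=1}^n R(e_a,Je_i,e_j,Je_a)$, and the $*$-scalar curvature is its trace $s^*=\sum_{i=1}^n R^*_{ii}=\sum_{i,a=1}^n R(e_a,Je_i,e_i,Je_a)$. The scalar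 curvature is $s=\sum_{i,a=1}^n R(e_i,e_a,e_i,e_a)$. *)

theory Defs
  imports "HOL-Analysis.Analysis" "HOL-Library.Function_Algebras"
begin

text \<open>Functions into a real vector space form a real vector space under the pointwise operations;
  tangent vectors, vector fields and sums of these use this structure.\<close>

instantiation "fun" :: (type, scaleR) scaleR
begin

definition scaleR_fun :: "real \<Rightarrow> ('a \<Rightarrow> 'b) \<Rightarrow> 'a \<Rightarrow> 'b" where
  "scaleR_fun a f = (\<lambda>x. a *\<^sub>R f x)"

instance ..

end

instance "fun" :: (type, real_vector) real_vector
  by standard (auto simp: scaleR_fun_def fun_eq_iff scaleR_add_right scaleR_add_left)


section \<open>Smooth manifolds\<close>

text \<open>Used only for open \<open>S\<close> in finite-dimensional spaces, where the directional derivatives being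
  of class \<open>C^k\<close> amounts to the derivative being so.\<close>

primrec Ck_on :: "nat \<Rightarrow> 'a::real_normed_vector set \<Rightarrow> ('a \<Rightarrow> 'b::real_normed_vector) \<Rightarrow> bool" where
  "Ck_on 0 S f \<longleftrightarrow> continuous_on S f"
| "Ck_on (Suc k) S f \<longleftrightarrow> (\<forall>x\<in>S. f differentiable (at x)) \<and>
     (\<forall>v. Ck_on k S (\<lambda>x. frechet_derivative f (at x) v))"

definition smooth_on :: "'a::real_normed_vector set \<Rightarrow> ('a \<Rightarrow> 'b::real_normed_vector) \<Rightarrow> bool" where
  "smooth_on S f \<longleftrightarrow> (\<forall>k. Ck_on k S f)"

text \<open>A chart is a pair of its domain and its coordinate map; the values of the coordinate map
  outside the domain are irrelevant.\<close>

type_synonym ('m, 'n) chart = "'m set \<times> ('m \<Rightarrow> real^'n)"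

abbreviation chart_dom :: "('m, 'n) chart \<Rightarrow> 'm set" where
  "chart_dom c \<equiv> fst c"

abbreviation coords :: "('m, 'n) chart \<Rightarrow> 'm \<Rightarrow> real^'n" where
  "coords c \<equiv> snd c"

definition chart_cod :: "('m, 'n) chart \<Rightarrow> (real^'n) set" where
  "chart_cod c = coords c ` chart_dom c"

definition chart_inv :: "('m, 'n) chart \<Rightarrow> real^'n \<Rightarrow> 'm" where
  "chart_inv c = inv_into (chart_dom c) (coords c)"

definition smooth_atlas :: "('m::topological_space, 'n::finite) chart set \<Rightarrow> bool" where
  "smooth_atlas A \<longleftrightarrow>
     (\<Union>c\<in>A. chart_dom c) = UNIV \<and>
     (\<forall>c\<in>A. open (chart_dom c) \<and> open (chart_cod c) \<and>
        homeomorphism (chart_dom c) (chart_cod c) (coords c) (chart_inv c)) \<and>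
     (\<forall>c\<in>A. \<forall>d\<in>A. smooth_on (coords c ` (chart_dom c \<inter> chart_dom d)) (coords d \<circ> chart_inv c))"

definition charts_at :: "('m, 'n) chart set \<Rightarrow> 'm \<Rightarrow> ('m, 'n) chart set" where
  "charts_at A p = {c \<in> A. p \<in> chart_dom c}"

definition smooth_fun :: "('m, 'n::finite) chart set \<Rightarrow> ('m \<Rightarrow> real) \<Rightarrow> bool" where
  "smooth_fun A f \<longleftrightarrow> (\<forall>c\<in>A. smooth_on (chart_cod c) (f \<circ> chart_inv c))"

text \<open>A tangent vector at \<open>p\<close> is the family of its coordinate representations, one for every chart
  at \<open>p\<close>, related by the derivatives of the coordinate changes. It is extended by \<open>0\<close> to the
  remaining charts, so that equality of tangent vectors is equality of functions.\<close>

type_synonym ('m, 'n) tvec = "('m, 'n) chart \<Rightarrow> real^'n"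

definition tangent_space :: "('m, 'n::finite) chart set \<Rightarrow> 'm \<Rightarrow> ('m, 'n) tvec set" where
  "tangent_space A p = {v.
     (\<forall>c. c \<notin> charts_at A p \<longrightarrow> v c = 0) \<and>
     (\<forall>c\<in>charts_at A p. \<forall>d\<in>charts_at A p.
        v d = frechet_derivative (coords d \<circ> chart_inv c) (at (coords c p)) (v c))}"

type_synonym ('m, 'n) vfield = "'m \<Rightarrow> ('m, 'n) tvec"

definition coord_rep :: "('m, 'n) vfield \<Rightarrow> ('m, 'n) chart \<Rightarrow> real^'n \<Rightarrow> real^'n" where
  "coord_rep X c x = X (chart_inv c x) c"

definition smooth_vfields :: "('m, 'n::finite) chart set \<Rightarrow> ('m, 'n) vfield set" where
  "smooth_vfields A = {X. (\<forall>p. X p \<in> tangent_space A p) \<and>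
     (\<forall>c\<in>A. smooth_on (chart_cod c) (coord_rep X c))}"

definition fun_scale :: "('m \<Rightarrow> real) \<Rightarrow> ('m, 'n::finite) vfield \<Rightarrow> ('m, 'n) vfield" where
  "fun_scale f X = (\<lambda>p. f p *\<^sub>R X p)"

text \<open>The derivative \<open>X f\<close>; its value does not depend on the chart used to compute it.\<close>

definition vf_deriv :: "('m, 'n::finite) chart set \<Rightarrow> ('m, 'n) vfield \<Rightarrow> ('m \<Rightarrow> real) \<Rightarrow> 'm \<Rightarrow> real" where
  "vf_deriv A X f p = (let c = (SOME c. c \<in> charts_at A p) in
     frechet_derivative (f \<circ> chart_inv c) (at (coords c p)) (X p c))"

definition lie_bracket ::
    "('m, 'n::finite) chart set \<Rightarrow> ('m, 'n) vfield \<Rightarrow> ('m, 'n) vfield \<Rightarrow> ('m, 'n) vfield" where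
  "lie_bracket A X Y = (\<lambda>p c. if c \<in> charts_at A p
     then frechet_derivative (coord_rep Y c) (at (coords c p)) (X p c)
        - frechet_derivative (coord_rep X c) (at (coords c p)) (Y p c)
     else 0)"


section \<open>Almost-Hermitian structures\<close>

text \<open>Smoothness of the tensor fields \<open>g\<close> and \<open>J\<close> means that they map smooth vector fields to
  smooth functions and to smooth vector fields, respectively.\<close>

definition riemannian_metric ::
    "('m, 'n::finite) chart set \<Rightarrow> ('m \<Rightarrow> ('m, 'n) tvec \<Rightarrow> ('m, 'n) tvec \<Rightarrow> real) \<Rightarrow> bool" where
  "riemannian_metric A g \<longleftrightarrow>
     (\<forall>p. \<forall>u\<in>tangent_space A p. \<forall>v\<in>tangent_space A p. \<forall>w\<in>tangent_space A p. \<forall>a.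
        g p u v = g p v u \<and>
        g p (u + v) w = g p u w + g p v w \<and>
        g p (a *\<^sub>R u) v = a * g p u v \<and>
        (u \<noteq> 0 \<longrightarrow> g p u u > 0)) \<and>
     (\<forall>X\<in>smooth_vfields A. \<forall>Y\<in>smooth_vfields A. smooth_fun A (\<lambda>p. g p (X p) (Y p)))"

definition almost_complex_structure ::
    "('m, 'n::finite) chart set \<Rightarrow> ('m \<Rightarrow> ('m, 'n) tvec \<Rightarrow> ('m, 'n) tvec) \<Rightarrow> bool" where
  "almost_complex_structure A J \<longleftrightarrow>
     (\<forall>p. \<forall>v\<in>tangent_space A p. \<forall>w\<in>tangent_space A p. \<forall>a.
        J p v \<in> tangent_space A p \<and>
        J p (v + w) = J p v + J p w \<and>
        J p (a *\<^sub>R v) = a *\<^sub>R J p v \<and>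
        J p (J p v) = - v) \<and>
     (\<forall>X\<in>smooth_vfields A. (\<lambda>p. J p (X p)) \<in> smooth_vfields A)"

definition almost_hermitian ::
    "('m, 'n::finite) chart set \<Rightarrow> ('m \<Rightarrow> ('m, 'n) tvec \<Rightarrow> ('m, 'n) tvec \<Rightarrow> real) \<Rightarrow>
     ('m \<Rightarrow> ('m, 'n) tvec \<Rightarrow> ('m, 'n) tvec) \<Rightarrow> bool" where
  "almost_hermitian A g J \<longleftrightarrow> riemannian_metric A g \<and> almost_complex_structure A J \<and>
     (\<forall>p. \<forall>v\<in>tangent_space A p. \<forall>w\<in>tangent_space A p. g p (J p v) (J p w) = g p v w)"


section \<open>The Levi-Civita connection and its curvature\<close>

definition affine_connection ::
    "('m, 'n::finite) chart set \<Rightarrow> (('m, 'n) vfield \<Rightarrow> ('m, 'n) vfield \<Rightarrow> ('m, 'n) vfield) \<Rightarrow> bool" where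
  "affine_connection A nabla \<longleftrightarrow>
     (\<forall>X\<in>smooth_vfields A. \<forall>Y\<in>smooth_vfields A. \<forall>Z\<in>smooth_vfields A. \<forall>f. smooth_fun A f \<longrightarrow>
        nabla X Y \<in> smooth_vfields A \<and>
        nabla (X + Y) Z = nabla X Z + nabla Y Z \<and>
        nabla (fun_scale f X) Z = fun_scale f (nabla X Z) \<and>
        nabla X (Y + Z) = nabla X Y + nabla X Z \<and>
        nabla X (fun_scale f Y) = fun_scale (vf_deriv A X f) Y + fun_scale f (nabla X Y))"

definition levi_civita ::
    "('m, 'n::finite) chart set \<Rightarrow> ('m \<Rightarrow> ('m, 'n) tvec \<Rightarrow> ('m, 'n) tvec \<Rightarrow> real) \<Rightarrow>
     (('m, 'n) vfield \<Rightarrow> ('m, 'n) vfield \<Rightarrow> ('m, 'n) vfield) \<Rightarrow> bool" where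
  "levi_civita A g nabla \<longleftrightarrow> affine_connection A nabla \<and>
     (\<forall>X\<in>smooth_vfields A. \<forall>Y\<in>smooth_vfields A. nabla X Y - nabla Y X = lie_bracket A X Y) \<and>
     (\<forall>X\<in>smooth_vfields A. \<forall>Y\<in>smooth_vfields A. \<forall>Z\<in>smooth_vfields A. \<forall>p.
        vf_deriv A X (\<lambda>q. g q (Y q) (Z q)) p = g p (nabla X Y p) (Z p) + g p (Y p) (nabla X Z p))"

text \<open>Sign convention: \<open>R(W,X,Y,Z) = g(\<nabla>\<^bsub>[W,X]\<^esub> Y - [\<nabla>\<^sub>W, \<nabla>\<^sub>X] Y, Z)\<close>, so that \<open>R(x,y,x,y)\<close> is the
  sectional curvature for orthonormal \<open>x\<close>, \<open>y\<close>.\<close>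

definition curvature_fields ::
    "('m, 'n::finite) chart set \<Rightarrow> ('m \<Rightarrow> ('m, 'n) tvec \<Rightarrow> ('m, 'n) tvec \<Rightarrow> real) \<Rightarrow>
     (('m, 'n) vfield \<Rightarrow> ('m, 'n) vfield \<Rightarrow> ('m, 'n) vfield) \<Rightarrow>
     ('m, 'n) vfield \<Rightarrow> ('m, 'n) vfield \<Rightarrow> ('m, 'n) vfield \<Rightarrow> ('m, 'n) vfield \<Rightarrow> 'm \<Rightarrow> real" where
  "curvature_fields A g nabla W X Y Z p =
     g p ((nabla (lie_bracket A W X) Y - (nabla W (nabla X Y) - nabla X (nabla W Y))) p) (Z p)"

text \<open>The value on tangent vectors at \<open>p\<close> is the common value on all smooth extensions to vector
  fields (the curvature is a tensor).\<close>

definition curvature ::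
    "('m, 'n::finite) chart set \<Rightarrow> ('m \<Rightarrow> ('m, 'n) tvec \<Rightarrow> ('m, 'n) tvec \<Rightarrow> real) \<Rightarrow>
     (('m, 'n) vfield \<Rightarrow> ('m, 'n) vfield \<Rightarrow> ('m, 'n) vfield) \<Rightarrow>
     'm \<Rightarrow> ('m, 'n) tvec \<Rightarrow> ('m, 'n) tvec \<Rightarrow> ('m, 'n) tvec \<Rightarrow> ('m, 'n) tvec \<Rightarrow> real" where
  "curvature A g nabla p w x y z = (THE r.
     \<forall>W\<in>smooth_vfields A. \<forall>X\<in>smooth_vfields A. \<forall>Y\<in>smooth_vfields A. \<forall>Z\<in>smooth_vfields A.
       W p = w \<and> X p = x \<and> Y p = y \<and> Z p = z \<longrightarrow> r = curvature_fields A g nabla W X Y Z p)"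

definition hol_sec_curvature ::
    "('m, 'n::finite) chart set \<Rightarrow> ('m \<Rightarrow> ('m, 'n) tvec \<Rightarrow> ('m, 'n) tvec \<Rightarrow> real) \<Rightarrow>
     ('m \<Rightarrow> ('m, 'n) tvec \<Rightarrow> ('m, 'n) tvec) \<Rightarrow>
     (('m, 'n) vfield \<Rightarrow> ('m, 'n) vfield \<Rightarrow> ('m, 'n) vfield) \<Rightarrow> 'm \<Rightarrow> ('m, 'n) tvec \<Rightarrow> real" where
  "hol_sec_curvature A g J nabla p x = curvature A g nabla p x (J p x) x (J p x)"

text \<open>The tangent spaces have dimension \<open>CARD('n)\<close>, so an orthonormal family indexed by \<open>'n\<close> is an
  orthonormal basis.\<close>

definition orthonormal_basis_at ::
    "('m, 'n::finite) chart set \<Rightarrow> ('m \<Rightarrow> ('m, 'n) tvec \<Rightarrow> ('m, 'n) tvec \<Rightarrow> real) \<Rightarrow>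
     'm \<Rightarrow> ('n \<Rightarrow> ('m, 'n) tvec) \<Rightarrow> bool" where
  "orthonormal_basis_at A g p e \<longleftrightarrow> (\<forall>i. e i \<in> tangent_space A p) \<and>
     (\<forall>i j. g p (e i) (e j) = (if i = j then 1 else 0))"

text \<open>The scalar and the \<open>*\<close>-scalar curvature are the common values of the defining sums over all
  orthonormal bases.\<close>

definition scalar_curvature ::
    "('m, 'n::finite) chart set \<Rightarrow> ('m \<Rightarrow> ('m, 'n) tvec \<Rightarrow> ('m, 'n) tvec \<Rightarrow> real) \<Rightarrow>
     (('m, 'n) vfield \<Rightarrow> ('m, 'n) vfield \<Rightarrow> ('m, 'n) vfield) \<Rightarrow> 'm \<Rightarrow> real" where
  "scalar_curvature A g nabla p = (THE s. \<forall>e. orthonormal_basis_at A g p e \<longrightarrow>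
     s = (\<Sum>i\<in>UNIV. \<Sum>a\<in>UNIV. curvature A g nabla p (e i) (e a) (e i) (e a)))"

definition star_ricci ::
    "('m, 'n::finite) chart set \<Rightarrow> ('m \<Rightarrow> ('m, 'n) tvec \<Rightarrow> ('m, 'n) tvec \<Rightarrow> real) \<Rightarrow>
     ('m \<Rightarrow> ('m, 'n) tvec \<Rightarrow> ('m, 'n) tvec) \<Rightarrow>
     (('m, 'n) vfield \<Rightarrow> ('m, 'n) vfield \<Rightarrow> ('m, 'n) vfield) \<Rightarrow>
     'm \<Rightarrow> ('n \<Rightarrow> ('m, 'n) tvec) \<Rightarrow> 'n \<Rightarrow> 'n \<Rightarrow> real" where
  "star_ricci A g J nabla p e i j =
     (\<Sum>a\<in>UNIV. curvature A g nabla p (e a) (J p (e i)) (e j) (J p (e a)))"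

definition star_scalar_curvature ::
    "('m, 'n::finite) chart set \<Rightarrow> ('m \<Rightarrow> ('m, 'n) tvec \<Rightarrow> ('m, 'n) tvec \<Rightarrow> real) \<Rightarrow>
     ('m \<Rightarrow> ('m, 'n) tvec \<Rightarrow> ('m, 'n) tvec) \<Rightarrow>
     (('m, 'n) vfield \<Rightarrow> ('m, 'n) vfield \<Rightarrow> ('m, 'n) vfield) \<Rightarrow> 'm \<Rightarrow> real" where
  "star_scalar_curvature A g J nabla p = (THE s. \<forall>e. orthonormal_basis_at A g p e \<longrightarrow>
     s = (\<Sum>i\<in>UNIV. star_ricci A g J nabla p e i i))"


section \<open>The volume of the round unit sphere\<close>

text \<open>The unit sphere of \<open>real^'n\<close> is covered, up to its equator, by two hemispheres, the graphs of
  \<open>\<plusminus>sqrt (1 - norm y ^ 2)\<close> over the unit ball of the remaining \<open>CARD('n) - 1\<close> coordinates \<open>y\<close>.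
  Any coordinate can serve as the polar one.\<close>

definition pole :: "'n::finite" where
  "pole = (SOME k. True)"

definition hemisphere_ball :: "('n::finite \<Rightarrow> real) set" where
  "hemisphere_ball = {y. (\<Sum>j\<in>UNIV - {pole}. (y j)^2) < 1}"

definition hemisphere :: "real \<Rightarrow> ('n::finite \<Rightarrow> real) \<Rightarrow> real^'n" where
  "hemisphere \<sigma> y =
     (\<chi> i. if i = pole then \<sigma> * sqrt (1 - (\<Sum>j\<in>UNIV - {pole}. (y j)^2)) else y i)"

definition hemisphere_partial :: "real \<Rightarrow> ('n::finite \<Rightarrow> real) \<Rightarrow> 'n \<Rightarrow> real^'n" where
  "hemisphere_partial \<sigma> y j = vector_derivative (\<lambda>t. hemisphere \<sigma> (y(j := t))) (at (y j))"

text \<open>The volume form of the unit sphere at \<open>x\<close> is the contraction of the Euclidean volume form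
  with the unit normal \<open>x\<close>, evaluated here (up to orientation) on the vectors \<open>v j\<close> with
  \<open>j \<noteq> pole\<close>.\<close>

definition sphere_volume_form :: "real^'n \<Rightarrow> ('n::finite \<Rightarrow> real^'n) \<Rightarrow> real" where
  "sphere_volume_form x v = det (\<chi> i j. if j = pole then x $ i else v j $ i)"

text \<open>Integration of the volume form over the two hemispheres, as a measure on the ambient space
  concentrated on the sphere.\<close>

definition sphere_measure :: "(real^'n::finite) measure" where
  "sphere_measure = distr
     (density (count_space {1, -1} \<Otimes>\<^sub>M Pi\<^sub>M (UNIV - {pole}) (\<lambda>_. lborel))
        (\<lambda>(\<sigma>, y). indicator hemisphere_ball y *
           ennreal \<bar>sphere_volume_form (hemisphere \<sigma> y) (hemisphere_partial \<sigma> y)\<bar>))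
     borel (\<lambda>(\<sigma>, y). hemisphere \<sigma> y)"

text \<open>The integral of \<open>f\<close> over the unit sphere of \<open>(T\<^sub>pM, g\<^sub>p)\<close> with respect to its round volume: every
  orthonormal basis identifies this sphere isometrically with the unit sphere of \<open>real^'n\<close>, and
  the integral is the common value for all these identifications.\<close>

definition unit_sphere_integral ::
    "('m, 'n::finite) chart set \<Rightarrow> ('m \<Rightarrow> ('m, 'n) tvec \<Rightarrow> ('m, 'n) tvec \<Rightarrow> real) \<Rightarrow>
     'm \<Rightarrow> (('m, 'n) tvec \<Rightarrow> real) \<Rightarrow> real" where
  "unit_sphere_integral A g p f = (THE I. \<forall>e. orthonormal_basis_at A g p e \<longrightarrow>
     I = (\<integral>x. f (\<Sum>i\<in>UNIV. x $ i *\<^sub>R e i) \<partial>sphere_measure))"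

end

theory Submission
  imports Defs
begin

text \<open>At a point \<open>p\<close> the holomorphic sectional curvature \<open>H(x) = R(x,Jx,x,Jx)\<close> is a quartic form in \<open>x\<close>,
  so its integral over the unit sphere is determined by the fourth moments of the sphere, which are
  \<open>\<integral> x\<^sub>i x\<^sub>j x\<^sub>k x\<^sub>l = Vol / (n (n + 2)) (\<delta>\<^sub>i\<^sub>j \<delta>\<^sub>k\<^sub>l + \<delta>\<^sub>i\<^sub>k \<delta>\<^sub>j\<^sub>l + \<delta>\<^sub>i\<^sub>l \<delta>\<^sub>j\<^sub>k)\<close>. Of the three resulting contractions of \<open>R\<close>, one is \<open>s\<close>
  and one is \<open>s\<^sup>*\<close>; the first Bianchi identity, together with the orthonormal basis \<open>J e\<^sub>i\<close>, turns
  the remaining one into \<open>2 s\<^sup>*\<close>. The moments need no change of variables: on a slice of a hemisphere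
  chart in which only one coordinate varies, integration by parts relates the moments of this
  coordinate to those of the polar one.\<close>


section \<open>Smooth functions\<close>

text \<open>Curvature, both scalar curvatures and the sphere integral are definite descriptions: the
  common value over all extensions to global smooth fields, or over all orthonormal bases. Such a
  term can be evaluated only after one competitor is exhibited and all are shown to agree, and this
  shapes the proof. For the curvature, existence means extending a vector at a point to a field on
  the whole manifold, hence bump functions; agreement means tensoriality, whose analytic ingredient
  is the symmetry of second derivatives, used for \<open>[W,X]f = W(Xf) - X(Wf)\<close>. For the
  traces and the integral, existence is Gram-Schmidt, and agreement is the basis independence of
  traces of bilinear forms.

  The constant comes from expanding \<open>1 = (x_1^2 + ... + x_n^2)^2\<close> on the sphere: if
  \<open>x_i^2 x_k^2\<close> has integral \<open>C\<close> for \<open>i \<noteq> k\<close> and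
  \<open>3 C\<close> for \<open>i = k\<close>, the volume is
  \<open>(3 n + n (n - 1)) C = n (n + 2) C\<close>, and \<open>n (n + 2) = 4 N (N + 1)\<close> for
  \<open>n = 2 N\<close>. Even moments are handled as integrals in the extended nonnegative reals,
  where they can be compared before they are known to be finite.\<close>

lemma Ck_on_SucD1: "Ck_on (Suc k) S f \<Longrightarrow> x \<in> S \<Longrightarrow> f differentiable (at x)"
  and Ck_on_SucD2: "Ck_on (Suc k) S f \<Longrightarrow> Ck_on k S (\<lambda>x. frechet_derivative f (at x) v)"
  by auto

lemma Ck_on_Suc_imp: "Ck_on (Suc k) S f \<Longrightarrow> Ck_on k S f"
proof (induction k arbitrary: f)
  case 0
  then have "\<And>x. x \<in> S \<Longrightarrow> isCont f x"
    by (auto intro: differentiable_imp_continuous_within)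
  then show ?case by (simp add: continuous_at_imp_continuous_on)
next
  case (Suc k)
  then show ?case by (metis Ck_on.simps(2))
qed

lemma differentiable_cong_open:
  assumes "open S" "x \<in> S" "\<And>y. y \<in> S \<Longrightarrow> f y = g y"
  shows "f differentiable (at x) \<longleftrightarrow> g differentiable (at x)"
  using assms has_derivative_transform_within_open[of f _ x UNIV S g]
    has_derivative_transform_within_open[of g _ x UNIV S f]
  unfolding differentiable_def by metis

lemma frechet_derivative_cong_open:
  assumes "open S" "x \<in> S" "\<And>y. y \<in> S \<Longrightarrow> f y = g y"
  shows "frechet_derivative f (at x) = frechet_derivative g (at x)"
proof -
  have "(f has_derivative D) (at x) \<longleftrightarrow> (g has_derivative D) (at x)" for D
    using assms has_derivative_transform_within_open[of f D x UNIV S g]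
      has_derivative_transform_within_open[of g D x UNIV S f] by metis
  then show ?thesis unfolding frechet_derivative_def by simp
qed

text \<open>Derivatives at points of an open set see only values inside it. Chart expressions have
  arbitrary values outside their codomain, so each replacement of one by another goes through this
  lemma.\<close>

lemma Ck_on_cong:
  assumes "open S" "\<And>x. x \<in> S \<Longrightarrow> f x = g x" "Ck_on k S f"
  shows "Ck_on k S g"
  using assms(2,3)
proof (induction k arbitrary: f g)
  case 0
  then show ?case by (simp cong: continuous_on_cong)
next
  case (Suc k)
  have "Ck_on k S (\<lambda>x. frechet_derivative g (at x) v)" for v
    by (rule Suc.IH[of "\<lambda>x. frechet_derivative f (at x) v"])
      (use Suc.prems frechet_derivative_cong_open[OF assms(1)] in \<open>metis, auto\<close>)
  moreover have "\<forall>x\<in>S. g differentiable (at x)"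
    using Suc.prems differentiable_cong_open[OF assms(1), of _ f g] by auto
  ultimately show ?case by simp
qed

lemma Ck_on_subset: "Ck_on k S f \<Longrightarrow> T \<subseteq> S \<Longrightarrow> Ck_on k T f"
  by (induction k arbitrary: f) (auto intro: continuous_on_subset)

text \<open>The neighbourhoods \<open>U\<close> may leave \<open>S\<close>. This form serves for
  gluing: a function smooth on two open sets is smooth on their union.\<close>

lemma Ck_on_local:
  assumes "\<And>x. x \<in> S \<Longrightarrow> \<exists>U. open U \<and> x \<in> U \<and> Ck_on k U f"
  shows "Ck_on k S f"
  using assms
proof (induction k arbitrary: f)
  case 0
  then have "\<And>x. x \<in> S \<Longrightarrow> isCont f x"
    by (metis Ck_on.simps(1) continuous_on_eq_continuous_at)
  then show ?case by (simp add: continuous_at_imp_continuous_on)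
next
  case (Suc k)
  have "Ck_on k S (\<lambda>x. frechet_derivative f (at x) v)" for v
    by (rule Suc.IH) (use Suc.prems in \<open>metis Ck_on.simps(2)\<close>)
  moreover have "\<forall>x\<in>S. f differentiable (at x)"
    using Suc.prems by (metis Ck_on.simps(2))
  ultimately show ?case by simp
qed

lemma Ck_on_const: "Ck_on k S (\<lambda>x. c)"
  by (induction k arbitrary: c) auto

lemma Ck_on_bounded_linear:
  assumes "bounded_linear h"
  shows "Ck_on k S h"
proof (cases k)
  case 0
  then show ?thesis using assms by (simp add: linear_continuous_on)
next
  case (Suc k')
  have "(h has_derivative h) (at x)" for x
    using assms by (rule bounded_linear_imp_has_derivative)
  then have "frechet_derivative h (at x) = h" "h differentiable (at x)" for x
    using frechet_derivative_at differentiable_def by (metis, metis)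
  then show ?thesis using Suc by (simp add: Ck_on_const)
qed

lemma Ck_on_add:
  assumes "open S" "Ck_on k S f" "Ck_on k S g"
  shows "Ck_on k S (\<lambda>x. f x + g x)"
  using assms(2,3)
proof (induction k arbitrary: f g)
  case 0
  then show ?case by (simp add: continuous_on_add)
next
  case (Suc k)
  have D: "((\<lambda>x. f x + g x) has_derivative
      (\<lambda>v. frechet_derivative f (at x) v + frechet_derivative g (at x) v)) (at x)" if "x \<in> S" for x
    using Suc.prems that by (auto intro!: has_derivative_add simp: frechet_derivative_works)
  have "Ck_on k S (\<lambda>x. frechet_derivative (\<lambda>x. f x + g x) (at x) v)" for v
    by (rule Ck_on_cong[OF assms(1) _ Suc.IH[of "\<lambda>x. frechet_derivative f (at x) v"
            "\<lambda>x. frechet_derivative g (at x) v"]])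
      (use Suc.prems frechet_derivative_at[OF D] in \<open>auto simp: fun_eq_iff\<close>)
  moreover have "\<forall>x\<in>S. (\<lambda>x. f x + g x) differentiable (at x)"
    using D differentiable_def by blast
  ultimately show ?case by simp
qed

text \<open>Leibniz rule: each term of the derivative pairs one undifferentiated factor, lowered
  from order \<open>Suc k\<close> to \<open>k\<close>, with one differentiated factor. Scalar
  multiples, products and inner products are all instances.\<close>

lemma Ck_on_bilinear:
  assumes "bounded_bilinear h" "open S" "Ck_on k S f" "Ck_on k S g"
  shows "Ck_on k S (\<lambda>x. h (f x) (g x))"
  using assms(3,4)
proof (induction k arbitrary: f g)
  case 0
  then show ?case using bounded_bilinear.continuous_on[OF assms(1)] by simp
next
  case (Suc k)
  have D: "((\<lambda>x. h (f x) (g x)) has_derivative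
      (\<lambda>v. h (f x) (frechet_derivative g (at x) v) + h (frechet_derivative f (at x) v) (g x))) (at x)"
    if "x \<in> S" for x
    using Suc.prems that
    by (auto intro!: bounded_bilinear.FDERIV[OF assms(1)] simp: frechet_derivative_works)
  have fg: "Ck_on k S f" "Ck_on k S g" using Suc.prems Ck_on_Suc_imp by blast+
  have "Ck_on k S (\<lambda>x. frechet_derivative (\<lambda>x. h (f x) (g x)) (at x) v)" for v
    by (rule Ck_on_cong[OF assms(2) _ Ck_on_add[OF assms(2)
        Suc.IH[of f "\<lambda>x. frechet_derivative g (at x) v"]
        Suc.IH[of "\<lambda>x. frechet_derivative f (at x) v" g]]])
      (use Suc.prems fg frechet_derivative_at[OF D] in \<open>auto simp: fun_eq_iff\<close>)
  moreover have "\<forall>x\<in>S. (\<lambda>x. h (f x) (g x)) differentiable (at x)"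
    using D differentiable_def by blast
  ultimately show ?case by simp
qed

lemma Ck_on_sum:
  assumes "open S" "\<And>i. i \<in> I \<Longrightarrow> Ck_on k S (f i)"
  shows "Ck_on k S (\<lambda>x. \<Sum>i\<in>I. f i x)"
  using assms(2)
  by (induction I rule: infinite_finite_induct) (auto simp: Ck_on_const intro: Ck_on_add[OF assms(1)])

text \<open>\<open>Ck_on\<close> speaks of derivatives in a fixed direction. A direction that varies
  with the point is resolved into fixed basis directions with varying coefficients.\<close>

lemma frechet_derivative_basis_sum:
  fixes f :: "'a::euclidean_space \<Rightarrow> 'b::real_normed_vector"
  assumes "f differentiable (at x)"
  shows "frechet_derivative f (at x) v = (\<Sum>b\<in>Basis. (v \<bullet> b) *\<^sub>R frechet_derivative f (at x) b)"
proof -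
  interpret linear "frechet_derivative f (at x)"
    by (rule linear_frechet_derivative[OF assms])
  have "frechet_derivative f (at x) v = frechet_derivative f (at x) (\<Sum>b\<in>Basis. (v \<bullet> b) *\<^sub>R b)"
    by (simp add: euclidean_representation)
  then show ?thesis by (simp add: sum scale)
qed

text \<open>After the chain rule the outer derivative is taken in the moving direction
  \<open>Dg v\<close>. Its expansion over the basis leaves derivatives of \<open>f\<close> in
  constant directions composed with \<open>g\<close>, to which the induction hypothesis
  applies.\<close>

lemma Ck_on_compose:
  fixes f :: "'b::euclidean_space \<Rightarrow> 'c::real_normed_vector"
  assumes "open S" "open T" "Ck_on k S g" "g ` S \<subseteq> T" "Ck_on k T f"
  shows "Ck_on k S (\<lambda>x. f (g x))"
  using assms(3-5)
proof (induction k arbitrary: f)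
  case 0
  then show ?case using continuous_on_compose2[of T f S g] by simp
next
  case (Suc k)
  have gk: "Ck_on k S g" using Suc.prems Ck_on_Suc_imp by blast
  have dg: "g differentiable (at x)" and df: "f differentiable (at (g x))" if "x \<in> S" for x
    using that Suc.prems by auto
  have fd: "frechet_derivative (\<lambda>x. f (g x)) (at x) v =
      (\<Sum>b\<in>Basis. (frechet_derivative g (at x) v \<bullet> b) *\<^sub>R frechet_derivative f (at (g x)) b)"
    if "x \<in> S" for x v
    using frechet_derivative_compose[OF dg[OF that] df[OF that]]
      frechet_derivative_basis_sum[OF df[OF that], of "frechet_derivative g (at x) v"]
    unfolding o_def by metis
  have "Ck_on k S (\<lambda>x. \<Sum>b\<in>Basis. (frechet_derivative g (at x) v \<bullet> b) *\<^sub>R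
      frechet_derivative f (at (g x)) b)" for v
  proof (intro Ck_on_sum Ck_on_bilinear[OF bounded_bilinear_scaleR] assms(1)
      Ck_on_bilinear[OF bounded_bilinear_inner] Ck_on_const)
    fix b :: 'b
    show "Ck_on k S (\<lambda>x. frechet_derivative g (at x) v)" using Suc.prems by simp
    show "Ck_on k S (\<lambda>x. frechet_derivative f (at (g x)) b)"
      by (rule Suc.IH[OF gk]) (use Suc.prems in auto)
  qed
  then have "Ck_on k S (\<lambda>x. frechet_derivative (\<lambda>x. f (g x)) (at x) v)" for v
    by (rule Ck_on_cong[OF assms(1), rotated]) (simp add: fd)
  moreover have "\<forall>x\<in>S. (\<lambda>x. f (g x)) differentiable (at x)"
    using differentiable_chain_at[OF dg df] by (simp add: o_def)
  ultimately show ?case by simp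
qed

lemma smooth_on_cong:
  "open S \<Longrightarrow> (\<And>x. x \<in> S \<Longrightarrow> f x = g x) \<Longrightarrow> smooth_on S f \<Longrightarrow> smooth_on S g"
  unfolding smooth_on_def using Ck_on_cong by blast

lemma smooth_on_subset: "smooth_on S f \<Longrightarrow> T \<subseteq> S \<Longrightarrow> smooth_on T f"
  unfolding smooth_on_def using Ck_on_subset by blast

lemma smooth_on_Un:
  assumes "open S" "open T" "smooth_on S f" "smooth_on T f"
  shows "smooth_on (S \<union> T) f"
  unfolding smooth_on_def by (intro allI Ck_on_local) (use assms in \<open>auto simp: smooth_on_def\<close>)

lemma smooth_on_const: "smooth_on S (\<lambda>x. c)"
  by (simp add: smooth_on_def Ck_on_const)

lemma smooth_on_bounded_linear: "bounded_linear h \<Longrightarrow> smooth_on S h"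
  by (simp add: smooth_on_def Ck_on_bounded_linear)

lemma smooth_on_add:
  "open S \<Longrightarrow> smooth_on S f \<Longrightarrow> smooth_on S g \<Longrightarrow> smooth_on S (\<lambda>x. f x + g x)"
  by (simp add: smooth_on_def Ck_on_add)

lemma smooth_on_bilinear:
  "bounded_bilinear h \<Longrightarrow> open S \<Longrightarrow> smooth_on S f \<Longrightarrow> smooth_on S g \<Longrightarrow> smooth_on S (\<lambda>x. h (f x) (g x))"
  by (simp add: smooth_on_def Ck_on_bilinear)

lemmas smooth_on_scaleR = smooth_on_bilinear[OF bounded_bilinear_scaleR]
  and smooth_on_mult = smooth_on_bilinear[OF bounded_bilinear_mult]
  and smooth_on_inner = smooth_on_bilinear[OF bounded_bilinear_inner]

lemma smooth_on_sum:
  "open S \<Longrightarrow> (\<And>i. i \<in> I \<Longrightarrow> smooth_on S (f i)) \<Longrightarrow> smooth_on S (\<lambda>x. \<Sum>i\<in>I. f i x)"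
  by (simp add: smooth_on_def Ck_on_sum)

lemma smooth_on_compose:
  fixes f :: "'b::euclidean_space \<Rightarrow> 'c::real_normed_vector"
  shows "open S \<Longrightarrow> open T \<Longrightarrow> smooth_on S g \<Longrightarrow> g ` S \<subseteq> T \<Longrightarrow> smooth_on T f \<Longrightarrow>
    smooth_on S (\<lambda>x. f (g x))"
  unfolding smooth_on_def using Ck_on_compose by blast

lemma smooth_on_differentiable: "smooth_on S f \<Longrightarrow> x \<in> S \<Longrightarrow> f differentiable (at x)"
  unfolding smooth_on_def using Ck_on_SucD1 by blast

lemma smooth_on_derivative: "smooth_on S f \<Longrightarrow> smooth_on S (\<lambda>x. frechet_derivative f (at x) v)"
  unfolding smooth_on_def using Ck_on_SucD2 by blast

lemma smooth_on_directional_derivative: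
  fixes f :: "'a::euclidean_space \<Rightarrow> 'b::real_normed_vector"
  assumes "open S" "smooth_on S f" "smooth_on S X"
  shows "smooth_on S (\<lambda>x. frechet_derivative f (at x) (X x))"
proof -
  have "smooth_on S (\<lambda>x. \<Sum>b\<in>Basis. (X x \<bullet> b) *\<^sub>R frechet_derivative f (at x) b)"
    by (intro smooth_on_sum smooth_on_scaleR smooth_on_inner smooth_on_derivative smooth_on_const assms)
  then show ?thesis
    by (rule smooth_on_cong[OF assms(1), rotated])
      (simp add: frechet_derivative_basis_sum[OF smooth_on_differentiable[OF assms(2)], symmetric])
qed

section \<open>Symmetry of second derivatives\<close>

lemma line_derivative:
  fixes f :: "'a::real_normed_vector \<Rightarrow> real"
  assumes "f differentiable (at (a + t *\<^sub>R u))"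
  shows "((\<lambda>t. f (a + t *\<^sub>R u)) has_real_derivative frechet_derivative f (at (a + t *\<^sub>R u)) u) (at t)"
proof -
  have 1: "(f has_derivative frechet_derivative f (at (a + t *\<^sub>R u))) (at (a + t *\<^sub>R u))"
    using assms frechet_derivative_works by blast
  have 2: "((\<lambda>t. a + t *\<^sub>R u) has_derivative (\<lambda>h. h *\<^sub>R u)) (at t)"
    by (auto intro!: derivative_eq_intros)
  have "((\<lambda>t. f (a + t *\<^sub>R u)) has_derivative (\<lambda>h. frechet_derivative f (at (a + t *\<^sub>R u)) (h *\<^sub>R u))) (at t)"
    using diff_chain_at[OF 2 1] by (simp add: o_def)
  moreover have "frechet_derivative f (at (a + t *\<^sub>R u)) (h *\<^sub>R u) =
      frechet_derivative f (at (a + t *\<^sub>R u)) u * h" for h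
    using linear_scale[OF linear_frechet_derivative[OF assms]] by simp
  ultimately show ?thesis by (simp add: has_field_derivative_def)
qed

text \<open>The left-hand side is symmetric in \<open>u\<close> and \<open>v\<close>, whence the symmetry of second derivatives.\<close>

lemma second_difference:
  fixes f :: "'a::real_normed_vector \<Rightarrow> real"
  assumes "open S" "Ck_on 2 S f" "s > 0"
    and sq: "\<And>p q. 0 \<le> p \<Longrightarrow> p \<le> s \<Longrightarrow> 0 \<le> q \<Longrightarrow> q \<le> s \<Longrightarrow> x + p *\<^sub>R u + q *\<^sub>R v \<in> S"
  shows "\<exists>p q. 0 < p \<and> p < s \<and> 0 < q \<and> q < s \<and>
    f (x + s *\<^sub>R u + s *\<^sub>R v) - f (x + s *\<^sub>R u) - f (x + s *\<^sub>R v) + f x =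
    s\<^sup>2 * frechet_derivative (\<lambda>y. frechet_derivative f (at y) u) (at (x + p *\<^sub>R u + q *\<^sub>R v)) v"
proof -
  have df: "\<And>y. y \<in> S \<Longrightarrow> f differentiable (at y)"
    and ddf: "\<And>y. y \<in> S \<Longrightarrow> (\<lambda>y. frechet_derivative f (at y) u) differentiable (at y)"
    using assms(2) by (auto simp: numeral_2_eq_2)
  \<comment> \<open>The second difference over the square is an increment of \<open>\<phi>\<close>,
    itself a difference in direction \<open>v\<close>. The mean value theorem is applied along
    \<open>u\<close> to \<open>\<phi>\<close>, then along \<open>v\<close> to the derivative that
    results.\<close>
  define \<phi> where "\<phi> t = f ((x + s *\<^sub>R v) + t *\<^sub>R u) - f (x + t *\<^sub>R u)" for t
  have "(\<phi> has_real_derivative (frechet_derivative f (at ((x + s *\<^sub>R v) + t *\<^sub>R u)) u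
       - frechet_derivative f (at (x + t *\<^sub>R u)) u)) (at t)" if "0 \<le> t" "t \<le> s" for t
    unfolding \<phi>_def using sq[of t s] sq[of t 0] that assms(3)
    by (intro DERIV_diff line_derivative df) (simp_all add: algebra_simps)
  from MVT2[OF assms(3) this] obtain p where p: "0 < p" "p < s"
    and e1: "\<phi> s - \<phi> 0 = s * (frechet_derivative f (at ((x + s *\<^sub>R v) + p *\<^sub>R u)) u
       - frechet_derivative f (at (x + p *\<^sub>R u)) u)" by auto
  define \<psi> where "\<psi> t = frechet_derivative f (at ((x + p *\<^sub>R u) + t *\<^sub>R v)) u" for t
  have "(\<psi> has_real_derivative (frechet_derivative (\<lambda>y. frechet_derivative f (at y) u)
      (at ((x + p *\<^sub>R u) + t *\<^sub>R v)) v)) (at t)" if "0 \<le> t" "t \<le> s" for t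
    unfolding \<psi>_def using sq[of p t] that p
    by (intro line_derivative[of "\<lambda>y. frechet_derivative f (at y) u"] ddf) simp
  from MVT2[OF assms(3) this] obtain q where q: "0 < q" "q < s"
    and e2: "\<psi> s - \<psi> 0 = s * frechet_derivative (\<lambda>y. frechet_derivative f (at y) u)
      (at ((x + p *\<^sub>R u) + q *\<^sub>R v)) v" by auto
  have "\<phi> s - \<phi> 0 = s * (\<psi> s - \<psi> 0)"
    using e1 by (simp add: \<psi>_def algebra_simps)
  with e2 have "\<phi> s - \<phi> 0 = s\<^sup>2 * frechet_derivative (\<lambda>y. frechet_derivative f (at y) u)
      (at (x + p *\<^sub>R u + q *\<^sub>R v)) v" by (simp add: power2_eq_square)
  moreover have "\<phi> s - \<phi> 0 = f (x + s *\<^sub>R u + s *\<^sub>R v) - f (x + s *\<^sub>R u) - f (x + s *\<^sub>R v) + f x"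
    by (simp add: \<phi>_def algebra_simps)
  ultimately show ?thesis using p q by auto
qed

text \<open>Exchanging \<open>u\<close> and \<open>v\<close> does not change the second difference,
  so the two mixed derivatives coincide at two possibly different points of a small square.
  Continuity at \<open>x\<close> then brings their values at \<open>x\<close> within any
  \<open>\<epsilon>\<close> of each other.\<close>

lemma second_derivative_symmetric:
  fixes f :: "'a::real_normed_vector \<Rightarrow> real"
  assumes "open S" "x \<in> S" "Ck_on 2 S f"
  shows "frechet_derivative (\<lambda>y. frechet_derivative f (at y) u) (at x) v =
    frechet_derivative (\<lambda>y. frechet_derivative f (at y) v) (at x) u" (is "?F x = ?G x")
proof -
  have lim: "((\<lambda>s::real. x + s *\<^sub>R w + s *\<^sub>R w') \<longlongrightarrow> x + 0 *\<^sub>R w + 0 *\<^sub>R w') (at_right 0)" for w w'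
    by (intro tendsto_intros)
  have cont: "continuous_on S (\<lambda>y. frechet_derivative (\<lambda>y. frechet_derivative f (at y) w) (at y) w')" for w w'
    using assms(3) by (simp add: numeral_2_eq_2)
  obtain r where r: "r > 0" "ball x r \<subseteq> S" using assms(1,2) openE by blast
  \<comment> \<open>Bounds the extent of a square of side 1; the summand 1 keeps it positive when
    both directions are zero.\<close>
  define C where "C = norm u + norm v + 1"
  have C: "C > 0" by (simp add: C_def add_nonneg_pos)
  have close: "dist (x + p *\<^sub>R w + q *\<^sub>R w') x < \<epsilon>"
    if "0 \<le> p" "p \<le> s" "0 \<le> q" "q \<le> s" "s * C < \<epsilon>" "norm w + norm w' + 1 = C" "0 < s" for p q s \<epsilon> w w'
  proof -
    have "dist (x + p *\<^sub>R w + q *\<^sub>R w') x = norm (p *\<^sub>R w + q *\<^sub>R w')"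
      by (simp add: dist_norm algebra_simps)
    also have "\<dots> \<le> p * norm w + q * norm w'"
      using that by (intro norm_triangle_le) simp
    also have "\<dots> \<le> s * norm w + s * norm w'"
      using that by (intro add_mono mult_right_mono) auto
    also have "\<dots> < s * C" using that(6,7) by (simp add: distrib_left[symmetric])
    finally show ?thesis using that by simp
  qed
  have dist_small: "dist (?F x) (?G x) < \<epsilon>" if "\<epsilon> > 0" for \<epsilon>
  proof -
    obtain d1 where d1: "d1 > 0" "\<And>y. y \<in> S \<Longrightarrow> dist y x < d1 \<Longrightarrow> dist (?F y) (?F x) < \<epsilon> / 2"
      using cont[of u v] assms(2) \<open>\<epsilon> > 0\<close> unfolding continuous_on_iff by (metis half_gt_zero)
    obtain d2 where d2: "d2 > 0" "\<And>y. y \<in> S \<Longrightarrow> dist y x < d2 \<Longrightarrow> dist (?G y) (?G x) < \<epsilon> / 2"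
      using cont[of v u] assms(2) \<open>\<epsilon> > 0\<close> unfolding continuous_on_iff by (metis half_gt_zero)
    \<comment> \<open>The side \<open>s\<close> below satisfies \<open>s * C = d / 2 < d\<close>, so
      the square stays in \<open>S\<close> and in both continuity neighbourhoods.\<close>
    define d where "d = min r (min d1 d2)"
    define s where "s = d / (2 * C)"
    have s: "s > 0" "s * C < d" using r(1) d1(1) d2(1) C by (auto simp: s_def d_def)
    have in_S: "x + p *\<^sub>R w + q *\<^sub>R w' \<in> S"
      if "0 \<le> p" "p \<le> s" "0 \<le> q" "q \<le> s" "norm w + norm w' + 1 = C" for p q w w'
      using close[OF that(1-4) s(2) that(5) s(1)] r(2) by (auto simp: d_def dist_commute)
    obtain p q where pq: "0 < p" "p < s" "0 < q" "q < s"
      and e1: "f (x + s *\<^sub>R u + s *\<^sub>R v) - f (x + s *\<^sub>R u) - f (x + s *\<^sub>R v) + f x =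
        s\<^sup>2 * ?F (x + p *\<^sub>R u + q *\<^sub>R v)"
      using second_difference[OF assms(1,3) s(1), of x u v] in_S[of _ _ u v] by (auto simp: C_def)
    obtain p' q' where pq': "0 < p'" "p' < s" "0 < q'" "q' < s"
      and e2: "f (x + s *\<^sub>R v + s *\<^sub>R u) - f (x + s *\<^sub>R v) - f (x + s *\<^sub>R u) + f x =
        s\<^sup>2 * ?G (x + p' *\<^sub>R v + q' *\<^sub>R u)"
      using second_difference[OF assms(1,3) s(1), of x v u] in_S[of _ _ v u] by (auto simp: C_def)
    have "s\<^sup>2 * ?F (x + p *\<^sub>R u + q *\<^sub>R v) = s\<^sup>2 * ?G (x + p' *\<^sub>R v + q' *\<^sub>R u)"
      unfolding e1[symmetric] e2[symmetric] by (simp add: algebra_simps)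
    then have eq: "?F (x + p *\<^sub>R u + q *\<^sub>R v) = ?G (x + p' *\<^sub>R v + q' *\<^sub>R u)" using s by simp
    have "dist (?F (x + p *\<^sub>R u + q *\<^sub>R v)) (?F x) < \<epsilon> / 2"
      using in_S[OF less_imp_le[OF pq(1)] less_imp_le[OF pq(2)] less_imp_le[OF pq(3)] less_imp_le[OF pq(4)]]
        close[OF less_imp_le[OF pq(1)] less_imp_le[OF pq(2)] less_imp_le[OF pq(3)] less_imp_le[OF pq(4)] s(2) _ s(1)]
      by (intro d1(2)) (simp_all add: C_def d_def)
    moreover have "dist (?G (x + p' *\<^sub>R v + q' *\<^sub>R u)) (?G x) < \<epsilon> / 2"
      using in_S[OF less_imp_le[OF pq'(1)] less_imp_le[OF pq'(2)] less_imp_le[OF pq'(3)] less_imp_le[OF pq'(4)]]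
        close[OF less_imp_le[OF pq'(1)] less_imp_le[OF pq'(2)] less_imp_le[OF pq'(3)] less_imp_le[OF pq'(4)] s(2) _ s(1)]
      by (intro d2(2)) (simp_all add: C_def d_def)
    ultimately show ?thesis unfolding eq
      by (rule dist_triangle_half_r)
  qed
  show ?thesis
  proof (rule ccontr)
    assume "\<not> ?thesis"
    then have "dist (?F x) (?G x) > 0" by (rule iffD2[OF zero_less_dist_iff])
    from dist_small[OF this] show False by (rule less_irrefl[THEN notE])
  qed
qed


section \<open>Bump functions\<close>

text \<open>For \<open>m = 0\<close> this is the standard flat function
  \<open>exp (- 1 / t)\<close>. The powers of \<open>1 / t\<close> are included because the
  derivative of each member is a combination of members, so smoothness of the whole family follows
  by one induction with \<open>m\<close> arbitrary.\<close>

definition flat_exp :: "nat \<Rightarrow> real \<Rightarrow> real" where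
  "flat_exp m t = (if t > 0 then inverse t ^ m * exp (- inverse t) else 0)"

lemma flat_exp_derivative:
  "(flat_exp m has_real_derivative (flat_exp (m + 2) t - real m * flat_exp (m + 1) t)) (at t)"
proof -
  consider "t > 0" | "t < 0" | "t = 0" by linarith
  then show ?thesis
  proof cases
    case 1
    have pw: "inverse t * inverse t ^ (k - Suc 0) = inverse t ^ k \<or> k = 0" for k
      by (cases k) auto
    have "((\<lambda>t. inverse t ^ m * exp (- inverse t)) has_real_derivative
        (flat_exp (m + 2) t - real m * flat_exp (m + 1) t)) (at t)"
      using 1 pw[of "m - 1"] by (cases m) (auto intro!: derivative_eq_intros simp: flat_exp_def algebra_simps power2_eq_square)
    then show ?thesis
      by (rule has_field_derivative_transform_within_open[of _ _ _ "{0<..}"]) (use 1 in \<open>auto simp: flat_exp_def\<close>)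
  next
    case 2
    have "((\<lambda>t. 0) has_real_derivative (flat_exp (m + 2) t - real m * flat_exp (m + 1) t)) (at t)"
      using 2 by (simp add: flat_exp_def)
    then show ?thesis
      by (rule has_field_derivative_transform_within_open[of _ _ _ "{..<0}"]) (use 2 in \<open>auto simp: flat_exp_def\<close>)
  next
    case 3
    \<comment> \<open>Under \<open>x = 1 / t\<close> the difference quotient at 0 from the right
      becomes \<open>x ^ (m + 1) / exp x\<close> at infinity.\<close>
    have "((\<lambda>x::real. x ^ (m + 1) / exp x) \<longlongrightarrow> 0) at_top"
      by (rule tendsto_power_div_exp_0)
    then have "((\<lambda>t::real. inverse t ^ (m + 1) / exp (inverse t)) \<longlongrightarrow> 0) (at_right 0)"
      using filterlim_compose filterlim_inverse_at_top_right by blast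
    then have r: "((\<lambda>t. flat_exp m t / t) \<longlongrightarrow> 0) (at_right 0)"
      by (rule Lim_transform_eventually)
        (auto simp: eventually_at_filter flat_exp_def exp_minus divide_simps power_commutes)
    have l: "((\<lambda>t. flat_exp m t / t) \<longlongrightarrow> 0) (at_left 0)"
      by (rule Lim_transform_eventually[OF tendsto_const])
        (auto simp: eventually_at_filter flat_exp_def)
    show ?thesis
      using filterlim_split_at_real[OF l r] 3 by (simp add: has_field_derivative_iff flat_exp_def)
  qed
qed

lemma smooth_flat_exp: "smooth_on UNIV (flat_exp m)"
proof -
  have "Ck_on k UNIV (flat_exp m)" for k
  proof (induction k arbitrary: m)
    case 0
    then show ?case
      by (auto intro!: continuous_at_imp_continuous_on DERIV_isCont[OF flat_exp_derivative])
  next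
    case (Suc k)
    have D: "(flat_exp m has_derivative (\<lambda>v. (flat_exp (m + 2) t - real m * flat_exp (m + 1) t) * v)) (at t)"
      for t using flat_exp_derivative[of m t] by (simp add: has_field_derivative_def)
    then have "frechet_derivative (flat_exp m) (at t) v =
        flat_exp (m + 2) t * v + flat_exp (m + 1) t * (- real m * v)" for t v
      using frechet_derivative_at[OF D, of t] by (simp add: fun_eq_iff algebra_simps)
    moreover have "Ck_on k UNIV (\<lambda>t. flat_exp (m + 2) t * v + flat_exp (m + 1) t * (- real m * v))" for v
      by (intro Ck_on_add Ck_on_bilinear[OF bounded_bilinear_mult] Suc.IH Ck_on_const open_UNIV)
    moreover have "flat_exp m differentiable (at t)" for t
      using D unfolding differentiable_def by blast
    ultimately show ?case by simp
  qed
  then show ?thesis by (simp add: smooth_on_def)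
qed

lemma flat_exp_mono: "s \<le> t \<Longrightarrow> flat_exp 0 s \<le> flat_exp 0 t"
  by (auto simp: flat_exp_def intro: le_imp_inverse_le)

lemma flat_exp_pos: "t > 0 \<Longrightarrow> flat_exp 0 t > 0"
  by (simp add: flat_exp_def)

text \<open>Two nested copies of the flat function replace the usual quotient. For
  \<open>norm (x - a) < \<rho> / 2\<close> the inner one is 0, so the outer one has the constant
  value \<open>flat_exp 0 C\<close>, which is normalised to 1. For
  \<open>norm (x - a) \<ge> \<rho>\<close> the inner one is at least \<open>C\<close>, so the
  argument of the outer one is not positive and the value is 0. This fixes
  \<open>\<alpha> = \<rho>\<^sup>2 / 4\<close> and \<open>C\<close>.\<close>

lemma smooth_bump:
  fixes a :: "'a::euclidean_space"
  assumes "open S" "a \<in> S"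
  obtains \<phi> :: "'a \<Rightarrow> real" and K r where "smooth_on UNIV \<phi>" "compact K" "K \<subseteq> S"
    "\<And>x. x \<notin> K \<Longrightarrow> \<phi> x = 0" "r > 0" "\<And>x. x \<in> ball a r \<Longrightarrow> \<phi> x = 1"
proof -
  obtain \<rho> where \<rho>: "\<rho> > 0" "cball a \<rho> \<subseteq> S" using assms open_contains_cball by blast
  define \<alpha> where "\<alpha> = \<rho>\<^sup>2 / 4"
  define C where "C = flat_exp 0 (\<rho>\<^sup>2 - \<alpha>)"
  define \<phi> where "\<phi> x = flat_exp 0 (C - flat_exp 0 ((x - a) \<bullet> (x - a) - \<alpha>)) * inverse (flat_exp 0 C)" for x
  have C: "C > 0" using \<rho> by (simp add: C_def \<alpha>_def flat_exp_pos)
  have sm: "smooth_on UNIV (\<lambda>x::'a. x - a)"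
    using smooth_on_add[OF open_UNIV smooth_on_bounded_linear[OF bounded_linear_ident] smooth_on_const[of _ "- a"]]
    by simp
  have "smooth_on UNIV (\<lambda>x. (x - a) \<bullet> (x - a) - \<alpha>)"
    using smooth_on_add[OF open_UNIV smooth_on_inner[OF open_UNIV sm sm] smooth_on_const[of _ "- \<alpha>"]]
    by simp
  then have "smooth_on UNIV (\<lambda>x. flat_exp 0 ((x - a) \<bullet> (x - a) - \<alpha>))"
    by (rule smooth_on_compose[OF open_UNIV open_UNIV _ subset_UNIV smooth_flat_exp])
  then have "smooth_on UNIV (\<lambda>x. C + (- 1) * flat_exp 0 ((x - a) \<bullet> (x - a) - \<alpha>))"
    by (intro smooth_on_add smooth_on_mult smooth_on_const open_UNIV)
  then have "smooth_on UNIV (\<lambda>x. flat_exp 0 (C + (- 1) * flat_exp 0 ((x - a) \<bullet> (x - a) - \<alpha>)))"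
    by (rule smooth_on_compose[OF open_UNIV open_UNIV _ subset_UNIV smooth_flat_exp])
  then have "smooth_on UNIV \<phi>"
    unfolding \<phi>_def by (intro smooth_on_mult smooth_on_const open_UNIV) simp
  moreover have "\<phi> x = 0" if "x \<notin> cball a \<rho>" for x
  proof -
    have "\<rho> \<le> norm (x - a)" using that by (simp add: dist_norm norm_minus_commute)
    then have "\<rho>\<^sup>2 \<le> (x - a) \<bullet> (x - a)" using \<rho>(1) by (simp add: power2_norm_eq_inner[symmetric] power_mono)
    then have "C \<le> flat_exp 0 ((x - a) \<bullet> (x - a) - \<alpha>)" unfolding C_def by (intro flat_exp_mono) simp
    then show ?thesis by (simp add: \<phi>_def flat_exp_def[of 0 "C - _"])
  qed
  moreover have "\<phi> x = 1" if "x \<in> ball a (\<rho> / 2)" for x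
  proof -
    have "norm (x - a) < \<rho> / 2" using that by (simp add: dist_norm norm_minus_commute)
    then have "(norm (x - a))\<^sup>2 < (\<rho> / 2)\<^sup>2" by (intro power_strict_mono) auto
    then have "flat_exp 0 ((x - a) \<bullet> (x - a) - \<alpha>) = 0"
      by (simp add: power2_norm_eq_inner \<alpha>_def flat_exp_def power_divide)
    then show ?thesis using flat_exp_pos[OF C] by (simp add: \<phi>_def)
  qed
  ultimately show thesis using that[of \<phi> "cball a \<rho>" "\<rho> / 2"] \<rho> by simp
qed


section \<open>Tangent vectors and vector fields\<close>

lemma scaleR_fun_apply [simp]: "(a *\<^sub>R f) x = a *\<^sub>R f x"
  by (simp add: scaleR_fun_def)

lemma uminus_fun_apply [simp]: "(- f) x = - f x"
  by (simp add: fun_Compl_def)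

lemma minus_fun_apply [simp]: "(f - g) x = f x - g x"
  by (simp add: fun_diff_def)

lemma sum_fun_apply [simp]: "(\<Sum>i\<in>I. f i) x = (\<Sum>i\<in>I. f i x)"
  by (induction I rule: infinite_finite_induct) auto

locale smooth_manifold =
  fixes A :: "('m::t2_space, 'n::finite) chart set"
  assumes atlas: "smooth_atlas A"
begin

section \<open>Charts and transition maps\<close>

lemma charts_atD: "c \<in> charts_at A p \<Longrightarrow> c \<in> A" "c \<in> charts_at A p \<Longrightarrow> p \<in> chart_dom c"
  and charts_atI: "c \<in> A \<Longrightarrow> p \<in> chart_dom c \<Longrightarrow> c \<in> charts_at A p"
  by (auto simp: charts_at_def)

lemma ex_chart_at: "\<exists>c. c \<in> charts_at A p"
  using atlas unfolding smooth_atlas_def charts_at_def by blast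

lemma
  assumes "c \<in> A"
  shows open_dom: "open (chart_dom c)"
    and open_cod: "open (chart_cod c)"
    and chart_homeomorphism: "homeomorphism (chart_dom c) (chart_cod c) (coords c) (chart_inv c)"
  using atlas assms unfolding smooth_atlas_def by auto

lemma coords_inv: "c \<in> A \<Longrightarrow> x \<in> chart_cod c \<Longrightarrow> coords c (chart_inv c x) = x"
  and inv_coords: "c \<in> A \<Longrightarrow> q \<in> chart_dom c \<Longrightarrow> chart_inv c (coords c q) = q"
  and inv_dom: "c \<in> A \<Longrightarrow> x \<in> chart_cod c \<Longrightarrow> chart_inv c x \<in> chart_dom c"
  and coords_cod: "q \<in> chart_dom c \<Longrightarrow> coords c q \<in> chart_cod c"
  using chart_homeomorphism[of c] by (auto simp: homeomorphism_def chart_cod_def)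

lemma continuous_inv: "c \<in> A \<Longrightarrow> continuous_on (chart_cod c) (chart_inv c)"
  and continuous_coords: "c \<in> A \<Longrightarrow> continuous_on (chart_dom c) (coords c)"
  using chart_homeomorphism[of c] by (auto simp: homeomorphism_def)

lemma coords_image_eq:
  "c \<in> A \<Longrightarrow> coords c ` (chart_dom c \<inter> U) = {x \<in> chart_cod c. chart_inv c x \<in> U}"
proof safe
  fix x assume "c \<in> A" "x \<in> chart_cod c" "chart_inv c x \<in> U"
  then show "x \<in> coords c ` (chart_dom c \<inter> U)"
    by (intro image_eqI[of _ _ "chart_inv c x"]) (auto simp: coords_inv inv_dom)
qed (auto simp: inv_coords coords_cod)

lemma open_coords_image: "c \<in> A \<Longrightarrow> open U \<Longrightarrow> open (coords c ` (chart_dom c \<inter> U))"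
  using continuous_open_preimage[OF continuous_inv open_cod, of c U]
  unfolding coords_image_eq by (simp add: vimage_def Int_def)

abbreviation transition where "transition c d \<equiv> coords d \<circ> chart_inv c"

abbreviation overlap where "overlap c d \<equiv> coords c ` (chart_dom c \<inter> chart_dom d)"

lemma smooth_trans: "c \<in> A \<Longrightarrow> d \<in> A \<Longrightarrow> smooth_on (overlap c d) (transition c d)"
  using atlas unfolding smooth_atlas_def by blast

lemma open_overlap: "c \<in> A \<Longrightarrow> d \<in> A \<Longrightarrow> open (overlap c d)"
  by (simp add: open_coords_image open_dom)

lemma trans_overlap: "c \<in> A \<Longrightarrow> d \<in> A \<Longrightarrow> transition c d ` overlap c d \<subseteq> overlap d c"
  by (auto simp: inv_coords)

lemma trans_coords: "c \<in> A \<Longrightarrow> q \<in> chart_dom c \<Longrightarrow> transition c d (coords c q) = coords d q"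
  by (simp add: inv_coords)

abbreviation Dtrans where
  "Dtrans c d q \<equiv> frechet_derivative (transition c d) (at (coords c q))"

lemma trans_differentiable:
  "c \<in> charts_at A q \<Longrightarrow> d \<in> charts_at A q \<Longrightarrow> transition c d differentiable (at (coords c q))"
  by (rule smooth_on_differentiable[OF smooth_trans]) (auto dest: charts_atD)

lemma Dtrans_linear: "c \<in> charts_at A q \<Longrightarrow> d \<in> charts_at A q \<Longrightarrow> linear (Dtrans c d q)"
  by (simp add: linear_frechet_derivative trans_differentiable)

lemma Dtrans_self: "c \<in> charts_at A q \<Longrightarrow> Dtrans c c q \<xi> = \<xi>"
proof -
  assume c: "c \<in> charts_at A q"
  have "frechet_derivative (\<lambda>x. x) (at (coords c q)) = Dtrans c c q"
    by (rule frechet_derivative_cong_open[of "chart_cod c"])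
      (use charts_atD[OF c] in \<open>auto simp: open_cod coords_cod coords_inv\<close>)
  then show ?thesis by (metis frechet_derivative_ident)
qed

text \<open>The cocycle condition, which is the chain rule for
  \<open>transition c e = transition d e \<circ> transition c d\<close> near
  \<open>coords c q\<close>. It is what makes the family built by \<open>tvec_of\<close>
  consistent.\<close>

lemma Dtrans_trans:
  assumes "c \<in> charts_at A q" "d \<in> charts_at A q" "e \<in> charts_at A q"
  shows "Dtrans d e q (Dtrans c d q \<xi>) = Dtrans c e q \<xi>"
proof -
  note A = charts_atD[OF assms(1)] charts_atD[OF assms(2)] charts_atD[OF assms(3)]
  have "Dtrans c e q = frechet_derivative (transition d e \<circ> transition c d) (at (coords c q))"
    by (rule frechet_derivative_cong_open[OF open_overlap[OF A(1,3)]]) (use A in \<open>auto simp: inv_coords\<close>)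
  moreover have "frechet_derivative (transition d e \<circ> transition c d) (at (coords c q)) = Dtrans d e q \<circ> Dtrans c d q"
    using frechet_derivative_compose[OF trans_differentiable[OF assms(1,2)], of "transition d e"]
      trans_differentiable[OF assms(2,3)] trans_coords[OF A(1,2), of d] by simp
  ultimately show ?thesis by (metis comp_apply)
qed

text \<open>The tangent vector with prescribed coordinates \<open>\<xi>\<close> in one chart;
  inverse to reading off the representative in that chart, provided \<open>c\<close> is a chart at
  \<open>q\<close>.\<close>

definition tvec_of :: "('m, 'n) chart \<Rightarrow> 'm \<Rightarrow> real^'n \<Rightarrow> ('m, 'n) tvec" where
  "tvec_of c q \<xi> = (\<lambda>d. if d \<in> charts_at A q then Dtrans c d q \<xi> else 0)"

lemma tvec_of_in_tangent_space: "c \<in> charts_at A q \<Longrightarrow> tvec_of c q \<xi> \<in> tangent_space A q"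
  by (simp add: tangent_space_def tvec_of_def Dtrans_trans)

lemma tvec_of_chart: "c \<in> charts_at A q \<Longrightarrow> tvec_of c q \<xi> c = \<xi>"
  by (simp add: tvec_of_def Dtrans_self)

lemma tangent_space_trans:
  "v \<in> tangent_space A q \<Longrightarrow> c \<in> charts_at A q \<Longrightarrow> d \<in> charts_at A q \<Longrightarrow> v d = Dtrans c d q (v c)"
  unfolding tangent_space_def by blast

lemma tangent_space_eq_0: "v \<in> tangent_space A q \<Longrightarrow> c \<notin> charts_at A q \<Longrightarrow> v c = 0"
  unfolding tangent_space_def by blast

text \<open>The representative in one chart determines all others, so identities between families of
  vectors reduce to a single identity in \<open>real^'n\<close>.\<close>

lemma tangent_space_eqI:
  assumes "u \<in> tangent_space A q" "v \<in> tangent_space A q" "c \<in> charts_at A q" "u c = v c"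
  shows "u = v"
proof
  fix d
  show "u d = v d"
  proof (cases "d \<in> charts_at A q")
    case True
    show ?thesis
      using tangent_space_trans[OF assms(1,3) True] tangent_space_trans[OF assms(2,3) True] assms(4)
      by (simp only:)
  qed (simp add: tangent_space_eq_0[OF assms(1)] tangent_space_eq_0[OF assms(2)])
qed

lemma tvec_of_rep: "c \<in> charts_at A q \<Longrightarrow> v \<in> tangent_space A q \<Longrightarrow> tvec_of c q (v c) = v"
  by (rule tangent_space_eqI) (auto simp: tvec_of_in_tangent_space tvec_of_chart)

lemma tangent_spaceI:
  assumes "\<And>c. c \<notin> charts_at A q \<Longrightarrow> v c = 0"
    and "\<And>c d. c \<in> charts_at A q \<Longrightarrow> d \<in> charts_at A q \<Longrightarrow> v d = Dtrans c d q (v c)"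
  shows "v \<in> tangent_space A q"
  using assms unfolding tangent_space_def by blast

lemma subspace_tangent_space: "subspace (tangent_space A q)"
  unfolding subspace_def
proof (intro conjI ballI allI)
  show "0 \<in> tangent_space A q"
    by (rule tangent_spaceI) (simp_all add: linear_0[OF Dtrans_linear])
next
  fix u v assume uv: "u \<in> tangent_space A q" "v \<in> tangent_space A q"
  show "u + v \<in> tangent_space A q"
  proof (rule tangent_spaceI)
    fix c d assume cd: "c \<in> charts_at A q" "d \<in> charts_at A q"
    show "(u + v) d = Dtrans c d q ((u + v) c)"
      unfolding plus_fun_apply linear_add[OF Dtrans_linear[OF cd]]
        tangent_space_trans[OF uv(1) cd] tangent_space_trans[OF uv(2) cd] ..
  qed (simp add: uv[THEN tangent_space_eq_0])
next
  fix a v assume v: "v \<in> tangent_space A q"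
  show "a *\<^sub>R v \<in> tangent_space A q"
  proof (rule tangent_spaceI)
    fix c d assume cd: "c \<in> charts_at A q" "d \<in> charts_at A q"
    show "(a *\<^sub>R v) d = Dtrans c d q ((a *\<^sub>R v) c)"
      unfolding scaleR_fun_apply linear_scale[OF Dtrans_linear[OF cd]] tangent_space_trans[OF v cd] ..
  qed (simp add: v[THEN tangent_space_eq_0])
qed

lemmas tangent_space_closed =
  subspace_0[OF subspace_tangent_space] subspace_add[OF subspace_tangent_space]
  subspace_diff[OF subspace_tangent_space] subspace_scale[OF subspace_tangent_space]
  subspace_neg[OF subspace_tangent_space] subspace_sum[OF subspace_tangent_space]

lemma linear_tvec_of: "c \<in> charts_at A q \<Longrightarrow> linear (tvec_of c q)"
  by (rule linearI; rule tangent_space_eqI[of _ q _ c])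
    (auto simp: tvec_of_in_tangent_space tvec_of_chart tangent_space_closed)

section \<open>Smooth vector fields and extension by zero\<close>

lemma vfield_tangent: "X \<in> smooth_vfields A \<Longrightarrow> X q \<in> tangent_space A q"
  by (simp add: smooth_vfields_def)

lemma vfield_smooth: "X \<in> smooth_vfields A \<Longrightarrow> c \<in> A \<Longrightarrow> smooth_on (chart_cod c) (coord_rep X c)"
  by (simp add: smooth_vfields_def)

lemma smooth_fun_chart: "smooth_fun A f \<Longrightarrow> c \<in> A \<Longrightarrow> smooth_on (chart_cod c) (f \<circ> chart_inv c)"
  by (simp add: smooth_fun_def)

lemma smooth_vfieldsI:
  assumes "\<And>p. X p \<in> tangent_space A p"
    and "\<And>c. c \<in> A \<Longrightarrow> smooth_on (chart_cod c) (\<lambda>x. X (chart_inv c x) c)"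
  shows "X \<in> smooth_vfields A"
  using assms by (simp add: smooth_vfields_def coord_rep_def[abs_def])

lemma vfield_smooth': "X \<in> smooth_vfields A \<Longrightarrow> c \<in> A \<Longrightarrow> smooth_on (chart_cod c) (\<lambda>x. X (chart_inv c x) c)"
  by (simp add: smooth_vfields_def coord_rep_def[abs_def])

lemma smooth_vfields_add:
  assumes "X \<in> smooth_vfields A" "Y \<in> smooth_vfields A"
  shows "X + Y \<in> smooth_vfields A"
  by (rule smooth_vfieldsI)
    (simp_all add: tangent_space_closed vfield_tangent vfield_smooth' smooth_on_add open_cod assms)

lemma smooth_fun_const: "smooth_fun A (\<lambda>_. a)"
  by (simp add: smooth_fun_def o_def smooth_on_const)

lemma smooth_vfields_fun_scale:
  assumes "smooth_fun A f" "X \<in> smooth_vfields A"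
  shows "fun_scale f X \<in> smooth_vfields A"
proof (rule smooth_vfieldsI)
  fix c assume c: "c \<in> A"
  show "smooth_on (chart_cod c) (\<lambda>x. fun_scale f X (chart_inv c x) c)"
    using smooth_on_scaleR[OF open_cod[OF c] smooth_fun_chart[OF assms(1) c] vfield_smooth'[OF assms(2) c]]
    by (simp add: fun_scale_def o_def)
qed (simp add: fun_scale_def tangent_space_closed vfield_tangent assms)

lemma smooth_vfields_scaleR: "X \<in> smooth_vfields A \<Longrightarrow> a *\<^sub>R X \<in> smooth_vfields A"
  using smooth_vfields_fun_scale[OF smooth_fun_const, of X a]
  by (simp add: fun_scale_def scaleR_fun_def[of a X])

lemma smooth_vfields_0: "0 \<in> smooth_vfields A"
  by (rule smooth_vfieldsI) (simp_all add: tangent_space_closed smooth_on_const)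

lemma subspace_smooth_vfields: "subspace (smooth_vfields A)"
  by (simp add: subspace_def smooth_vfields_0 smooth_vfields_add smooth_vfields_scaleR)

lemmas smooth_vfields_closed =
  subspace_0[OF subspace_smooth_vfields] subspace_add[OF subspace_smooth_vfields]
  subspace_diff[OF subspace_smooth_vfields] subspace_scale[OF subspace_smooth_vfields]
  subspace_neg[OF subspace_smooth_vfields] subspace_sum[OF subspace_smooth_vfields]

text \<open>The image of \<open>K\<close> is compact, hence closed because the manifold is
  Hausdorff. The codomain of \<open>d\<close> is therefore covered by two open sets, the overlap
  with \<open>c\<close> and the points outside that image, where \<open>F\<close> vanishes;
  \<open>F\<close> is smooth on each.\<close>

lemma smooth_extend_by_0:
  assumes "c \<in> A" "d \<in> A" "compact K" "K \<subseteq> chart_cod c"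
    and F: "smooth_on (overlap d c) F"
    and 0: "\<And>y. y \<in> chart_cod d \<Longrightarrow> chart_inv d y \<notin> chart_inv c ` K \<Longrightarrow> F y = 0"
  shows "smooth_on (chart_cod d) F"
proof -
  define U where "U = - (chart_inv c ` K)"
  have "compact (chart_inv c ` K)"
    using assms(3) continuous_on_subset[OF continuous_inv[OF assms(1)] assms(4)]
    by (rule compact_continuous_image[rotated])
  then have U: "open U" unfolding U_def by (simp add: compact_imp_closed open_Compl)
  define W where "W = coords d ` (chart_dom d \<inter> U)"
  have oW: "open W" unfolding W_def using assms(2) U by (rule open_coords_image)
  have "smooth_on W F"
    by (rule smooth_on_cong[OF oW _ smooth_on_const[of _ 0]])
      (use 0 assms(2) in \<open>auto simp: W_def U_def inv_coords coords_cod\<close>)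
  then have "smooth_on (overlap d c \<union> W) F"
    using smooth_on_Un[OF open_overlap[OF assms(2,1)] oW F] by simp
  moreover have "chart_cod d \<subseteq> overlap d c \<union> W"
    unfolding W_def coords_image_eq[OF assms(2)]
    using assms(1,4) inv_dom[OF assms(1)] by (auto simp: U_def)
  ultimately show ?thesis by (rule smooth_on_subset)
qed

definition extend_fun :: "('m, 'n) chart \<Rightarrow> (real^'n \<Rightarrow> real) \<Rightarrow> 'm \<Rightarrow> real" where
  "extend_fun c \<phi> q = (if q \<in> chart_dom c then \<phi> (coords c q) else 0)"

definition extend_vfield :: "('m, 'n) chart \<Rightarrow> (real^'n \<Rightarrow> real^'n) \<Rightarrow> ('m, 'n) vfield" where
  "extend_vfield c \<Xi> q = (if q \<in> chart_dom c then tvec_of c q (\<Xi> (coords c q)) else 0)"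

lemma not_in_image_inv:
  "c \<in> A \<Longrightarrow> q \<in> chart_dom c \<Longrightarrow> q \<notin> chart_inv c ` K \<Longrightarrow> coords c q \<notin> K"
  by (metis image_eqI inv_coords)

lemma smooth_extend_fun:
  assumes "c \<in> A" "compact K" "K \<subseteq> chart_cod c" "smooth_on (chart_cod c) \<phi>"
    and "\<And>x. x \<notin> K \<Longrightarrow> \<phi> x = 0"
  shows "smooth_fun A (extend_fun c \<phi>)"
  unfolding smooth_fun_def
proof
  fix d assume d: "d \<in> A"
  have "smooth_on (overlap d c) (\<lambda>y. \<phi> (transition d c y))"
    by (rule smooth_on_compose[OF open_overlap[OF d assms(1)] open_cod[OF assms(1)]
          smooth_trans[OF d assms(1)] _ assms(4)]) (use d in \<open>auto simp: inv_coords coords_cod\<close>)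
  then have "smooth_on (overlap d c) (extend_fun c \<phi> \<circ> chart_inv d)"
    by (rule smooth_on_cong[OF open_overlap[OF d assms(1)], rotated])
      (use d in \<open>auto simp: inv_coords extend_fun_def\<close>)
  then show "smooth_on (chart_cod d) (extend_fun c \<phi> \<circ> chart_inv d)"
    by (rule smooth_extend_by_0[OF assms(1) d assms(2,3)])
      (auto simp: extend_fun_def intro!: assms(5) dest: not_in_image_inv[OF assms(1)])
qed

lemma smooth_extend_vfield:
  assumes "c \<in> A" "compact K" "K \<subseteq> chart_cod c" "smooth_on (chart_cod c) \<Xi>"
    and "\<And>x. x \<notin> K \<Longrightarrow> \<Xi> x = 0"
  shows "extend_vfield c \<Xi> \<in> smooth_vfields A"
  unfolding smooth_vfields_def mem_Collect_eq
proof (intro conjI allI ballI)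
  show "extend_vfield c \<Xi> p \<in> tangent_space A p" for p
    using assms(1) by (simp add: extend_vfield_def tvec_of_in_tangent_space charts_atI tangent_space_closed)
  fix d assume d: "d \<in> A"
  \<comment> \<open>The field in the coordinates of \<open>d\<close> is
    \<open>D(transition c d) \<Xi>\<close>, first viewed as a function of the coordinates of
    \<open>c\<close>, then pulled back by the inverse transition.\<close>
  have "smooth_on (overlap c d) (\<lambda>x. frechet_derivative (transition c d) (at x) (\<Xi> x))"
    by (rule smooth_on_directional_derivative[OF open_overlap[OF assms(1) d] smooth_trans[OF assms(1) d]])
      (rule smooth_on_subset[OF assms(4)], auto simp: coords_cod)
  then have "smooth_on (overlap d c) (\<lambda>y. frechet_derivative (transition c d) (at (transition d c y)) (\<Xi> (transition d c y)))"
    by (rule smooth_on_compose[OF open_overlap[OF d assms(1)] open_overlap[OF assms(1) d]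
          smooth_trans[OF d assms(1)] trans_overlap[OF d assms(1)]])
  then have "smooth_on (overlap d c) (coord_rep (extend_vfield c \<Xi>) d)"
    by (rule smooth_on_cong[OF open_overlap[OF d assms(1)], rotated])
      (use d assms(1) in \<open>auto simp: inv_coords extend_vfield_def coord_rep_def tvec_of_def charts_atI\<close>)
  then show "smooth_on (chart_cod d) (coord_rep (extend_vfield c \<Xi>) d)"
  proof (rule smooth_extend_by_0[OF assms(1) d assms(2,3)])
    fix y assume "chart_inv d y \<notin> chart_inv c ` K"
    then show "coord_rep (extend_vfield c \<Xi>) d y = 0"
      using assms(5)[OF not_in_image_inv[OF assms(1)]] linear_0[OF linear_tvec_of[OF charts_atI[OF assms(1)]]]
      by (simp add: extend_vfield_def coord_rep_def)
  qed
qed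

text \<open>The definition evaluates in an arbitrarily chosen chart. The chain rule and the
  transformation law of \<open>X p\<close> cancel each other when the chart is changed.\<close>

lemma vf_deriv_chart:
  assumes "c \<in> charts_at A p" "smooth_fun A f" "X p \<in> tangent_space A p"
  shows "vf_deriv A X f p = frechet_derivative (f \<circ> chart_inv c) (at (coords c p)) (X p c)"
proof -
  define d where "d = (SOME d. d \<in> charts_at A p)"
  have d: "d \<in> charts_at A p" unfolding d_def by (rule someI_ex[OF ex_chart_at])
  note A = charts_atD[OF assms(1)] charts_atD[OF d]
  have "frechet_derivative (f \<circ> chart_inv d) (at (coords d p)) =
      frechet_derivative ((f \<circ> chart_inv c) \<circ> transition d c) (at (coords d p))"
    by (rule frechet_derivative_cong_open[OF open_overlap[OF A(3,1)]]) (use A in \<open>auto simp: inv_coords\<close>)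
  moreover have "\<dots> = frechet_derivative (f \<circ> chart_inv c) (at (transition d c (coords d p))) \<circ> Dtrans d c p"
    by (rule frechet_derivative_compose)
      (use trans_differentiable[OF d assms(1)] A in
        \<open>auto intro!: smooth_on_differentiable[OF smooth_fun_chart[OF assms(2)]] simp: inv_coords coords_cod\<close>)
  moreover have "X p c = Dtrans d c p (X p d)"
    by (rule tangent_space_trans[OF assms(3) d assms(1)])
  ultimately show ?thesis
    using trans_coords[OF A(3,4), of c] unfolding vf_deriv_def d_def[symmetric] Let_def by simp
qed

lemma vf_deriv_rep:
  assumes "c \<in> A" "smooth_fun A f" "X \<in> smooth_vfields A" "x \<in> chart_cod c"
  shows "vf_deriv A X f (chart_inv c x) = frechet_derivative (f \<circ> chart_inv c) (at x) (coord_rep X c x)"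
  using vf_deriv_chart[OF charts_atI[OF assms(1) inv_dom[OF assms(1,4)]] assms(2), of X] vfield_tangent[OF assms(3)]
  by (simp add: coord_rep_def coords_inv assms)

lemma smooth_vf_deriv:
  assumes "smooth_fun A f" "X \<in> smooth_vfields A"
  shows "smooth_fun A (vf_deriv A X f)"
  unfolding smooth_fun_def
proof
  fix c assume c: "c \<in> A"
  show "smooth_on (chart_cod c) (vf_deriv A X f \<circ> chart_inv c)"
    by (rule smooth_on_cong[OF open_cod[OF c] _ smooth_on_directional_derivative[OF open_cod[OF c]
            smooth_fun_chart[OF assms(1) c] vfield_smooth[OF assms(2) c]]])
      (simp only: o_apply vf_deriv_rep[OF c assms])
qed

end


section \<open>Tensoriality\<close>

lemma frechet_derivative_directional_sum:
  fixes F :: "'a::euclidean_space \<Rightarrow> 'b::real_normed_vector"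
  assumes "open S" "x \<in> S" "smooth_on S F" "smooth_on S X"
  shows "frechet_derivative (\<lambda>y. frechet_derivative F (at y) (X y)) (at x) w =
    (\<Sum>b\<in>Basis. (X x \<bullet> b) *\<^sub>R frechet_derivative (\<lambda>y. frechet_derivative F (at y) b) (at x) w) +
    frechet_derivative F (at x) (frechet_derivative X (at x) w)"
proof -
  note dF = smooth_on_differentiable[OF assms(3)]
  have DF: "((\<lambda>y. frechet_derivative F (at y) b) has_derivative
      frechet_derivative (\<lambda>y. frechet_derivative F (at y) b) (at x)) (at x)" for b
    using smooth_on_differentiable[OF smooth_on_derivative[OF assms(3)] assms(2)]
    by (simp add: frechet_derivative_works)
  have DX: "(X has_derivative frechet_derivative X (at x)) (at x)"
    using smooth_on_differentiable[OF assms(4,2)] by (simp add: frechet_derivative_works)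
  have D: "((\<lambda>y. \<Sum>b\<in>Basis. (X y \<bullet> b) *\<^sub>R frechet_derivative F (at y) b) has_derivative
      (\<lambda>w. \<Sum>b\<in>Basis. (X x \<bullet> b) *\<^sub>R frechet_derivative (\<lambda>y. frechet_derivative F (at y) b) (at x) w +
        (frechet_derivative X (at x) w \<bullet> b) *\<^sub>R frechet_derivative F (at x) b)) (at x)"
    by (intro has_derivative_sum has_derivative_scaleR DF has_derivative_inner_left DX)
  have "frechet_derivative (\<lambda>y. \<Sum>b\<in>Basis. (X y \<bullet> b) *\<^sub>R frechet_derivative F (at y) b) (at x) w =
      (\<Sum>b\<in>Basis. (X x \<bullet> b) *\<^sub>R frechet_derivative (\<lambda>y. frechet_derivative F (at y) b) (at x) w) +
      frechet_derivative F (at x) (frechet_derivative X (at x) w)"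
    unfolding frechet_derivative_at[OF D, symmetric] sum.distrib
      frechet_derivative_basis_sum[OF dF[OF assms(2)], of "frechet_derivative X (at x) w"] ..
  moreover have "frechet_derivative (\<lambda>y. frechet_derivative F (at y) (X y)) (at x) =
      frechet_derivative (\<lambda>y. \<Sum>b\<in>Basis. (X y \<bullet> b) *\<^sub>R frechet_derivative F (at y) b) (at x)"
    by (rule frechet_derivative_cong_open[OF assms(1,2)]) (rule frechet_derivative_basis_sum[OF dF])
  ultimately show ?thesis by simp
qed

text \<open>By the product rule, differentiation hits either the coefficient or the direction. The
  first part is the same expression with the field frozen at \<open>X x\<close>, since a constant
  field contributes no second part.\<close>

lemma frechet_derivative_directional:
  fixes F :: "'a::euclidean_space \<Rightarrow> 'b::real_normed_vector"
  assumes "open S" "x \<in> S" "smooth_on S F" "smooth_on S X"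
  shows "frechet_derivative (\<lambda>y. frechet_derivative F (at y) (X y)) (at x) w =
    frechet_derivative (\<lambda>y. frechet_derivative F (at y) (X x)) (at x) w +
    frechet_derivative F (at x) (frechet_derivative X (at x) w)"
  using frechet_derivative_directional_sum[OF assms, of w]
    frechet_derivative_directional_sum[OF assms(1-3) smooth_on_const[of S "X x"], of w]
    linear_0[OF linear_frechet_derivative[OF smooth_on_differentiable[OF assms(3,2)]]]
  by simp

context smooth_manifold
begin

lemma fun_scale_apply: "fun_scale f X p = f p *\<^sub>R X p"
  by (simp add: fun_scale_def)

lemma lie_bracket_chart:
  assumes "c \<in> charts_at A p"
  shows "lie_bracket A X Y p c = frechet_derivative (coord_rep Y c) (at (coords c p)) (X p c)
    - frechet_derivative (coord_rep X c) (at (coords c p)) (Y p c)"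
  using assms by (simp add: lie_bracket_def)

text \<open>In a chart the second-order terms are the two mixed derivatives of \<open>f\<close> and
  cancel by symmetry; the first-order terms form the bracket. Tangency of the bracket is assumed
  here and supplied later by the torsion-free connection, so the transformation law of the bracket
  is never computed.\<close>

lemma vf_deriv_lie_bracket:
  assumes f: "smooth_fun A f" and W: "W \<in> smooth_vfields A" and X: "X \<in> smooth_vfields A"
    and WX: "lie_bracket A W X p \<in> tangent_space A p"
  shows "vf_deriv A (lie_bracket A W X) f p =
    vf_deriv A W (vf_deriv A X f) p - vf_deriv A X (vf_deriv A W f) p"
proof -
  obtain c where c: "c \<in> charts_at A p" using ex_chart_at by blast
  note cA = charts_atD[OF c]
  define F x S where "F = f \<circ> chart_inv c" and "x = coords c p" and "S = chart_cod c"
  have S: "open S" "x \<in> S" by (simp_all add: S_def x_def open_cod coords_cod cA)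
  have F: "smooth_on S F" unfolding F_def S_def by (rule smooth_fun_chart[OF f cA(1)])
  have rep: "coord_rep Z c x = Z p c" for Z by (simp add: coord_rep_def x_def inv_coords cA)
  have D: "vf_deriv A Y (vf_deriv A Z f) p =
      frechet_derivative (\<lambda>y. frechet_derivative F (at y) (Z p c)) (at x) (Y p c) +
      frechet_derivative F (at x) (frechet_derivative (coord_rep Z c) (at x) (Y p c))"
    if Y: "Y \<in> smooth_vfields A" and Z: "Z \<in> smooth_vfields A" for Y Z
  proof -
    have "vf_deriv A Y (vf_deriv A Z f) p = frechet_derivative (vf_deriv A Z f \<circ> chart_inv c) (at x) (Y p c)"
      unfolding x_def by (rule vf_deriv_chart[OF c smooth_vf_deriv[OF f Z]]) (rule vfield_tangent[OF Y])
    also have "frechet_derivative (vf_deriv A Z f \<circ> chart_inv c) (at x) =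
        frechet_derivative (\<lambda>y. frechet_derivative F (at y) (coord_rep Z c y)) (at x)"
      by (rule frechet_derivative_cong_open[OF S])
        (simp add: F_def S_def vf_deriv_rep[OF cA(1) f Z])
    finally show ?thesis
      using frechet_derivative_directional[OF S F, of "coord_rep Z c"] vfield_smooth[OF Z cA(1)]
      by (simp add: S_def rep)
  qed
  have sym: "frechet_derivative (\<lambda>y. frechet_derivative F (at y) u) (at x) v =
      frechet_derivative (\<lambda>y. frechet_derivative F (at y) v) (at x) u" for u v
    by (rule second_derivative_symmetric[OF S]) (use F in \<open>simp add: smooth_on_def\<close>)
  interpret F: linear "frechet_derivative F (at x)"
    by (rule linear_frechet_derivative[OF smooth_on_differentiable[OF F S(2)]])
  have "vf_deriv A (lie_bracket A W X) f p = frechet_derivative F (at x) (lie_bracket A W X p c)"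
    unfolding F_def x_def by (rule vf_deriv_chart[OF c f]) (rule WX)
  then show ?thesis
    unfolding D[OF W X] D[OF X W] sym[of "X p c" "W p c"] lie_bracket_chart[OF c] x_def[symmetric]
    by (simp add: F.diff)
qed

lemma bump_at:
  assumes "c \<in> charts_at A p" "open U" "p \<in> U"
  obtains \<phi> K r where "smooth_on UNIV \<phi>" "compact K" "K \<subseteq> coords c ` (chart_dom c \<inter> U)"
    "K \<subseteq> chart_cod c" "\<And>x. x \<notin> K \<Longrightarrow> \<phi> x = (0::real)" "r > 0" "\<phi> (coords c p) = 1"
    "\<And>x. x \<in> ball (coords c p) r \<Longrightarrow> \<phi> x = 1"
proof -
  have "coords c p \<in> coords c ` (chart_dom c \<inter> U)"
    using charts_atD[OF assms(1)] assms(3) by blast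
  from smooth_bump[OF open_coords_image[OF charts_atD(1)[OF assms(1)] assms(2)] this]
  obtain \<phi> :: "real^'n \<Rightarrow> real" and K r where *: "smooth_on UNIV \<phi>" "compact K" "K \<subseteq> coords c ` (chart_dom c \<inter> U)"
    "\<And>x. x \<notin> K \<Longrightarrow> \<phi> x = 0" "r > 0" "\<And>x. x \<in> ball (coords c p) r \<Longrightarrow> \<phi> x = 1" by metis
  have "K \<subseteq> chart_cod c" using *(3) by (auto simp: chart_cod_def)
  then show thesis using that[of \<phi> K r] * by simp
qed

text \<open>With a bump function \<open>\<phi>\<close> at \<open>p\<close>, the field \<open>\<phi>\<^sup>2 X\<close> is the combination of the global fields
  \<open>\<phi> \<partial>\<^sub>i\<close> with the global coefficients \<open>\<phi> X\<^sup>i\<close>, all of which vanish at \<open>p\<close> if \<open>X\<close> does.\<close>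

lemma tensorial_at_zero:
  fixes T :: "('m, 'n) vfield \<Rightarrow> 'v::real_vector"
  assumes add: "\<And>X Y. X \<in> smooth_vfields A \<Longrightarrow> Y \<in> smooth_vfields A \<Longrightarrow> T (X + Y) = T X + T Y"
    and scale: "\<And>f X. smooth_fun A f \<Longrightarrow> X \<in> smooth_vfields A \<Longrightarrow> T (fun_scale f X) = f p *\<^sub>R T X"
    and X: "X \<in> smooth_vfields A" "X p = 0"
  shows "T X = 0"
proof -
  obtain c where c: "c \<in> charts_at A p" using ex_chart_at by blast
  note cA = charts_atD[OF c]
  obtain \<phi> K where \<phi>: "smooth_on UNIV \<phi>" "compact K" "K \<subseteq> chart_cod c"
    "\<And>x. x \<notin> K \<Longrightarrow> \<phi> x = (0::real)" "\<phi> (coords c p) = 1"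
    using bump_at[OF c open_UNIV UNIV_I] by metis
  have \<phi>c: "smooth_on (chart_cod c) \<phi>" using smooth_on_subset[OF \<phi>(1)] by simp
  note oc = open_cod[OF cA(1)]
  define E where "E i = extend_vfield c (\<lambda>y. \<phi> y *\<^sub>R axis i 1)" for i
  define F where "F i = extend_fun c (\<lambda>y. \<phi> y * (coord_rep X c y \<bullet> axis i 1))" for i
  define P where "P = extend_fun c (\<lambda>y. \<phi> y * \<phi> y)"
  have E: "E i \<in> smooth_vfields A" for i unfolding E_def
    by (rule smooth_extend_vfield[OF cA(1) \<phi>(2,3)]) (auto intro!: smooth_on_scaleR oc \<phi>c smooth_on_const simp: \<phi>(4))
  have F: "smooth_fun A (F i)" for i unfolding F_def
    by (rule smooth_extend_fun[OF cA(1) \<phi>(2,3)])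
      (auto intro!: smooth_on_mult smooth_on_inner oc \<phi>c smooth_on_const vfield_smooth[OF X(1) cA(1)] simp: \<phi>(4))
  have P: "smooth_fun A P" unfolding P_def
    by (rule smooth_extend_fun[OF cA(1) \<phi>(2,3)]) (auto intro!: smooth_on_mult oc \<phi>c simp: \<phi>(4))
  have FE: "(\<Sum>i\<in>UNIV. fun_scale (F i) (E i)) \<in> smooth_vfields A"
    by (intro smooth_vfields_closed smooth_vfields_fun_scale F E)
  have "fun_scale P X q = (\<Sum>i\<in>UNIV. fun_scale (F i) (E i)) q" for q
  proof (cases "q \<in> chart_dom c")
    case True
    then have cq: "c \<in> charts_at A q" using cA(1) by (simp add: charts_atI)
    have "fun_scale P X q c = (\<Sum>i\<in>UNIV. fun_scale (F i) (E i)) q c"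
    proof -
      have "X q c = (\<Sum>i\<in>UNIV. (X q c $ i) *\<^sub>R axis i 1)"
        using basis_expansion[of "X q c"] by (simp add: scalar_mult_eq_scaleR)
      then have "(\<phi> (coords c q) * \<phi> (coords c q)) *\<^sub>R X q c =
          (\<phi> (coords c q) * \<phi> (coords c q)) *\<^sub>R (\<Sum>i\<in>UNIV. (X q c $ i) *\<^sub>R axis i 1)"
        by (rule arg_cong)
      also have "\<dots> = (\<Sum>i\<in>UNIV. (\<phi> (coords c q) * (X q c $ i)) *\<^sub>R \<phi> (coords c q) *\<^sub>R axis i 1)"
        by (simp add: scaleR_sum_right mult_ac)
      finally show ?thesis
        using True by (simp add: fun_scale_apply P_def F_def E_def extend_fun_def extend_vfield_def
          tvec_of_chart[OF cq] coord_rep_def inv_coords cA(1) inner_axis)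
    qed
    then show ?thesis
      by (rule tangent_space_eqI[OF vfield_tangent[OF smooth_vfields_fun_scale[OF P X(1)]] vfield_tangent[OF FE] cq])
  qed (simp add: fun_scale_apply P_def E_def extend_fun_def extend_vfield_def)
  then have eq: "fun_scale P X = (\<Sum>i\<in>UNIV. fun_scale (F i) (E i))" by blast
  have T0: "T 0 = 0" using add[OF smooth_vfields_0 smooth_vfields_0] by simp
  have Tsum: "T (\<Sum>i\<in>I. fun_scale (F i) (E i)) = (\<Sum>i\<in>I. T (fun_scale (F i) (E i)))" for I
    by (induction I rule: infinite_finite_induct)
      (simp_all only: T0 sum.infinite sum.empty sum.insert not_False_eq_True
        add[OF smooth_vfields_fun_scale[OF F E] smooth_vfields_closed(6)[OF smooth_vfields_fun_scale[OF F E]]])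
  have "P p *\<^sub>R T X = (\<Sum>i\<in>UNIV. F i p *\<^sub>R T (E i))"
    using arg_cong[OF eq, of T] unfolding Tsum scale[OF P X(1)] scale[OF F E] .
  moreover have "F i p = 0" for i
    using X(2) by (simp add: F_def extend_fun_def coord_rep_def inv_coords cA)
  moreover have "P p = 1" using \<phi>(5) cA by (simp add: P_def extend_fun_def)
  ultimately show ?thesis by simp
qed

text \<open>A constant field in one chart, cut off by a bump function. This provides the competitors
  over which the description defining the curvature ranges.\<close>

lemma ex_vfield:
  assumes "v \<in> tangent_space A p"
  shows "\<exists>X\<in>smooth_vfields A. X p = v"
proof -
  obtain c where c: "c \<in> charts_at A p" using ex_chart_at by blast
  obtain \<phi> K where \<phi>: "smooth_on UNIV \<phi>" "compact K" "K \<subseteq> chart_cod c"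
    "\<And>x. x \<notin> K \<Longrightarrow> \<phi> x = (0::real)" "\<phi> (coords c p) = 1"
    using bump_at[OF c open_UNIV UNIV_I] by metis
  have "extend_vfield c (\<lambda>y. \<phi> y *\<^sub>R v c) \<in> smooth_vfields A"
    by (rule smooth_extend_vfield[OF charts_atD(1)[OF c] \<phi>(2,3)])
      (auto intro!: smooth_on_scaleR open_cod charts_atD[OF c] smooth_on_subset[OF \<phi>(1)] smooth_on_const simp: \<phi>(4))
  moreover have "extend_vfield c (\<lambda>y. \<phi> y *\<^sub>R v c) p = v"
    using charts_atD[OF c] by (simp add: extend_vfield_def \<phi>(5) tvec_of_rep[OF c assms])
  ultimately show ?thesis by blast
qed

end


section \<open>The curvature tensor\<close>

locale levi_civita_manifold = smooth_manifold A
  for A :: "('m::t2_space, 'n::finite) chart set" +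
  fixes g :: "'m \<Rightarrow> ('m, 'n) tvec \<Rightarrow> ('m, 'n) tvec \<Rightarrow> real"
    and nabla :: "('m, 'n) vfield \<Rightarrow> ('m, 'n) vfield \<Rightarrow> ('m, 'n) vfield"
  assumes metric: "riemannian_metric A g" and levi_civita: "levi_civita A g nabla"
begin

lemma
  assumes "X \<in> smooth_vfields A" "Y \<in> smooth_vfields A"
  shows nabla_smooth: "nabla X Y \<in> smooth_vfields A"
    and torsion_free: "lie_bracket A X Y = nabla X Y - nabla Y X"
  using levi_civita assms smooth_fun_const
  unfolding levi_civita_def affine_connection_def by (blast, metis)

lemma
  assumes "X \<in> smooth_vfields A" "Y \<in> smooth_vfields A" "Z \<in> smooth_vfields A"
  shows nabla_add_left: "nabla (X + Y) Z = nabla X Z + nabla Y Z"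
    and nabla_add_right: "nabla X (Y + Z) = nabla X Y + nabla X Z"
  using levi_civita assms smooth_fun_const
  unfolding levi_civita_def affine_connection_def by blast+

lemma
  assumes "smooth_fun A f" "X \<in> smooth_vfields A" "Y \<in> smooth_vfields A"
  shows nabla_scale_left: "nabla (fun_scale f X) Y = fun_scale f (nabla X Y)"
    and nabla_leibniz: "nabla X (fun_scale f Y) = fun_scale (vf_deriv A X f) Y + fun_scale f (nabla X Y)"
  using levi_civita assms unfolding levi_civita_def affine_connection_def by blast+

lemma nabla_diff_left:
  assumes "X \<in> smooth_vfields A" "Y \<in> smooth_vfields A" "Z \<in> smooth_vfields A"
  shows "nabla (X - Y) Z = nabla X Z - nabla Y Z"
  using nabla_add_left[OF smooth_vfields_closed(3)[OF assms(1,2)] assms(2,3)] by (simp add: algebra_simps)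

lemma nabla_diff_right:
  assumes "X \<in> smooth_vfields A" "Y \<in> smooth_vfields A" "Z \<in> smooth_vfields A"
  shows "nabla X (Y - Z) = nabla X Y - nabla X Z"
  using nabla_add_right[OF assms(1) smooth_vfields_closed(3)[OF assms(2,3)] assms(3)]
  by (simp add: algebra_simps)

text \<open>Torsion-freeness writes the bracket as a difference of covariant derivatives, which are
  smooth fields by assumption.\<close>

lemma lie_bracket_smooth:
  "X \<in> smooth_vfields A \<Longrightarrow> Y \<in> smooth_vfields A \<Longrightarrow> lie_bracket A X Y \<in> smooth_vfields A"
  by (simp add: torsion_free nabla_smooth smooth_vfields_closed(3))

lemma fun_scale_diff: "fun_scale f (X - Y) = fun_scale f X - fun_scale f Y"
  by (rule ext) (simp add: fun_scale_apply scaleR_diff_right)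

lemma lie_bracket_scale:
  assumes "smooth_fun A f" "W \<in> smooth_vfields A" "X \<in> smooth_vfields A"
  shows "lie_bracket A (fun_scale f W) X = fun_scale f (lie_bracket A W X) - fun_scale (vf_deriv A X f) W"
  using assms
  by (simp add: torsion_free smooth_vfields_fun_scale nabla_scale_left nabla_leibniz fun_scale_diff)

text \<open>The curvature operator with the sign of \<open>curvature_fields\<close>, before pairing
  with the last field; tensoriality is an identity between vector fields at this level.\<close>

definition curv :: "('m, 'n) vfield \<Rightarrow> ('m, 'n) vfield \<Rightarrow> ('m, 'n) vfield \<Rightarrow> ('m, 'n) vfield" where
  "curv W X Y = nabla (lie_bracket A W X) Y - (nabla W (nabla X Y) - nabla X (nabla W Y))"

lemmas smooth_intros = nabla_smooth lie_bracket_smooth smooth_vfields_fun_scale smooth_vf_deriv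
  smooth_vfields_closed

lemma curv_smooth:
  "W \<in> smooth_vfields A \<Longrightarrow> X \<in> smooth_vfields A \<Longrightarrow> Y \<in> smooth_vfields A \<Longrightarrow> curv W X Y \<in> smooth_vfields A"
  unfolding curv_def by (intro smooth_intros)

lemma curv_swap:
  assumes "W \<in> smooth_vfields A" "X \<in> smooth_vfields A" "Y \<in> smooth_vfields A"
  shows "curv W X Y = - curv X W Y"
  using assms
  by (simp add: curv_def torsion_free nabla_diff_left nabla_smooth)

lemma curv_add1:
  assumes "W \<in> smooth_vfields A" "W' \<in> smooth_vfields A" "X \<in> smooth_vfields A" "Y \<in> smooth_vfields A"
  shows "curv (W + W') X Y = curv W X Y + curv W' X Y"
  using assms
  by (simp add: curv_def torsion_free nabla_diff_left nabla_add_left nabla_add_right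
      nabla_smooth smooth_vfields_closed algebra_simps)

text \<open>The bracket \<open>[f W, X]\<close> contributes
  \<open>- (X f) \<nabla>\<^sub>W Y\<close>, and the Leibniz rule in
  \<open>\<nabla>\<^sub>X (f \<nabla>\<^sub>W Y)\<close> contributes the opposite term.\<close>

lemma curv_scale1:
  assumes f: "smooth_fun A f" and W: "W \<in> smooth_vfields A" "X \<in> smooth_vfields A" "Y \<in> smooth_vfields A"
  shows "curv (fun_scale f W) X Y = fun_scale f (curv W X Y)"
proof -
  have "nabla (lie_bracket A (fun_scale f W) X) Y =
      fun_scale f (nabla (lie_bracket A W X) Y) - fun_scale (vf_deriv A X f) (nabla W Y)"
    using assms
    by (simp add: lie_bracket_scale nabla_diff_left nabla_scale_left smooth_intros)
  then show ?thesis
    using assms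
    by (simp add: curv_def nabla_scale_left nabla_leibniz nabla_smooth fun_scale_diff)
qed

lemma curv_add3:
  assumes "W \<in> smooth_vfields A" "X \<in> smooth_vfields A" "Y \<in> smooth_vfields A" "Y' \<in> smooth_vfields A"
  shows "curv W X (Y + Y') = curv W X Y + curv W X Y'"
  using assms
  by (simp add: curv_def nabla_add_right nabla_smooth lie_bracket_smooth algebra_simps)

text \<open>The terms with one derivative of \<open>f\<close> are symmetric in \<open>W\<close> and
  \<open>X\<close> and cancel in the commutator. The terms with two derivatives leave
  \<open>(W (X f) - X (W f)) Y\<close>, which cancels against the derivative of \<open>f\<close>
  along the bracket.\<close>

lemma curv_scale3:
  assumes f: "smooth_fun A f" and W: "W \<in> smooth_vfields A" and X: "X \<in> smooth_vfields A"
    and Y: "Y \<in> smooth_vfields A"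
  shows "curv W X (fun_scale f Y) = fun_scale f (curv W X Y)"
proof
  fix p
  have 1: "nabla (lie_bracket A W X) (fun_scale f Y) p =
      (vf_deriv A W (vf_deriv A X f) p - vf_deriv A X (vf_deriv A W f) p) *\<^sub>R Y p +
      f p *\<^sub>R nabla (lie_bracket A W X) Y p"
    using nabla_leibniz[OF f lie_bracket_smooth[OF W X] Y]
      vf_deriv_lie_bracket[OF f W X, of p] vfield_tangent[OF lie_bracket_smooth[OF W X]]
    by (simp add: fun_scale_apply)
  have 2: "nabla V (nabla U (fun_scale f Y)) p =
      vf_deriv A V (vf_deriv A U f) p *\<^sub>R Y p + vf_deriv A U f p *\<^sub>R nabla V Y p +
      (vf_deriv A V f p *\<^sub>R nabla U Y p + f p *\<^sub>R nabla V (nabla U Y) p)"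
    if "V \<in> smooth_vfields A" "U \<in> smooth_vfields A" for U V
    using that f Y by (simp add: nabla_leibniz nabla_add_right smooth_intros fun_scale_apply)
  show "curv W X (fun_scale f Y) p = fun_scale f (curv W X Y) p"
    by (simp add: curv_def 1 2 W X fun_scale_apply algebra_simps)
qed

text \<open>Additivity turns a change of extension into a field vanishing at \<open>p\<close>, to
  which \<open>tensorial_at_zero\<close> applies. This treats the first and third slots; the second
  follows from the first by antisymmetry.\<close>

lemma curv_cong:
  assumes W: "W \<in> smooth_vfields A" "W' \<in> smooth_vfields A" "W p = W' p"
    and X: "X \<in> smooth_vfields A" "X' \<in> smooth_vfields A" "X p = X' p"
    and Y: "Y \<in> smooth_vfields A" "Y' \<in> smooth_vfields A" "Y p = Y' p"
  shows "curv W X Y p = curv W' X' Y' p"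
proof -
  have 1: "curv V U Z p = curv V' U Z p"
    if "V \<in> smooth_vfields A" "V' \<in> smooth_vfields A" "V p = V' p" "U \<in> smooth_vfields A" "Z \<in> smooth_vfields A"
    for V V' U Z
  proof -
    have "curv (V - V') U Z p = 0"
      by (rule tensorial_at_zero[where T = "\<lambda>V. curv V U Z p" and p = p])
        (use that in \<open>simp_all add: curv_add1 curv_scale1 fun_scale_apply smooth_vfields_closed(3)\<close>)
    moreover have "curv V U Z = curv (V - V') U Z + curv V' U Z"
      using curv_add1[OF smooth_vfields_closed(3)[OF that(1,2)] that(2,4,5)] by simp
    ultimately show ?thesis by simp
  qed
  have "curv W' X' (Y - Y') p = 0"
    by (rule tensorial_at_zero[where T = "\<lambda>Y. curv W' X' Y p" and p = p])
      (use assms in \<open>simp_all add: curv_add3 curv_scale3 fun_scale_apply smooth_vfields_closed(3)\<close>)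
  moreover have "curv W' X' Y = curv W' X' (Y - Y') + curv W' X' Y'"
    using curv_add3[OF W(2) X(2) smooth_vfields_closed(3)[OF Y(1,2)] Y(2)] by simp
  ultimately have 3: "curv W' X' Y p = curv W' X' Y' p" by simp
  have "curv W X Y p = curv W' X Y p" by (rule 1[OF W X(1) Y(1)])
  also have "\<dots> = - curv X W' Y p" using curv_swap[OF W(2) X(1) Y(1)] by simp
  also have "\<dots> = - curv X' W' Y p" using 1[OF X W(2) Y(1)] by simp
  also have "\<dots> = curv W' X' Y p" using curv_swap[OF W(2) X(2) Y(1)] by simp
  finally show ?thesis using 3 by simp
qed

abbreviation R where "R \<equiv> curvature A g nabla"

text \<open>All extensions give the same number by \<open>curv_cong\<close>, and the fields given
  here are themselves one of the extensions, which forces uniqueness in the description.\<close>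

lemma curvature_eq:
  assumes "W \<in> smooth_vfields A" "X \<in> smooth_vfields A" "Y \<in> smooth_vfields A" "Z \<in> smooth_vfields A"
  shows "R p (W p) (X p) (Y p) (Z p) = g p (curv W X Y p) (Z p)"
proof -
  have cf: "curvature_fields A g nabla W X Y Z p = g p (curv W X Y p) (Z p)" for W X Y Z
    by (simp add: curvature_fields_def curv_def)
  show ?thesis
    unfolding curvature_def cf
  proof (rule the_equality)
    show "\<forall>W'\<in>smooth_vfields A. \<forall>X'\<in>smooth_vfields A. \<forall>Y'\<in>smooth_vfields A. \<forall>Z'\<in>smooth_vfields A.
       W' p = W p \<and> X' p = X p \<and> Y' p = Y p \<and> Z' p = Z p \<longrightarrow>
       g p (curv W X Y p) (Z p) = g p (curv W' X' Y' p) (Z' p)"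
    proof (intro ballI impI, elim conjE)
      fix W' X' Y' Z'
      assume *: "W' \<in> smooth_vfields A" "X' \<in> smooth_vfields A" "Y' \<in> smooth_vfields A" "Z' \<in> smooth_vfields A"
        and eq: "W' p = W p" "X' p = X p" "Y' p = Y p" "Z' p = Z p"
      show "g p (curv W X Y p) (Z p) = g p (curv W' X' Y' p) (Z' p)"
        unfolding eq(4) curv_cong[OF assms(1) *(1) eq(1)[symmetric] assms(2) *(2) eq(2)[symmetric]
            assms(3) *(3) eq(3)[symmetric]] ..
    qed
  qed (use assms in blast)
qed

lemma
  assumes "u \<in> tangent_space A p" "v \<in> tangent_space A p" "w \<in> tangent_space A p"
  shows metric_sym: "g p u v = g p v u"
    and metric_add_left: "g p (u + v) w = g p u w + g p v w"
    and metric_scale_left: "g p (a *\<^sub>R u) v = a * g p u v"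
    and metric_pos: "u \<noteq> 0 \<Longrightarrow> g p u u > 0"
  using metric assms unfolding riemannian_metric_def by blast+

lemma metric_add_right:
  assumes "u \<in> tangent_space A p" "v \<in> tangent_space A p" "w \<in> tangent_space A p"
  shows "g p w (u + v) = g p w u + g p w v"
  using assms by (metis metric_add_left metric_sym subspace_add[OF subspace_tangent_space])

lemma metric_scale_right:
  assumes "u \<in> tangent_space A p" "v \<in> tangent_space A p"
  shows "g p u (a *\<^sub>R v) = a * g p u v"
  using assms by (metis metric_scale_left metric_sym subspace_scale[OF subspace_tangent_space])

lemma scaleR_eq_fun_scale: "a *\<^sub>R X = fun_scale (\<lambda>_. a) X"
  by (simp add: fun_scale_def scaleR_fun_def[of a X])

lemma metric_minus_left:
  assumes "u \<in> tangent_space A p" "v \<in> tangent_space A p"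
  shows "g p (- u) v = - g p u v"
  using metric_scale_left[OF assms assms(1), of "-1"] by simp

text \<open>The pattern for passing from fields to vectors: extend all arguments to fields, evaluate
  by \<open>curvature_eq\<close>, and use the identity for \<open>curv\<close> at
  \<open>p\<close>.\<close>

lemma curvature_antisym:
  assumes "u \<in> tangent_space A p" "v \<in> tangent_space A p" "w \<in> tangent_space A p" "z \<in> tangent_space A p"
  shows "R p u v w z = - R p v u w z"
proof -
  obtain U V W Z where F: "U \<in> smooth_vfields A" "V \<in> smooth_vfields A" "W \<in> smooth_vfields A" "Z \<in> smooth_vfields A"
    and eq: "u = U p" "v = V p" "w = W p" "z = Z p"
    using ex_vfield assms by metis
  show ?thesis
    unfolding eq curvature_eq[OF F] curvature_eq[OF F(2,1,3,4)]
    using curv_swap[OF F(1-3)] metric_minus_left[OF vfield_tangent[OF curv_smooth[OF F(2,1,3)]] vfield_tangent[OF F(4)]]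
    by simp
qed

lemma curvature_linear1:
  assumes "u \<in> tangent_space A p" "u' \<in> tangent_space A p" "v \<in> tangent_space A p" "w \<in> tangent_space A p" "z \<in> tangent_space A p"
  shows "R p (u + u') v w z = R p u v w z + R p u' v w z"
    and "R p (a *\<^sub>R u) v w z = a * R p u v w z"
proof -
  obtain U U' V W Z where F: "U \<in> smooth_vfields A" "U' \<in> smooth_vfields A" "V \<in> smooth_vfields A" "W \<in> smooth_vfields A" "Z \<in> smooth_vfields A"
    and eq: "u = U p" "u' = U' p" "v = V p" "w = W p" "z = Z p"
    using ex_vfield assms by metis
  note T = vfield_tangent[OF curv_smooth[OF F(1,3,4)]] vfield_tangent[OF curv_smooth[OF F(2,3,4)]] vfield_tangent[OF F(5)]
  show "R p (u + u') v w z = R p u v w z + R p u' v w z"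
    unfolding eq plus_fun_apply[symmetric] curvature_eq[OF smooth_vfields_closed(2)[OF F(1,2)] F(3-5)]
      curvature_eq[OF F(1,3-5)] curvature_eq[OF F(2-5)] curv_add1[OF F(1-4)]
    using metric_add_left[OF T] unfolding plus_fun_apply .
  show "R p (a *\<^sub>R u) v w z = a * R p u v w z"
    unfolding eq scaleR_fun_apply[symmetric] curvature_eq[OF smooth_vfields_closed(4)[OF F(1)] F(3-5)]
      curvature_eq[OF F(1,3-5)]
    unfolding scaleR_eq_fun_scale curv_scale1[OF smooth_fun_const F(1,3,4)]
    unfolding fun_scale_apply by (rule metric_scale_left[OF T(1,3,3)])
qed

lemma curvature_linear3:
  assumes "u \<in> tangent_space A p" "u' \<in> tangent_space A p" "v \<in> tangent_space A p" "w \<in> tangent_space A p" "z \<in> tangent_space A p"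
  shows "R p v w (u + u') z = R p v w u z + R p v w u' z"
    and "R p v w (a *\<^sub>R u) z = a * R p v w u z"
proof -
  obtain U U' V W Z where F: "U \<in> smooth_vfields A" "U' \<in> smooth_vfields A" "V \<in> smooth_vfields A" "W \<in> smooth_vfields A" "Z \<in> smooth_vfields A"
    and eq: "u = U p" "u' = U' p" "v = V p" "w = W p" "z = Z p"
    using ex_vfield assms by metis
  note T = vfield_tangent[OF curv_smooth[OF F(3,4,1)]] vfield_tangent[OF curv_smooth[OF F(3,4,2)]] vfield_tangent[OF F(5)]
  show "R p v w (u + u') z = R p v w u z + R p v w u' z"
    unfolding eq plus_fun_apply[symmetric] curvature_eq[OF F(3,4) smooth_vfields_closed(2)[OF F(1,2)] F(5)]
      curvature_eq[OF F(3,4,1,5)] curvature_eq[OF F(3,4,2,5)] curv_add3[OF F(3,4,1,2)]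
    using metric_add_left[OF T] unfolding plus_fun_apply .
  show "R p v w (a *\<^sub>R u) z = a * R p v w u z"
    unfolding eq scaleR_fun_apply[symmetric] curvature_eq[OF F(3,4) smooth_vfields_closed(4)[OF F(1)] F(5)]
      curvature_eq[OF F(3,4,1,5)]
    unfolding scaleR_eq_fun_scale curv_scale3[OF smooth_fun_const F(3,4,1)]
    unfolding fun_scale_apply by (rule metric_scale_left[OF T(1,3,3)])
qed

text \<open>Extending the first three vectors once and for all makes the curvature
  \<open>g p (curv V W Z p) x\<close> for every tangent \<open>x\<close>, so linearity is that of
  the metric.\<close>

lemma curvature_linear4:
  assumes "u \<in> tangent_space A p" "u' \<in> tangent_space A p" "v \<in> tangent_space A p" "w \<in> tangent_space A p" "z \<in> tangent_space A p"
  shows "R p v w z (u + u') = R p v w z u + R p v w z u'"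
    and "R p v w z (a *\<^sub>R u) = a * R p v w z u"
proof -
  obtain V W Z where F: "V \<in> smooth_vfields A" "W \<in> smooth_vfields A" "Z \<in> smooth_vfields A"
    and eq: "v = V p" "w = W p" "z = Z p"
    using ex_vfield assms(3-5) by metis
  have *: "R p v w z x = g p (curv V W Z p) x" if "x \<in> tangent_space A p" for x
    using ex_vfield[OF that] curvature_eq[OF F] eq by metis
  note T = vfield_tangent[OF curv_smooth[OF F], of p]
  show "R p v w z (u + u') = R p v w z u + R p v w z u'"
    using assms(1,2) by (simp only: * tangent_space_closed metric_add_right[OF _ _ T])
  show "R p v w z (a *\<^sub>R u) = a * R p v w z u"
    using assms(1) by (simp only: * tangent_space_closed metric_scale_right[OF T])
qed

lemma curvature_linear2:
  assumes "u \<in> tangent_space A p" "u' \<in> tangent_space A p" "v \<in> tangent_space A p" "w \<in> tangent_space A p" "z \<in> tangent_space A p"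
  shows "R p v (u + u') w z = R p v u w z + R p v u' w z"
    and "R p v (a *\<^sub>R u) w z = a * R p v u w z"
  using curvature_linear1[OF assms]
    curvature_antisym[OF assms(3) tangent_space_closed(2)[OF assms(1,2)] assms(4,5)]
    curvature_antisym[OF assms(3,1,4,5)] curvature_antisym[OF assms(3,2,4,5)]
    curvature_antisym[OF assms(3) tangent_space_closed(4)[OF assms(1)] assms(4,5)]
  by simp_all

text \<open>For a bump function \<open>f\<close> supported in \<open>U\<close> with
  \<open>f p = 1\<close>, the field \<open>f Z\<close> is globally zero. Expanding
  \<open>\<nabla>\<^sub>W (f Z) = 0\<close> at \<open>p\<close> leaves
  \<open>\<nabla>\<^sub>W Z\<close>, because \<open>Z p = 0\<close>.\<close>

lemma nabla_local:
  assumes "open U" "p \<in> U" "W \<in> smooth_vfields A" "Z \<in> smooth_vfields A" "\<And>q. q \<in> U \<Longrightarrow> Z q = 0"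
  shows "nabla W Z p = 0"
proof -
  obtain c where c: "c \<in> charts_at A p" using ex_chart_at by blast
  note cA = charts_atD[OF c]
  obtain \<phi> K where \<phi>: "smooth_on UNIV \<phi>" "compact K" "K \<subseteq> coords c ` (chart_dom c \<inter> U)"
    "K \<subseteq> chart_cod c" "\<And>x. x \<notin> K \<Longrightarrow> \<phi> x = (0::real)" "\<phi> (coords c p) = 1"
    using bump_at[OF c assms(1,2)] by metis
  define f where "f = extend_fun c \<phi>"
  have f: "smooth_fun A f" unfolding f_def
    by (rule smooth_extend_fun[OF cA(1) \<phi>(2,4) smooth_on_subset[OF \<phi>(1) subset_UNIV] \<phi>(5)])
  have "fun_scale f Z q = 0" for q
  proof (cases "q \<in> chart_dom c \<and> coords c q \<in> K")
    case True
    then obtain q' where "q' \<in> chart_dom c" "q' \<in> U" "coords c q = coords c q'" using \<phi>(3) by blast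
    then have "q \<in> U" using inv_coords[OF cA(1)] True by metis
    then show ?thesis using assms(5) by (simp add: fun_scale_apply)
  next
    case False
    then have "f q = 0" using \<phi>(5) by (auto simp: f_def extend_fun_def)
    then show ?thesis by (simp add: fun_scale_apply)
  qed
  then have "fun_scale f Z = 0" by (simp add: fun_eq_iff)
  moreover have "nabla W 0 = 0"
    using nabla_add_right[OF assms(3) smooth_vfields_0 smooth_vfields_0] by simp
  ultimately have "vf_deriv A W f p *\<^sub>R Z p + f p *\<^sub>R nabla W Z p = 0"
    using fun_cong[OF nabla_leibniz[OF f assms(3,4)], of p] by (simp add: fun_scale_apply)
  moreover have "f p = 1" "Z p = 0" using \<phi>(6) cA assms(2,5) by (auto simp: f_def extend_fun_def)
  ultimately show ?thesis by simp
qed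

lemma nabla_at_zero:
  assumes "Z \<in> smooth_vfields A" "Y \<in> smooth_vfields A" "Z p = 0"
  shows "nabla Z Y p = 0"
  by (rule tensorial_at_zero[where T = "\<lambda>X. nabla X Y p" and p = p])
    (use assms in \<open>simp_all add: nabla_add_left nabla_scale_left fun_scale_apply\<close>)

text \<open>Vectors at \<open>p\<close> extend to fields with constant components near \<open>p\<close> in a chart; these commute
  near \<open>p\<close>, so that the Bianchi identity needs no Jacobi identity.\<close>

lemma commuting_extensions:
  obtains E N where "\<And>v. v \<in> tangent_space A p \<Longrightarrow> E v \<in> smooth_vfields A"
    "\<And>v. v \<in> tangent_space A p \<Longrightarrow> E v p = v" "open N" "p \<in> N"
    "\<And>u v q. u \<in> tangent_space A p \<Longrightarrow> v \<in> tangent_space A p \<Longrightarrow> q \<in> N \<Longrightarrow> lie_bracket A (E u) (E v) q = 0"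
proof -
  obtain c where c: "c \<in> charts_at A p" using ex_chart_at by blast
  note cA = charts_atD[OF c]
  obtain \<phi> K and r :: real where \<phi>: "smooth_on UNIV \<phi>" "compact K" "K \<subseteq> chart_cod c"
    "\<And>x. x \<notin> K \<Longrightarrow> \<phi> x = (0::real)" "\<phi> (coords c p) = 1" "r > 0" "\<And>x. x \<in> ball (coords c p) r \<Longrightarrow> \<phi> x = 1"
    using bump_at[OF c open_UNIV UNIV_I] by metis
  define E where "E v = extend_vfield c (\<lambda>y. \<phi> y *\<^sub>R v c)" for v
  define N where "N = chart_dom c \<inter> coords c -` ball (coords c p) r"
  have E: "E v \<in> smooth_vfields A" for v unfolding E_def
    by (rule smooth_extend_vfield[OF cA(1) \<phi>(2,3)])
      (auto intro!: smooth_on_scaleR open_cod cA smooth_on_subset[OF \<phi>(1)] smooth_on_const simp: \<phi>(4))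
  have "open N" unfolding N_def
    by (rule continuous_open_preimage[OF continuous_coords[OF cA(1)] open_dom[OF cA(1)] open_ball])
  moreover have "p \<in> N" using cA \<phi>(6) by (simp add: N_def)
  moreover have "E v p = v" if "v \<in> tangent_space A p" for v
    using cA by (simp add: E_def extend_vfield_def \<phi>(5) tvec_of_rep[OF c that])
  moreover have "lie_bracket A (E u) (E v) q = 0" if q: "q \<in> N" for u v q
  proof (rule tangent_space_eqI)
    show cq: "c \<in> charts_at A q" using q cA by (simp add: N_def charts_atI)
    define B where "B = chart_cod c \<inter> ball (coords c p) r"
    have B: "open B" "coords c q \<in> B" using q by (auto simp: B_def N_def open_cod cA coords_cod)
    have "frechet_derivative (coord_rep (E w) c) (at (coords c q)) = frechet_derivative (\<lambda>_. w c) (at (coords c q))" for w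
    proof (rule frechet_derivative_cong_open[OF B])
      fix y assume "y \<in> B"
      then have y: "y \<in> chart_cod c" "\<phi> y = 1" using \<phi>(7) by (auto simp: B_def)
      have "c \<in> charts_at A (chart_inv c y)" by (rule charts_atI[OF cA(1) inv_dom[OF cA(1) y(1)]])
      then show "coord_rep (E w) c y = w c"
        using y by (simp add: coord_rep_def E_def extend_vfield_def inv_dom cA(1) coords_inv tvec_of_chart)
    qed
    then show "lie_bracket A (E u) (E v) q c = 0 c" by (simp add: lie_bracket_chart[OF cq])
  qed (auto intro!: vfield_tangent lie_bracket_smooth E tangent_space_closed(1))
  ultimately show thesis using that[of E N] E by blast
qed

text \<open>For extensions commuting near \<open>p\<close> the bracket terms drop out at
  \<open>p\<close>, and vanishing torsion lets the inner two fields of each iterated covariant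
  derivative be exchanged. The six iterated derivatives of the cyclic sum then cancel in
  pairs.\<close>

lemma bianchi:
  assumes "u \<in> tangent_space A p" "v \<in> tangent_space A p" "w \<in> tangent_space A p" "z \<in> tangent_space A p"
  shows "R p u v w z + R p v w u z + R p w u v z = 0"
proof -
  obtain E N where E: "\<And>v. v \<in> tangent_space A p \<Longrightarrow> E v \<in> smooth_vfields A"
    "\<And>v. v \<in> tangent_space A p \<Longrightarrow> E v p = v" "open N" "p \<in> N"
    "\<And>u v q. u \<in> tangent_space A p \<Longrightarrow> v \<in> tangent_space A p \<Longrightarrow> q \<in> N \<Longrightarrow> lie_bracket A (E u) (E v) q = 0"
    using commuting_extensions by blast
  define U V W Z where "U = E u" and "V = E v" and "W = E w" and "Z = E z"
  have F: "U \<in> smooth_vfields A" "V \<in> smooth_vfields A" "W \<in> smooth_vfields A" "Z \<in> smooth_vfields A"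
    and eq: "u = U p" "v = V p" "w = W p" "z = Z p"
    using E(1,2) assms by (simp_all add: U_def V_def W_def Z_def)
  have br: "lie_bracket A X Y q = 0" if "X \<in> {U, V, W}" "Y \<in> {U, V, W}" "q \<in> N" for X Y q
    using that E(5) assms by (auto simp: U_def V_def W_def)
  have c: "curv X Y Y' p = - (nabla X (nabla Y Y') p - nabla Y (nabla X Y') p)"
    if "X \<in> {U, V, W}" "Y \<in> {U, V, W}" "Y' \<in> {U, V, W}" for X Y Y'
  proof -
    have "X \<in> smooth_vfields A" "Y \<in> smooth_vfields A" "Y' \<in> smooth_vfields A" using that F by auto
    then have "nabla (lie_bracket A X Y) Y' p = 0"
      by (intro nabla_at_zero lie_bracket_smooth br[OF that(1,2) E(4)])
    then show ?thesis by (simp add: curv_def)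
  qed
  \<comment> \<open>Here the bracket is differentiated, so its vanishing at \<open>p\<close> alone
    would not suffice; it must vanish on a neighbourhood.\<close>
  have d: "nabla X (nabla Y Y') p = nabla X (nabla Y' Y) p"
    if "X \<in> {U, V, W}" "Y \<in> {U, V, W}" "Y' \<in> {U, V, W}" for X Y Y'
  proof -
    have *: "X \<in> smooth_vfields A" "Y \<in> smooth_vfields A" "Y' \<in> smooth_vfields A" using that F by auto
    have "nabla X (lie_bracket A Y Y') p = 0"
      by (rule nabla_local[OF E(3,4) *(1) lie_bracket_smooth[OF *(2,3)] br[OF that(2,3)]])
    then show ?thesis
      by (simp add: torsion_free * nabla_diff_right nabla_smooth)
  qed
  have sum0: "curv U V W p + curv V W U p + curv W U V p = 0"
    using d[of U V W] d[of V U W] d[of W U V] by (simp add: c)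
  note T = vfield_tangent[OF curv_smooth[OF F(1,2,3)], of p] vfield_tangent[OF curv_smooth[OF F(2,3,1)], of p]
    vfield_tangent[OF curv_smooth[OF F(3,1,2)], of p] vfield_tangent[OF F(4), of p]
  have "R p u v w z + R p v w u z + R p w u v z = g p (curv U V W p + curv V W U p + curv W U V p) (Z p)"
    unfolding eq curvature_eq[OF F(1,2,3,4)] curvature_eq[OF F(2,3,1,4)] curvature_eq[OF F(3,1,2,4)]
      metric_add_left[OF tangent_space_closed(2)[OF T(1,2)] T(3,4)] metric_add_left[OF T(1,2,4)] ..
  also have "\<dots> = 0"
    unfolding sum0 using metric_scale_left[OF T(1,4,4), of 0] by simp
  finally show ?thesis .
qed

end


section \<open>The volume of the sphere in the hemisphere charts\<close>

text \<open>A set of indices, those of the non-polar coordinates, rather than of points of the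
  sphere.\<close>

abbreviation equator :: "'n::finite set" where "equator \<equiv> UNIV - {pole}"

abbreviation equator_space :: "('n::finite \<Rightarrow> real) measure" where
  "equator_space \<equiv> Pi\<^sub>M equator (\<lambda>_. lborel)"

definition hsq :: "('n::finite \<Rightarrow> real) \<Rightarrow> real" where
  "hsq y = (\<Sum>j\<in>equator. (y j)\<^sup>2)"

lemma hemisphere_nth:
  "hemisphere \<sigma> y $ i = (if i = pole then \<sigma> * sqrt (1 - hsq y) else y i)"
  by (simp add: hemisphere_def hsq_def)

lemma hsq_upd:
  assumes "j \<noteq> pole"
  shows "hsq (y(j := t)) = t\<^sup>2 + (\<Sum>k\<in>equator - {j}. (y k)\<^sup>2)"
proof -
  have "hsq (y(j := t)) = ((y(j := t)) j)\<^sup>2 + (\<Sum>k\<in>equator - {j}. ((y(j := t)) k)\<^sup>2)"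
    unfolding hsq_def using assms by (intro sum.remove) auto
  also have "(\<Sum>k\<in>equator - {j}. ((y(j := t)) k)\<^sup>2) = (\<Sum>k\<in>equator - {j}. (y k)\<^sup>2)"
    by (intro sum.cong) auto
  finally show ?thesis by (simp only: fun_upd_same)
qed

lemma hemisphere_partial_eq:
  assumes "hsq y < 1" "j \<noteq> pole"
  shows "hemisphere_partial \<sigma> y j =
    (\<chi> i. if i = pole then - \<sigma> * y j / sqrt (1 - hsq y) else if i = j then 1 else 0)" (is "_ = ?v")
proof -
  define r where "r = (\<Sum>k\<in>equator - {j}. (y k)\<^sup>2)"
  have r: "hsq y = (y j)\<^sup>2 + r" using hsq_upd[OF assms(2), of y "y j"] by (simp add: r_def)
  have "((\<lambda>t. hemisphere \<sigma> (y(j := t))) has_vector_derivative ?v) (at (y j))"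
    unfolding has_vector_derivative_def
  proof (rule iffD2[OF has_derivative_componentwise_within], rule ballI)
    fix b :: "real^'a" assume "b \<in> Basis"
    then obtain i where b: "b = axis i 1" by (auto simp: Basis_vec_def)
    have "((\<lambda>t. \<sigma> * sqrt (1 - (t\<^sup>2 + r))) has_real_derivative - \<sigma> * y j / sqrt (1 - hsq y)) (at (y j))"
      using assms(1) unfolding r by (auto intro!: derivative_eq_intros simp: field_simps)
    from this[unfolded has_field_derivative_def] have 1: "((\<lambda>t. \<sigma> * sqrt (1 - (t\<^sup>2 + r))) has_derivative (\<lambda>x. x * (- \<sigma> * y j / sqrt (1 - hsq y)))) (at (y j))"
      by (rule has_derivative_eq_rhs) (simp add: fun_eq_iff)
    show "((\<lambda>t. hemisphere \<sigma> (y(j := t)) \<bullet> b) has_derivative (\<lambda>x. (x *\<^sub>R ?v) \<bullet> b)) (at (y j))"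
      using 1 by (cases "i = pole"; cases "i = j")
        (auto simp: b inner_axis hemisphere_nth hsq_upd[OF assms(2)] r_def[symmetric] assms(2))
  qed
  then show ?thesis unfolding hemisphere_partial_def by (rule vector_derivative_at)
qed

text \<open>Both determinants are instances of Cramer's rule: the position vector is the combination of the
  partial derivatives, with coefficients \<open>y\<close>, and of \<open>\<sigma> / sqrt (1 - \<bar>y\<bar>\<^sup>2)\<close> times the polar axis.\<close>

lemma sphere_volume_form_hemisphere:
  assumes "hsq y < 1" "\<sigma>\<^sup>2 = 1"
  shows "sphere_volume_form (hemisphere \<sigma> y) (hemisphere_partial \<sigma> y) = \<sigma> / sqrt (1 - hsq y)"
proof -
  define s where "s = sqrt (1 - hsq y)"
  have s: "s > 0" "s * s = 1 - hsq y" using assms(1) by (simp_all add: s_def)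
  then have hs: "hsq y = 1 - s * s" by simp
  \<comment> \<open>\<open>B\<close> has the partial derivatives as columns and the polar axis as
    polar column, so \<open>B *v z\<close> is the combination described above. Its polar entry is
    \<open>\<sigma> / s * (1 - hsq y) = \<sigma> * s\<close>, the height of the point.\<close>
  define z :: "real^'a" where "z = (\<chi> j. if j = pole then \<sigma> / s else y j)"
  define B :: "real^'a^'a" where "B = (\<chi> i j. if j = pole then (if i = pole then 1 else 0)
      else if i = pole then - \<sigma> * y j / s else if i = j then 1 else 0)"
  have Bz: "(B *v z) $ i = hemisphere \<sigma> y $ i" for i
  proof (cases "i = pole")
    case True
    have "(B *v z) $ pole = \<sigma> / s + (\<Sum>j\<in>equator. - \<sigma> * y j / s * y j)"
      unfolding matrix_vector_mult_def vec_lambda_beta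
      by (subst sum.remove[of UNIV pole]) (auto simp: B_def z_def intro!: sum.cong)
    also have "(\<Sum>j\<in>equator. - \<sigma> * y j / s * y j) = (- \<sigma> / s) * hsq y"
      unfolding hsq_def sum_distrib_left by (intro sum.cong) (auto simp: power2_eq_square)
    also have "\<sigma> / s + - \<sigma> / s * hsq y = \<sigma> * s"
      unfolding hs using s(1) by (simp add: field_simps)
    finally show ?thesis using True by (simp add: hemisphere_nth s_def)
  next
    case False
    have "(B *v z) $ i = (\<Sum>j\<in>UNIV. if j = i then y i else 0)"
      unfolding matrix_vector_mult_def vec_lambda_beta
      by (intro sum.cong) (use False in \<open>auto simp: B_def z_def\<close>)
    then show ?thesis using False by (simp add: hemisphere_nth)
  qed
  \<comment> \<open>\<open>B\<close> is the identity except for its polar row. Transposing makes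
    that row the polar column, so Cramer's rule over \<open>mat 1\<close> gives the determinant as
    the polar entry of \<open>w\<close>, which is 1.\<close>
  define w :: "real^'a" where "w = (\<chi> j. if j = pole then 1 else - \<sigma> * y j / s)"
  have "transpose B = (\<chi> i j. if j = pole then (mat 1 *v w) $ i else mat 1 $ i $ j)"
    unfolding matrix_vector_mul_lid by (auto simp: transpose_def B_def w_def vec_eq_iff mat_def)
  then have "det (transpose B) = w $ pole * det (mat 1 :: real^'a^'a)"
    by (simp only: cramer_lemma)
  then have detB: "det B = 1" by (simp add: w_def)
  have "(\<chi> i j. if j = pole then hemisphere \<sigma> y $ i else hemisphere_partial \<sigma> y j $ i) =
      (\<chi> i j. if j = pole then (B *v z) $ i else B $ i $ j)"
    unfolding Bz by (auto simp: vec_eq_iff hemisphere_partial_eq[OF assms(1)] B_def s_def)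
  then have "sphere_volume_form (hemisphere \<sigma> y) (hemisphere_partial \<sigma> y) = z $ pole * det B"
    unfolding sphere_volume_form_def by (simp only: cramer_lemma)
  then show ?thesis using detB by (simp add: z_def s_def)
qed

text \<open>The absolute value of the volume form in either hemisphere chart, cut off outside the
  open unit ball of the non-polar coordinates.\<close>

definition hweight :: "('n::finite \<Rightarrow> real) \<Rightarrow> real" where
  "hweight y = (if hsq y < 1 then 1 / sqrt (1 - hsq y) else 0)"

lemma hweight_nonneg: "0 \<le> hweight y"
  by (simp add: hweight_def)

lemma measurable_hsq [measurable]: "hsq \<in> borel_measurable (equator_space :: ('n::finite \<Rightarrow> real) measure)"
  unfolding hsq_def by measurable

lemma measurable_hweight [measurable]:
  "hweight \<in> borel_measurable (equator_space :: ('n::finite \<Rightarrow> real) measure)"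
  unfolding hweight_def by measurable

lemma measurable_hemisphere [measurable]:
  "hemisphere \<sigma> \<in> borel_measurable (equator_space :: ('n::finite \<Rightarrow> real) measure)"
proof -
  have "(\<lambda>y. hemisphere \<sigma> y \<bullet> axis i 1) \<in> borel_measurable (equator_space :: ('n \<Rightarrow> real) measure)" for i :: 'n
    by (cases "i = pole") (simp_all add: inner_axis hemisphere_nth)
  then show ?thesis
    by (subst borel_measurable_euclidean_space) (auto simp: Basis_vec_def)
qed

abbreviation hemispheres_space :: "(real \<times> ('n::finite \<Rightarrow> real)) measure" where
  "hemispheres_space \<equiv> count_space {1, -1} \<Otimes>\<^sub>M equator_space"

lemma measurable_hemispheres:
  fixes f :: "real \<Rightarrow> ('n::finite \<Rightarrow> real) \<Rightarrow> 'b::topological_space"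
  assumes "\<And>\<sigma>. \<sigma> \<in> {1, -1} \<Longrightarrow> f \<sigma> \<in> borel_measurable equator_space"
  shows "(\<lambda>(\<sigma>, y). f \<sigma> y) \<in> borel_measurable (hemispheres_space :: (real \<times> ('n \<Rightarrow> real)) measure)"
  by (rule measurable_pair_measure_countable1) (use assms in auto)

lemma sphere_measure_eq:
  "(sphere_measure :: (real^'n::finite) measure) = distr
     (density hemispheres_space (\<lambda>(\<sigma>, y). ennreal (hweight y))) borel (\<lambda>(\<sigma>, y). hemisphere \<sigma> y)"
proof -
  have eq: "(case x of (\<sigma>, y :: 'n \<Rightarrow> real) \<Rightarrow> indicator hemisphere_ball y *
           ennreal \<bar>sphere_volume_form (hemisphere \<sigma> y) (hemisphere_partial \<sigma> y)\<bar>) =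
     (case x of (\<sigma>, y) \<Rightarrow> ennreal (hweight y))" if "x \<in> space hemispheres_space" for x
  proof -
    obtain \<sigma> y where x: "x = (\<sigma>, y)" by (cases x)
    then have \<sigma>: "\<sigma> = 1 \<or> \<sigma> = -1" using that by (auto simp: space_pair_measure)
    have ball: "y \<in> hemisphere_ball \<longleftrightarrow> hsq y < 1" by (simp add: hemisphere_ball_def hsq_def)
    show ?thesis
    proof (cases "hsq y < 1")
      case True
      have "\<bar>sphere_volume_form (hemisphere \<sigma> y) (hemisphere_partial \<sigma> y)\<bar> = hweight y"
        using sphere_volume_form_hemisphere[OF True, of \<sigma>] \<sigma> True by (auto simp: hweight_def)
      then show ?thesis by (simp add: x ball True)
    qed (simp add: x ball hweight_def)
  qed
  have m: "(\<lambda>(\<sigma>, y). ennreal (hweight y)) \<in> borel_measurable (hemispheres_space :: (real \<times> ('n \<Rightarrow> real)) measure)"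
    by (rule measurable_hemispheres) measurable
  have m0: "(\<lambda>(\<sigma>, y). indicator hemisphere_ball y *
      ennreal \<bar>sphere_volume_form (hemisphere \<sigma> y) (hemisphere_partial \<sigma> y)\<bar>)
      \<in> borel_measurable (hemispheres_space :: (real \<times> ('n \<Rightarrow> real)) measure)"
    by (rule iffD2[OF measurable_cong[OF eq] m])
  show ?thesis unfolding sphere_measure_def
    by (rule arg_cong[OF density_cong[OF m0 m AE_I2[OF eq]]])
qed

lemma measurable_hemisphere_pair:
  "(\<lambda>(\<sigma>, y). hemisphere \<sigma> y) \<in> borel_measurable (hemispheres_space :: (real \<times> ('n::finite \<Rightarrow> real)) measure)"
  by (rule measurable_hemispheres) measurable

lemma sets_sphere_measure [measurable_cong, simp]: "sets sphere_measure = sets borel"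
  and space_sphere_measure [simp]: "space sphere_measure = UNIV"
  by (simp_all add: sphere_measure_eq)

lemma product_lborel: "product_sigma_finite (\<lambda>_ :: 'n. lborel :: real measure)"
  by standard

lemma nn_integral_sphere:
  assumes F[measurable]: "F \<in> borel_measurable borel"
  shows "(\<integral>\<^sup>+ x. F x \<partial>(sphere_measure :: (real^'n::finite) measure)) =
    (\<Sum>\<sigma>\<in>{1, -1}. \<integral>\<^sup>+ y. ennreal (hweight y) * F (hemisphere \<sigma> y) \<partial>equator_space)"
proof -
  interpret product_sigma_finite "\<lambda>_ :: 'n. lborel :: real measure" by (rule product_lborel)
  interpret E: sigma_finite_measure "equator_space :: ('n \<Rightarrow> real) measure"
    by (rule sigma_finite) simp
  have m: "(\<lambda>(\<sigma>, y). ennreal (hweight y)) \<in> borel_measurable (hemispheres_space :: (real \<times> ('n \<Rightarrow> real)) measure)"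
    by (rule measurable_hemispheres) measurable
  have mF: "(\<lambda>(\<sigma>, y). F (hemisphere \<sigma> y)) \<in> borel_measurable (hemispheres_space :: (real \<times> ('n \<Rightarrow> real)) measure)"
    by (rule measurable_hemispheres) measurable
  have "(\<integral>\<^sup>+ x. F x \<partial>(sphere_measure :: (real^'n) measure)) =
      (\<integral>\<^sup>+ x. (case x of (\<sigma>, y) \<Rightarrow> F (hemisphere \<sigma> y)) \<partial>density (hemispheres_space :: (real \<times> ('n \<Rightarrow> real)) measure) (\<lambda>(\<sigma>, y). ennreal (hweight y)))"
    unfolding sphere_measure_eq
    using nn_integral_distr[OF equalityD2[OF measurable_cong_sets[OF sets_density refl], THEN subsetD, OF measurable_hemisphere_pair],
      of F "\<lambda>(\<sigma>, y). ennreal (hweight y)"] F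
    by (simp add: case_prod_unfold)
  also have "\<dots> = (\<integral>\<^sup>+ x. (case x of (\<sigma>, y) \<Rightarrow> ennreal (hweight y)) * (case x of (\<sigma>, y) \<Rightarrow> F (hemisphere \<sigma> y))
      \<partial>(hemispheres_space :: (real \<times> ('n \<Rightarrow> real)) measure))"
    by (rule nn_integral_density[OF m mF])
  also have "\<dots> = (\<integral>\<^sup>+ \<sigma>. \<integral>\<^sup>+ y. ennreal (hweight y) * F (hemisphere \<sigma> y) \<partial>equator_space \<partial>count_space {1, -1})"
    using E.nn_integral_fst[OF borel_measurable_times_ennreal[OF m mF]] by (simp only: prod.case)
  also have "\<dots> = (\<Sum>\<sigma>\<in>{1, -1}. \<integral>\<^sup>+ y. ennreal (hweight y) * F (hemisphere \<sigma> y) \<partial>equator_space)"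
    by (rule nn_integral_count_space_finite) simp
  finally show ?thesis .
qed

section \<open>Slices, reflections and integration by parts\<close>

lemma measurable_vec_nth [measurable]: "(\<lambda>x :: real^'n. x $ i) \<in> borel_measurable borel"
proof -
  have "(\<lambda>x :: real^'n. x \<bullet> axis i 1) \<in> borel_measurable borel" by measurable
  then show ?thesis by (simp add: inner_axis)
qed

lemma nn_integral_equator_slice:
  assumes "j \<noteq> (pole :: 'n::finite)" and G: "G \<in> borel_measurable equator_space"
  shows "(\<integral>\<^sup>+ y. G y \<partial>(equator_space :: ('n \<Rightarrow> real) measure)) =
    (\<integral>\<^sup>+ x. \<integral>\<^sup>+ t. G (x(j := t)) \<partial>lborel \<partial>Pi\<^sub>M (equator - {j}) (\<lambda>_. lborel))"
proof -
  interpret product_sigma_finite "\<lambda>_ :: 'n. lborel :: real measure" by (rule product_lborel)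
  have i: "insert j (equator - {j}) = (equator :: 'n set)" using assms(1) by auto
  show ?thesis
    using product_nn_integral_insert[of "equator - {j}" j G] G unfolding i by simp
qed

definition reflect :: "'n \<Rightarrow> real^'n \<Rightarrow> real^'n" where
  "reflect k x = (\<chi> i. if i = k then - x $ i else x $ i)"

lemma reflect_nth: "reflect k x $ i = (if i = k then - x $ i else x $ i)"
  by (simp add: reflect_def)

lemma measurable_reflect [measurable]: "reflect k \<in> borel_measurable (borel :: (real^'n::finite) measure)"
proof -
  have "(\<lambda>x. reflect k x \<bullet> axis i 1) \<in> borel_measurable (borel :: (real^'n) measure)" for i :: 'n
    by (cases "i = k") (simp_all add: inner_axis reflect_nth)
  then show ?thesis
    by (subst borel_measurable_euclidean_space) (auto simp: Basis_vec_def)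
qed

lemma measurable_upd_slice:
  assumes "j \<noteq> (pole :: 'n::finite)" and G: "G \<in> borel_measurable (equator_space :: ('n \<Rightarrow> real) measure)"
    and x: "x \<in> space (Pi\<^sub>M (equator - {j}) (\<lambda>_. lborel :: real measure))"
  shows "(\<lambda>t. G (x(j := t))) \<in> borel_measurable borel"
proof -
  have i: "insert j (equator - {j}) = (equator :: 'n set)" using assms(1) by auto
  have "(\<lambda>t. x(j := t)) \<in> measurable lborel (Pi\<^sub>M (insert j (equator - {j})) (\<lambda>_. lborel :: real measure))"
    by (rule measurable_fun_upd[where J = "equator - {j}"]) (use x in auto)
  then have "(\<lambda>t. x(j := t)) \<in> measurable lborel (equator_space :: ('n \<Rightarrow> real) measure)"
    unfolding i .
  from measurable_comp[OF this G] show ?thesis by (simp add: o_def)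
qed

lemma measurable_hweight_mult:
  fixes F :: "real^'n::finite \<Rightarrow> ennreal"
  assumes [measurable]: "F \<in> borel_measurable borel"
  shows "(\<lambda>y. ennreal (hweight y) * F (hemisphere \<sigma> y)) \<in> borel_measurable equator_space"
  by (intro borel_measurable_times_ennreal measurable_compose[OF measurable_hweight measurable_ennreal]
      measurable_compose[OF measurable_hemisphere] assms)

text \<open>Reflecting the polar coordinate exchanges the two hemispheres. Reflecting any other
  coordinate is the substitution \<open>t \<mapsto> - t\<close> on the slices in that coordinate,
  under which the weight is even.\<close>

lemma nn_integral_reflect_sphere:
  assumes F[measurable]: "F \<in> borel_measurable borel"
  shows "(\<integral>\<^sup>+ x. F (reflect k x) \<partial>(sphere_measure :: (real^'n::finite) measure)) = (\<integral>\<^sup>+ x. F x \<partial>sphere_measure)"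
proof (cases "k = pole")
  case True
  have "reflect k (hemisphere \<sigma> y) = hemisphere (- \<sigma>) y" for \<sigma> and y :: "'n \<Rightarrow> real"
    using True by (simp add: vec_eq_iff reflect_nth hemisphere_nth)
  then show ?thesis by (simp add: nn_integral_sphere add.commute)
next
  case False
  have "(\<integral>\<^sup>+ y. ennreal (hweight y) * F (reflect k (hemisphere \<sigma> y)) \<partial>equator_space) =
      (\<integral>\<^sup>+ y. ennreal (hweight y) * F (hemisphere \<sigma> y) \<partial>equator_space)" for \<sigma>
    unfolding nn_integral_equator_slice[OF False measurable_hweight_mult[OF measurable_compose[OF measurable_reflect F]]]
      nn_integral_equator_slice[OF False measurable_hweight_mult[OF F]]
  proof (rule nn_integral_cong)
    fix x :: "'n \<Rightarrow> real" assume x: "x \<in> space (Pi\<^sub>M (equator - {k}) (\<lambda>_. lborel))"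
    have r: "reflect k (hemisphere \<sigma> (x(k := t))) = hemisphere \<sigma> (x(k := - t))"
      and h: "hweight (x(k := t)) = hweight (x(k := - t))" for t
      using False by (auto simp: vec_eq_iff reflect_nth hemisphere_nth hsq_upd hweight_def)
    have "(\<integral>\<^sup>+ t. ennreal (hweight (x(k := t))) * F (reflect k (hemisphere \<sigma> (x(k := t)))) \<partial>lborel) =
        (\<integral>\<^sup>+ t. ennreal (hweight (x(k := - t))) * F (hemisphere \<sigma> (x(k := - t))) \<partial>lborel)"
      unfolding r h[symmetric] ..
    also have "\<dots> = (\<integral>\<^sup>+ t. ennreal (hweight (x(k := t))) * F (hemisphere \<sigma> (x(k := t))) \<partial>lborel)"
      using nn_integral_real_affine[of "\<lambda>t. ennreal (hweight (x(k := t))) * F (hemisphere \<sigma> (x(k := t)))" "-1" 0]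
        measurable_upd_slice[OF False measurable_hweight_mult[OF F, of \<sigma>] x]
      by simp
    finally show "(\<integral>\<^sup>+ t. ennreal (hweight (x(k := t))) * F (reflect k (hemisphere \<sigma> (x(k := t)))) \<partial>lborel) =
      (\<integral>\<^sup>+ t. ennreal (hweight (x(k := t))) * F (hemisphere \<sigma> (x(k := t))) \<partial>lborel)" .
  qed
  then show ?thesis by (simp add: nn_integral_sphere)
qed

text \<open>The measure is its own image under \<open>reflect k\<close>, so the integral equals its
  negative.\<close>

lemma integral_sphere_odd:
  fixes f :: "real^'n::finite \<Rightarrow> real"
  assumes f[measurable]: "f \<in> borel_measurable borel" and odd: "\<And>x. f (reflect k x) = - f x"
  shows "(\<integral>x. f x \<partial>sphere_measure) = 0"
proof -
  have "distr sphere_measure borel (reflect k) = (sphere_measure :: (real^'n) measure)"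
  proof (rule measure_eqI)
    fix X assume "X \<in> sets (distr sphere_measure borel (reflect k :: real^'n \<Rightarrow> _))"
    then have X[measurable]: "X \<in> sets borel" by simp
    have "emeasure (distr sphere_measure borel (reflect k)) X = (\<integral>\<^sup>+ x. indicator X x \<partial>distr sphere_measure borel (reflect k))"
      by simp
    also have "\<dots> = (\<integral>\<^sup>+ x. indicator X (reflect k x) \<partial>sphere_measure)"
      by (rule nn_integral_distr) simp_all
    also have "\<dots> = (\<integral>\<^sup>+ x. indicator X x \<partial>sphere_measure)"
      by (rule nn_integral_reflect_sphere) simp
    also have "\<dots> = emeasure sphere_measure X" by simp
    finally show "emeasure (distr sphere_measure borel (reflect k)) X = emeasure sphere_measure X" .
  qed simp
  then have "(\<integral>x. f x \<partial>sphere_measure) = (\<integral>x. f x \<partial>distr sphere_measure borel (reflect k))" by simp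
  also have "\<dots> = (\<integral>x. f (reflect k x) \<partial>sphere_measure)"
    by (rule integral_distr) simp_all
  finally show ?thesis by (simp add: odd)
qed

text \<open>Integration by parts with vanishing boundary terms. Continuity is required of
  \<open>a\<close> alone, since in use \<open>b\<close> can be unbounded near the end points; the
  integral of \<open>b\<close> is obtained from those of \<open>a\<close> and of the derivative
  \<open>a - b\<close>.\<close>

lemma nn_integral_FTC_zero:
  fixes f a b :: "real \<Rightarrow> real"
  assumes "0 \<le> \<rho>" "continuous_on {-\<rho>..\<rho>} f" "f \<rho> = 0" "f (- \<rho>) = 0"
    and "\<And>t. t \<in> {-\<rho><..<\<rho>} \<Longrightarrow> (f has_real_derivative (a t - b t)) (at t)"
    and "continuous_on {-\<rho>..\<rho>} a" "\<And>t. t \<in> {-\<rho>..\<rho>} \<Longrightarrow> 0 \<le> a t" "\<And>t. t \<in> {-\<rho>..\<rho>} \<Longrightarrow> 0 \<le> b t"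
  shows "(\<integral>\<^sup>+ t. ennreal (a t) * indicator {-\<rho>..\<rho>} t \<partial>lborel) = (\<integral>\<^sup>+ t. ennreal (b t) * indicator {-\<rho>..\<rho>} t \<partial>lborel)"
proof -
  have 1: "((\<lambda>t. a t - b t) has_integral 0) {-\<rho>..\<rho>}"
    using fundamental_theorem_of_calculus_interior[of "-\<rho>" \<rho> f "\<lambda>t. a t - b t"] assms
    by (simp add: has_real_derivative_iff_has_vector_derivative)
  obtain I where 2: "(a has_integral I) {-\<rho>..\<rho>}"
    using integrable_continuous_interval[OF assms(6)] by (auto simp: integrable_on_def)
  have 3: "(b has_integral I) {-\<rho>..\<rho>}"
    using has_integral_diff[OF 2 1] by simp
  show ?thesis
    using nn_integral_has_integral_lebesgue'[OF assms(7) 2] nn_integral_has_integral_lebesgue'[OF assms(8) 3]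
    by simp
qed

text \<open>The sphere density along a line on which a single non-polar coordinate \<open>t\<close>
  varies. Together with the polar coordinate, \<open>t\<close> runs through a half circle of radius
  \<open>\<rho>\<close>.\<close>

definition slice_weight :: "real \<Rightarrow> real \<Rightarrow> real" where
  "slice_weight \<rho> t = (if t\<^sup>2 < \<rho>\<^sup>2 then 1 / sqrt (\<rho>\<^sup>2 - t\<^sup>2) else 0)"

lemma square_less_iff_interval:
  assumes "0 < (\<rho>::real)"
  shows "t\<^sup>2 < \<rho>\<^sup>2 \<longleftrightarrow> t \<in> {-\<rho><..<\<rho>}" and "t\<^sup>2 \<le> \<rho>\<^sup>2 \<longleftrightarrow> t \<in> {-\<rho>..\<rho>}"
proof -
  have "\<bar>t\<bar> < \<bar>\<rho>\<bar> \<longleftrightarrow> t \<in> {-\<rho><..<\<rho>}" "\<bar>t\<bar> \<le> \<bar>\<rho>\<bar> \<longleftrightarrow> t \<in> {-\<rho>..\<rho>}"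
    using assms by auto
  then show "t\<^sup>2 < \<rho>\<^sup>2 \<longleftrightarrow> t \<in> {-\<rho><..<\<rho>}" "t\<^sup>2 \<le> \<rho>\<^sup>2 \<longleftrightarrow> t \<in> {-\<rho>..\<rho>}"
    unfolding abs_le_square_iff[symmetric] not_le[symmetric] by simp_all
qed

text \<open>With \<open>t = \<rho> sin \<theta>\<close> these say that over a half period
  \<open>sin^4\<close> and \<open>cos^4\<close> have the same integral as
  \<open>3 sin^2 cos^2\<close>, and \<open>sin^2\<close> the same as \<open>cos^2\<close>. With
  \<open>s = sqrt (\<rho>\<^sup>2 - t\<^sup>2)\<close>, the functions integrated by parts are
  \<open>t^3 s\<close>, \<open>- t (\<rho>\<^sup>2 - t\<^sup>2) s\<close> and \<open>t s\<close>,
  all zero at both ends.\<close>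

lemma slice_integrals:
  assumes \<rho>: "0 < \<rho>"
  shows "(\<integral>\<^sup>+ t. ennreal (slice_weight \<rho> t * t ^ 4) \<partial>lborel) =
      (\<integral>\<^sup>+ t. ennreal (slice_weight \<rho> t * (3 * (t\<^sup>2 * (\<rho>\<^sup>2 - t\<^sup>2)))) \<partial>lborel)" (is ?A)
    and "(\<integral>\<^sup>+ t. ennreal (slice_weight \<rho> t * (\<rho>\<^sup>2 - t\<^sup>2)\<^sup>2) \<partial>lborel) =
      (\<integral>\<^sup>+ t. ennreal (slice_weight \<rho> t * (3 * (t\<^sup>2 * (\<rho>\<^sup>2 - t\<^sup>2)))) \<partial>lborel)" (is ?B)
    and "(\<integral>\<^sup>+ t. ennreal (slice_weight \<rho> t * t\<^sup>2) \<partial>lborel) =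
      (\<integral>\<^sup>+ t. ennreal (slice_weight \<rho> t * (\<rho>\<^sup>2 - t\<^sup>2)) \<partial>lborel)" (is ?C)
proof -
  define s where "s t = sqrt (\<rho>\<^sup>2 - t\<^sup>2)" for t
  have s: "s t > 0" "s t * s t = \<rho>\<^sup>2 - t\<^sup>2" if "t \<in> {-\<rho><..<\<rho>}" for t
    using that square_less_iff_interval(1)[OF \<rho>, of t] by (simp_all add: s_def)
  have s0: "0 \<le> s t" if "t \<in> {-\<rho>..\<rho>}" for t
    using that square_less_iff_interval(2)[OF \<rho>, of t] by (simp add: s_def)
  have ds: "(s has_real_derivative (- t / s t)) (at t)" if "t \<in> {-\<rho><..<\<rho>}" for t
    unfolding s_def using that square_less_iff_interval(1)[OF \<rho>, of t]
    by (auto intro!: derivative_eq_intros simp: field_simps)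
  have cs: "continuous_on X s" for X unfolding s_def by (intro continuous_intros)
  have end0: "s \<rho> = 0" "s (- \<rho>) = 0" by (simp_all add: s_def)
  \<comment> \<open>Inside the interval the weight is \<open>1 / s\<close>, so the integrand is
    \<open>w\<close>. At the end points the weight is 0, hence \<open>w\<close> has to vanish there
    as well; the quotients by \<open>s\<close> used below do so because division by zero yields
    0.\<close>
  have eq: "(\<integral>\<^sup>+ t. ennreal (slice_weight \<rho> t * p t) \<partial>lborel) =
      (\<integral>\<^sup>+ t. ennreal (w t) * indicator {-\<rho>..\<rho>} t \<partial>lborel)"
    if "\<And>t. t \<in> {-\<rho><..<\<rho>} \<Longrightarrow> p t = w t * s t" "w \<rho> = 0" "w (- \<rho>) = 0" for p w
  proof (rule nn_integral_cong)
    fix t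
    show "ennreal (slice_weight \<rho> t * p t) = ennreal (w t) * indicator {-\<rho>..\<rho>} t"
    proof (cases "t \<in> {-\<rho><..<\<rho>}")
      case True
      then show ?thesis
        using that(1)[OF True] s(1)[OF True] square_less_iff_interval(1)[OF \<rho>, of t]
        by (simp add: slice_weight_def s_def)
    next
      case False
      then have "\<not> t\<^sup>2 < \<rho>\<^sup>2" using square_less_iff_interval(1)[OF \<rho>] by blast
      then have "slice_weight \<rho> t = 0" by (simp only: slice_weight_def if_False)
      moreover have "w t = 0 \<or> t \<notin> {-\<rho>..\<rho>}" using False that(2,3) by (cases "t = \<rho> \<or> t = - \<rho>") auto
      ultimately show ?thesis by auto
    qed
  qed
  have mid: "(\<integral>\<^sup>+ t. ennreal (slice_weight \<rho> t * (3 * (t\<^sup>2 * (\<rho>\<^sup>2 - t\<^sup>2)))) \<partial>lborel) =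
      (\<integral>\<^sup>+ t. ennreal (3 * t\<^sup>2 * s t) * indicator {-\<rho>..\<rho>} t \<partial>lborel)"
    by (rule eq) (use s(2) end0 in \<open>auto simp: mult.assoc\<close>)
  have left4: "(\<integral>\<^sup>+ t. ennreal (slice_weight \<rho> t * t ^ 4) \<partial>lborel) =
      (\<integral>\<^sup>+ t. ennreal (t ^ 4 / s t) * indicator {-\<rho>..\<rho>} t \<partial>lborel)"
    by (rule eq) (use s(1) end0 in force)+
  have right4: "(\<integral>\<^sup>+ t. ennreal (slice_weight \<rho> t * (\<rho>\<^sup>2 - t\<^sup>2)\<^sup>2) \<partial>lborel) =
      (\<integral>\<^sup>+ t. ennreal ((\<rho>\<^sup>2 - t\<^sup>2) * s t) * indicator {-\<rho>..\<rho>} t \<partial>lborel)"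
    by (rule eq) (use s(2) end0 in \<open>auto simp: mult.assoc power2_eq_square\<close>)
  have left2: "(\<integral>\<^sup>+ t. ennreal (slice_weight \<rho> t * t\<^sup>2) \<partial>lborel) =
      (\<integral>\<^sup>+ t. ennreal (t\<^sup>2 / s t) * indicator {-\<rho>..\<rho>} t \<partial>lborel)"
    by (rule eq) (use s(1) end0 in force)+
  have right2: "(\<integral>\<^sup>+ t. ennreal (slice_weight \<rho> t * (\<rho>\<^sup>2 - t\<^sup>2)) \<partial>lborel) =
      (\<integral>\<^sup>+ t. ennreal (s t) * indicator {-\<rho>..\<rho>} t \<partial>lborel)"
    by (rule eq) (use s(2) end0 in auto)
  have nn: "0 \<le> \<rho>\<^sup>2 - t\<^sup>2" if "t \<in> {-\<rho>..\<rho>}" for t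
    using that square_less_iff_interval(2)[OF \<rho>, of t] by simp
  show ?A unfolding left4 mid
  proof (rule nn_integral_FTC_zero[where f = "\<lambda>t. t ^ 3 * s t", symmetric])
    fix t assume t: "t \<in> {-\<rho><..<\<rho>}"
    show "((\<lambda>t. t ^ 3 * s t) has_real_derivative (3 * t\<^sup>2 * s t - t ^ 4 / s t)) (at t)"
      using s(1)[OF t]
      by (auto intro!: derivative_eq_intros ds[OF t] simp: field_simps power2_eq_square power3_eq_cube power4_eq_xxxx)
  qed (use \<rho> in \<open>auto intro!: continuous_intros cs mult_nonneg_nonneg divide_nonneg_nonneg s0 simp: end0\<close>)
  show ?B unfolding right4 mid
  proof (rule nn_integral_FTC_zero[where f = "\<lambda>t. - (t * (\<rho>\<^sup>2 - t\<^sup>2) * s t)", symmetric])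
    fix t assume t: "t \<in> {-\<rho><..<\<rho>}"
    have "((\<lambda>t. - (t * (\<rho>\<^sup>2 - t\<^sup>2) * s t)) has_real_derivative
        - ((\<rho>\<^sup>2 - t\<^sup>2 - 2 * t * t) * s t + t * (\<rho>\<^sup>2 - t\<^sup>2) * (- t / s t))) (at t)"
      by (auto intro!: derivative_eq_intros ds[OF t] simp: algebra_simps power2_eq_square)
    also have "- ((\<rho>\<^sup>2 - t\<^sup>2 - 2 * t * t) * s t + t * (\<rho>\<^sup>2 - t\<^sup>2) * (- t / s t)) =
        3 * t\<^sup>2 * s t - (\<rho>\<^sup>2 - t\<^sup>2) * s t"
      unfolding s(2)[OF t, symmetric] using s(1)[OF t] by (simp add: field_simps power2_eq_square)
    finally show "((\<lambda>t. - (t * (\<rho>\<^sup>2 - t\<^sup>2) * s t)) has_real_derivative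
        (3 * t\<^sup>2 * s t - (\<rho>\<^sup>2 - t\<^sup>2) * s t)) (at t)" .
  qed (use \<rho> nn in \<open>auto intro!: continuous_intros cs mult_nonneg_nonneg s0 simp: end0\<close>)
  show ?C unfolding left2 right2
  proof (rule nn_integral_FTC_zero[where f = "\<lambda>t. t * s t", symmetric])
    fix t assume t: "t \<in> {-\<rho><..<\<rho>}"
    show "((\<lambda>t. t * s t) has_real_derivative (s t - t\<^sup>2 / s t)) (at t)"
      using s(1)[OF t]
      by (auto intro!: derivative_eq_intros ds[OF t] simp: field_simps power2_eq_square)
  qed (use \<rho> in \<open>auto intro!: continuous_intros cs mult_nonneg_nonneg divide_nonneg_nonneg s0 simp: end0\<close>)
qed


section \<open>Fourth moments of the sphere\<close>

lemma hweight_slice: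
  fixes x :: "'n::finite \<Rightarrow> real"
  assumes "j \<noteq> pole"
  defines "r \<equiv> \<Sum>k\<in>equator - {j}. (x k)\<^sup>2"
  shows "hweight (x(j := t)) = (if r < 1 then slice_weight (sqrt (1 - r)) t else 0)"
proof (cases "r < 1")
  case True
  then have "(sqrt (1 - r))\<^sup>2 = 1 - r" by simp
  moreover have "t\<^sup>2 + r < 1 \<longleftrightarrow> t\<^sup>2 < 1 - r" by auto
  ultimately show ?thesis
    using True by (simp add: hweight_def hsq_upd[OF assms(1)] slice_weight_def r_def[symmetric] algebra_simps)
next
  case False
  then have "\<not> t\<^sup>2 + r < 1" using zero_le_power2[of t] by linarith
  then show ?thesis using False by (simp add: hweight_def hsq_upd[OF assms(1)] r_def[symmetric])
qed

lemma nn_integral_sphere_real: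
  fixes F :: "real^'n::finite \<Rightarrow> real"
  assumes [measurable]: "F \<in> borel_measurable borel"
  shows "(\<integral>\<^sup>+ x. ennreal (F x) \<partial>sphere_measure) =
    (\<Sum>\<sigma>\<in>{1, -1}. \<integral>\<^sup>+ y. ennreal (hweight y * F (hemisphere \<sigma> y)) \<partial>equator_space)"
  by (subst nn_integral_sphere) (simp_all add: ennreal_mult'[OF hweight_nonneg])

lemma measurable_hweight_times:
  fixes F :: "real^'n::finite \<Rightarrow> real"
  assumes "F \<in> borel_measurable borel"
  shows "(\<lambda>y. ennreal (hweight y * F (hemisphere \<sigma> y))) \<in> borel_measurable equator_space"
  by (intro measurable_compose[OF _ measurable_ennreal] borel_measurable_times measurable_hweight
      measurable_compose[OF measurable_hemisphere assms])

text \<open>By Tonelli it suffices to compare two integrals on each slice in the coordinate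
  \<open>j\<close>. The curve \<open>h\<close> records what a moment can see of a slice:
  \<open>j\<close> is the parameter, the other non-polar coordinates are constant, and the polar one
  has square \<open>\<rho>\<^sup>2 - t\<^sup>2\<close>. The last condition is restricted to nonzero
  weight, since beyond the sphere the chart formula is meaningless.\<close>

lemma nn_integral_sphere_slice_cong:
  fixes F G :: "real^'n::finite \<Rightarrow> real"
  assumes j: "j \<noteq> pole" and F: "F \<in> borel_measurable borel" and G: "G \<in> borel_measurable borel"
    and eq: "\<And>h \<rho> c. \<rho> > 0 \<Longrightarrow> (\<And>t. h t $ j = t) \<Longrightarrow> (\<And>k t. k \<noteq> j \<Longrightarrow> k \<noteq> pole \<Longrightarrow> h t $ k = c k) \<Longrightarrow>
      (\<And>t. slice_weight \<rho> t \<noteq> 0 \<Longrightarrow> (h t $ pole)\<^sup>2 = \<rho>\<^sup>2 - t\<^sup>2) \<Longrightarrow>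
      (\<integral>\<^sup>+ t. ennreal (slice_weight \<rho> t * F (h t)) \<partial>lborel) = (\<integral>\<^sup>+ t. ennreal (slice_weight \<rho> t * G (h t)) \<partial>lborel)"
  shows "(\<integral>\<^sup>+ x. ennreal (F x) \<partial>sphere_measure) = (\<integral>\<^sup>+ x. ennreal (G x) \<partial>sphere_measure)"
  unfolding nn_integral_sphere_real[OF F] nn_integral_sphere_real[OF G]
    nn_integral_equator_slice[OF j measurable_hweight_times[OF F]]
    nn_integral_equator_slice[OF j measurable_hweight_times[OF G]]
proof (rule sum.cong[OF refl], rule nn_integral_cong)
  fix \<sigma> :: real and x :: "'n \<Rightarrow> real" assume \<sigma>: "\<sigma> \<in> {1, -1}"
  define r where "r = (\<Sum>k\<in>equator - {j}. (x k)\<^sup>2)"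
  show "(\<integral>\<^sup>+ t. ennreal (hweight (x(j := t)) * F (hemisphere \<sigma> (x(j := t)))) \<partial>lborel) =
      (\<integral>\<^sup>+ t. ennreal (hweight (x(j := t)) * G (hemisphere \<sigma> (x(j := t)))) \<partial>lborel)"
  proof (cases "r < 1")
    case True
    define \<rho> where "\<rho> = sqrt (1 - r)"
    have \<rho>: "\<rho> > 0" "\<rho>\<^sup>2 = 1 - r" using True by (simp_all add: \<rho>_def)
    have "(hemisphere \<sigma> (x(j := t)) $ pole)\<^sup>2 = \<rho>\<^sup>2 - t\<^sup>2" if "slice_weight \<rho> t \<noteq> 0" for t
    proof -
      have "t\<^sup>2 < \<rho>\<^sup>2" using that by (auto simp: slice_weight_def split: if_splits)
      then have "hsq (x(j := t)) < 1" and "\<rho>\<^sup>2 - t\<^sup>2 = 1 - hsq (x(j := t))"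
        by (simp_all add: hsq_upd[OF j] r_def[symmetric] \<rho>(2))
      then show ?thesis using \<sigma> by (auto simp: hemisphere_nth power_mult_distrib)
    qed
    from eq[of \<rho> "\<lambda>t. hemisphere \<sigma> (x(j := t))" x, OF \<rho>(1) _ _ this] show ?thesis
      using True j by (simp add: hweight_slice[OF j] r_def[symmetric] \<rho>_def[symmetric] hemisphere_nth)
  qed (simp add: hweight_slice[OF j] r_def[symmetric])
qed

lemma measurable_moment: "(\<lambda>x :: real^'n::finite. (x $ i)\<^sup>2 * (x $ k)\<^sup>2) \<in> borel_measurable borel"
  by measurable

text \<open>Both indices lie in the plane of the slice circle, so the first two slice integrals
  apply directly and produce the factor 3.\<close>

lemma moment_meridian:
  assumes j: "j \<noteq> (pole :: 'n::finite)"
  shows "(\<integral>\<^sup>+ x. ennreal ((x $ j)\<^sup>2 * (x $ j)\<^sup>2) \<partial>(sphere_measure :: (real^'n) measure)) =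
      3 * (\<integral>\<^sup>+ x. ennreal ((x $ j)\<^sup>2 * (x $ pole)\<^sup>2) \<partial>sphere_measure)" (is "?A = _")
    and "(\<integral>\<^sup>+ x. ennreal ((x $ pole)\<^sup>2 * (x $ pole)\<^sup>2) \<partial>(sphere_measure :: (real^'n) measure)) =
      3 * (\<integral>\<^sup>+ x. ennreal ((x $ j)\<^sup>2 * (x $ pole)\<^sup>2) \<partial>sphere_measure)" (is "?B = _")
proof -
  have 3: "3 * (\<integral>\<^sup>+ x. ennreal ((x $ j)\<^sup>2 * (x $ pole)\<^sup>2) \<partial>(sphere_measure :: (real^'n) measure)) =
      (\<integral>\<^sup>+ x. ennreal (3 * ((x $ j)\<^sup>2 * (x $ pole)\<^sup>2)) \<partial>sphere_measure)"
    by (subst nn_integral_cmult[symmetric]) (simp_all add: ennreal_mult'[of 3])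
  have m3: "(\<lambda>x :: real^'n. 3 * ((x $ j)\<^sup>2 * (x $ pole)\<^sup>2)) \<in> borel_measurable borel" by measurable
  show "?A = 3 * (\<integral>\<^sup>+ x. ennreal ((x $ j)\<^sup>2 * (x $ pole)\<^sup>2) \<partial>sphere_measure)"
    unfolding 3
  proof (rule nn_integral_sphere_slice_cong[OF j measurable_moment m3])
    fix h :: "real \<Rightarrow> real^'n" and \<rho> :: real
    assume \<rho>: "\<rho> > 0" and h: "\<And>t. h t $ j = t" "\<And>t. slice_weight \<rho> t \<noteq> 0 \<Longrightarrow> (h t $ pole)\<^sup>2 = \<rho>\<^sup>2 - t\<^sup>2"
    have "slice_weight \<rho> t * (3 * ((h t $ j)\<^sup>2 * (h t $ pole)\<^sup>2)) = slice_weight \<rho> t * (3 * (t\<^sup>2 * (\<rho>\<^sup>2 - t\<^sup>2)))"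
      "slice_weight \<rho> t * ((h t $ j)\<^sup>2 * (h t $ j)\<^sup>2) = slice_weight \<rho> t * t ^ 4" for t
      using h[of t] by (cases "slice_weight \<rho> t = 0"; simp)+
    then show "(\<integral>\<^sup>+ t. ennreal (slice_weight \<rho> t * ((h t $ j)\<^sup>2 * (h t $ j)\<^sup>2)) \<partial>lborel) =
        (\<integral>\<^sup>+ t. ennreal (slice_weight \<rho> t * (3 * ((h t $ j)\<^sup>2 * (h t $ pole)\<^sup>2))) \<partial>lborel)"
      using slice_integrals(1)[OF \<rho>] by (simp only:)
  qed
  show "?B = 3 * (\<integral>\<^sup>+ x. ennreal ((x $ j)\<^sup>2 * (x $ pole)\<^sup>2) \<partial>sphere_measure)"
    unfolding 3
  proof (rule nn_integral_sphere_slice_cong[OF j measurable_moment m3])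
    fix h :: "real \<Rightarrow> real^'n" and \<rho> :: real
    assume \<rho>: "\<rho> > 0" and h: "\<And>t. h t $ j = t" "\<And>t. slice_weight \<rho> t \<noteq> 0 \<Longrightarrow> (h t $ pole)\<^sup>2 = \<rho>\<^sup>2 - t\<^sup>2"
    have "slice_weight \<rho> t * (3 * ((h t $ j)\<^sup>2 * (h t $ pole)\<^sup>2)) = slice_weight \<rho> t * (3 * (t\<^sup>2 * (\<rho>\<^sup>2 - t\<^sup>2)))"
      "slice_weight \<rho> t * ((h t $ pole)\<^sup>2 * (h t $ pole)\<^sup>2) = slice_weight \<rho> t * (\<rho>\<^sup>2 - t\<^sup>2)\<^sup>2" for t
      using h[of t] by (cases "slice_weight \<rho> t = 0"; simp add: power2_eq_square[of "\<rho>\<^sup>2 - t\<^sup>2"])+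
    then show "(\<integral>\<^sup>+ t. ennreal (slice_weight \<rho> t * ((h t $ pole)\<^sup>2 * (h t $ pole)\<^sup>2)) \<partial>lborel) =
        (\<integral>\<^sup>+ t. ennreal (slice_weight \<rho> t * (3 * ((h t $ j)\<^sup>2 * (h t $ pole)\<^sup>2))) \<partial>lborel)"
      using slice_integrals(2)[OF \<rho>] by (simp only:)
  qed
qed

text \<open>The coordinate \<open>k\<close> is constant on the slice and factors out; the remaining
  second moments of \<open>j\<close> and of the polar coordinate agree by the third slice
  integral.\<close>

lemma moment_parallel:
  assumes j: "j \<noteq> (pole :: 'n::finite)" and k: "k \<noteq> j" "k \<noteq> pole"
  shows "(\<integral>\<^sup>+ x. ennreal ((x $ j)\<^sup>2 * (x $ k)\<^sup>2) \<partial>(sphere_measure :: (real^'n) measure)) =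
      (\<integral>\<^sup>+ x. ennreal ((x $ pole)\<^sup>2 * (x $ k)\<^sup>2) \<partial>sphere_measure)"
proof (rule nn_integral_sphere_slice_cong[OF j measurable_moment measurable_moment])
  fix h :: "real \<Rightarrow> real^'n" and \<rho> :: real and c
  assume \<rho>: "\<rho> > 0" and h: "\<And>t. h t $ j = t" "\<And>k t. k \<noteq> j \<Longrightarrow> k \<noteq> pole \<Longrightarrow> h t $ k = c k"
    "\<And>t. slice_weight \<rho> t \<noteq> 0 \<Longrightarrow> (h t $ pole)\<^sup>2 = \<rho>\<^sup>2 - t\<^sup>2"
  have m: "(\<lambda>t. slice_weight \<rho> t * t\<^sup>2) \<in> borel_measurable borel" "(\<lambda>t. slice_weight \<rho> t * (\<rho>\<^sup>2 - t\<^sup>2)) \<in> borel_measurable borel"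
    unfolding slice_weight_def by measurable
  have "ennreal (slice_weight \<rho> t * ((h t $ j)\<^sup>2 * (h t $ k)\<^sup>2)) = ennreal (slice_weight \<rho> t * t\<^sup>2) * ennreal ((c k)\<^sup>2)"
    "ennreal (slice_weight \<rho> t * ((h t $ pole)\<^sup>2 * (h t $ k)\<^sup>2)) =
      ennreal (slice_weight \<rho> t * (\<rho>\<^sup>2 - t\<^sup>2)) * ennreal ((c k)\<^sup>2)" for t
    using h(1,3)[of t] h(2)[OF k] by (cases "slice_weight \<rho> t = 0"; simp add: ennreal_mult''[symmetric] mult.assoc)+
  then show "(\<integral>\<^sup>+ t. ennreal (slice_weight \<rho> t * ((h t $ j)\<^sup>2 * (h t $ k)\<^sup>2)) \<partial>lborel) =
      (\<integral>\<^sup>+ t. ennreal (slice_weight \<rho> t * ((h t $ pole)\<^sup>2 * (h t $ k)\<^sup>2)) \<partial>lborel)"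
    using m slice_integrals(3)[OF \<rho>] by (simp add: nn_integral_multc)
qed

text \<open>The square of the polar coordinate is \<open>1 - hsq y\<close>, which absorbs the
  singularity of the weight and leaves \<open>(y j)\<^sup>2 * sqrt (1 - hsq y) \<le> 1\<close>. The
  integrand is thus dominated by the indicator of the cube \<open>Q\<close>, whose volume is
  finite.\<close>

lemma moment_finite:
  assumes j: "j \<noteq> (pole :: 'n::finite)"
  shows "(\<integral>\<^sup>+ x. ennreal ((x $ j)\<^sup>2 * (x $ pole)\<^sup>2) \<partial>(sphere_measure :: (real^'n) measure)) < \<infinity>"
proof -
  interpret product_sigma_finite "\<lambda>_ :: 'n. lborel :: real measure" by (rule product_lborel)
  define Q :: "('n \<Rightarrow> real) set" where "Q = Pi\<^sub>E equator (\<lambda>_. {-1..1})"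
  have "emeasure equator_space Q = (\<Prod>i\<in>(equator :: 'n set). emeasure lborel {-1..1::real})"
    using emeasure_PiM[of equator "\<lambda>_. {-1..1}"] by (simp add: Q_def)
  also have "\<dots> < \<infinity>" by (simp add: power_less_top_ennreal)
  finally have Q: "emeasure equator_space Q < \<infinity>" .
  have Qs: "Q \<in> sets equator_space" unfolding Q_def by (rule sets_PiM_I_finite) auto
  have "(\<integral>\<^sup>+ y. ennreal (hweight y * ((hemisphere \<sigma> y $ j)\<^sup>2 * (hemisphere \<sigma> y $ pole)\<^sup>2)) \<partial>equator_space) < \<infinity>"
    if \<sigma>: "\<sigma> \<in> {1, -1}" for \<sigma>
  proof -
    have "(\<integral>\<^sup>+ y. ennreal (hweight y * ((hemisphere \<sigma> y $ j)\<^sup>2 * (hemisphere \<sigma> y $ pole)\<^sup>2)) \<partial>equator_space)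
      \<le> (\<integral>\<^sup>+ y. indicator Q y \<partial>equator_space)"
    proof (rule nn_integral_mono)
      fix y :: "'n \<Rightarrow> real" assume y: "y \<in> space equator_space"
      show "ennreal (hweight y * ((hemisphere \<sigma> y $ j)\<^sup>2 * (hemisphere \<sigma> y $ pole)\<^sup>2)) \<le> indicator Q y"
      proof (cases "hsq y < 1")
        case True
        have le: "(y k)\<^sup>2 \<le> hsq y" if "k \<noteq> pole" for k
          unfolding hsq_def by (rule member_le_sum) (use that in auto)
        then have "(y k)\<^sup>2 \<le> 1" if "k \<noteq> pole" for k using True that by fastforce
        then have "y k \<in> {-1..1}" if "k \<noteq> pole" for k
          using that by (auto simp: abs_square_le_1 abs_le_iff)
        then have "y \<in> Q" using y by (auto simp: Q_def space_PiM PiE_iff)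
        moreover have "hsq y \<ge> 0" unfolding hsq_def by (intro sum_nonneg) auto
        moreover have "(hemisphere \<sigma> y $ pole)\<^sup>2 = 1 - hsq y"
          using \<sigma> True by (auto simp: hemisphere_nth power_mult_distrib)
        then have "hweight y * ((hemisphere \<sigma> y $ j)\<^sup>2 * (hemisphere \<sigma> y $ pole)\<^sup>2) = (y j)\<^sup>2 * sqrt (1 - hsq y)"
          using True j real_div_sqrt[of "1 - hsq y"] by (simp add: hweight_def hemisphere_nth[of _ _ j] field_simps)
        moreover have "(y j)\<^sup>2 * sqrt (1 - hsq y) \<le> 1 * 1"
          using le[OF j] True \<open>hsq y \<ge> 0\<close> by (intro mult_mono) auto
        ultimately show ?thesis by simp
      qed (simp add: hweight_def)
    qed
    also have "\<dots> = emeasure equator_space Q" using Qs by simp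
    finally show ?thesis using Q by (rule le_less_trans)
  qed
  then show ?thesis unfolding nn_integral_sphere_real[OF measurable_moment] by simp
qed


text \<open>The dimension bound supplies one non-polar index, whose mixed moment with the pole
  defines \<open>C\<close>. The fourth moment of the pole is then \<open>3 * C\<close>, and as it
  equals three times the mixed moment of every other index with the pole, all of these are
  \<open>C\<close>. Slices in the remaining coordinates carry this to all pairs.\<close>

lemma sphere_moments:
  assumes "CARD('n::finite) \<ge> 2"
  shows "\<exists>C\<ge>0. \<forall>i k. (\<integral>\<^sup>+ x. ennreal ((x $ i)\<^sup>2 * (x $ k)\<^sup>2) \<partial>(sphere_measure :: (real^'n) measure)) =
    ennreal (if i = k then 3 * C else C)"
proof -
  define M where "M i k = (\<integral>\<^sup>+ x. ennreal ((x $ i)\<^sup>2 * (x $ k)\<^sup>2) \<partial>(sphere_measure :: (real^'n) measure))" for i k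
  have sym: "M i k = M k i" for i k by (simp add: M_def mult.commute)
  have "\<exists>j. j \<noteq> (pole :: 'n)"
  proof (rule ccontr)
    assume "\<not> (\<exists>j. j \<noteq> (pole :: 'n))"
    then have "UNIV = {pole :: 'n}" by auto
    then have "CARD('n) = 1" by (metis card_1_singleton_iff One_nat_def)
    then show False using assms by simp
  qed
  then obtain j0 :: 'n where j0: "j0 \<noteq> pole" by blast
  define C where "C = enn2real (M j0 pole)"
  have C: "M j0 pole = ennreal C"
    using moment_finite[OF j0] by (simp add: C_def M_def)
  have pp: "M pole pole = ennreal (3 * C)"
    using moment_meridian(2)[OF j0] C by (simp add: M_def ennreal_mult')
  have jp: "M j pole = ennreal C" if j: "j \<noteq> pole" for j
  proof -
    \<comment> \<open>Finiteness is what permits cancelling the factor 3 in the extended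
      reals.\<close>
    obtain D where D: "M j pole = ennreal D" "D \<ge> 0"
      using moment_finite[OF j] by (cases "M j pole") (auto simp: M_def)
    have "3 * ennreal D = ennreal (3 * C)"
      using moment_meridian(2)[OF j] pp D by (simp add: M_def)
    then have "ennreal (3 * D) = ennreal (3 * C)" by (simp add: ennreal_mult')
    then show ?thesis using D by (simp add: C_def)
  qed
  have "M i k = ennreal (if i = k then 3 * C else C)" for i k
  proof (cases "i = k")
    case True
    show ?thesis
      using True pp moment_meridian(1)[of k] jp[of k] by (cases "k = pole") (auto simp: M_def ennreal_mult')
  next
    case False
    show ?thesis
    proof (cases "i = pole \<or> k = pole")
      case True
      then show ?thesis using False jp[of i] jp[of k] sym[of i k] by auto
    next
      case no_pole: False
      have "M i k = M pole k" using moment_parallel[of i k] no_pole False by (auto simp: M_def)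
      then show ?thesis using jp[of k] sym[of pole k] no_pole False by simp
    qed
  qed
  moreover have "0 \<le> C" by (simp add: C_def)
  ultimately show ?thesis unfolding M_def by blast
qed

text \<open>On both hemispheres the indicator of \<open>X\<close> equals
  \<open>(\<Sum>i. x_i^2)^2\<close>, whose expansion is the sum of moments. This computes the volume
  without knowing a closed formula for it.\<close>

lemma emeasure_sphere_measure:
  fixes X :: "(real^'n::finite) set"
  assumes X: "X \<in> sets borel" "sphere 0 1 \<subseteq> X"
  shows "emeasure sphere_measure X = (\<Sum>i\<in>UNIV. \<Sum>k\<in>UNIV. \<integral>\<^sup>+ x. ennreal ((x $ i)\<^sup>2 * (x $ k)\<^sup>2) \<partial>(sphere_measure :: (real^'n) measure))"
proof -
  have norm1: "(\<Sum>i\<in>UNIV. (hemisphere \<sigma> y $ i)\<^sup>2) = 1" if "hsq y < 1" "\<sigma> \<in> {1, -1}" for \<sigma> and y :: "'n \<Rightarrow> real"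
  proof -
    have "(\<Sum>i\<in>UNIV. (hemisphere \<sigma> y $ i)\<^sup>2) = (hemisphere \<sigma> y $ pole)\<^sup>2 + (\<Sum>i\<in>equator. (hemisphere \<sigma> y $ i)\<^sup>2)"
      by (rule sum.remove) auto
    also have "(\<Sum>i\<in>equator. (hemisphere \<sigma> y $ i)\<^sup>2) = hsq y"
      unfolding hsq_def by (intro sum.cong) (auto simp: hemisphere_nth)
    also have "(hemisphere \<sigma> y $ pole)\<^sup>2 = 1 - hsq y"
      using that by (auto simp: hemisphere_nth power_mult_distrib)
    finally show ?thesis by simp
  qed
  have in_X: "hemisphere \<sigma> y \<in> X" if "hsq y < 1" "\<sigma> \<in> {1, -1}" for \<sigma> and y :: "'n \<Rightarrow> real"
  proof -
    have "norm (hemisphere \<sigma> y) = 1"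
      using norm1[OF that] by (simp add: norm_vec_def L2_set_def)
    then show ?thesis using X(2) by auto
  qed
  have "emeasure sphere_measure X = (\<integral>\<^sup>+ x. ennreal (indicator X x) \<partial>sphere_measure)"
    using X(1) by (simp add: ennreal_indicator)
  also have "\<dots> = (\<integral>\<^sup>+ x. ennreal ((\<Sum>i\<in>UNIV. (x $ i)\<^sup>2) * (\<Sum>i\<in>UNIV. (x $ i)\<^sup>2)) \<partial>(sphere_measure :: (real^'n) measure))"
  proof -
    have mi: "(indicator X :: _ \<Rightarrow> real) \<in> borel_measurable borel" using X(1) by simp
    have ms: "(\<lambda>x :: real^'n. (\<Sum>i\<in>UNIV. (x $ i)\<^sup>2) * (\<Sum>i\<in>UNIV. (x $ i)\<^sup>2)) \<in> borel_measurable borel" by measurable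
    show ?thesis
      unfolding nn_integral_sphere_real[OF mi] nn_integral_sphere_real[OF ms]
    proof (rule sum.cong[OF refl], rule nn_integral_cong)
      fix \<sigma> :: real and y :: "'n \<Rightarrow> real" assume \<sigma>: "\<sigma> \<in> {1, -1}"
      show "ennreal (hweight y * indicator X (hemisphere \<sigma> y)) = ennreal (hweight y *
        ((\<Sum>i\<in>UNIV. (hemisphere \<sigma> y $ i)\<^sup>2) * (\<Sum>i\<in>UNIV. (hemisphere \<sigma> y $ i)\<^sup>2)))"
        using norm1[OF _ \<sigma>, of y] in_X[OF _ \<sigma>, of y] by (cases "hsq y < 1") (simp_all add: hweight_def)
    qed
  qed
  also have "\<dots> = (\<integral>\<^sup>+ x. (\<Sum>i\<in>UNIV. \<Sum>k\<in>UNIV. ennreal ((x $ i)\<^sup>2 * (x $ k)\<^sup>2)) \<partial>(sphere_measure :: (real^'n) measure))"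
    by (simp add: sum_product sum_nonneg)
  also have "\<dots> = (\<Sum>i\<in>UNIV. \<Sum>k\<in>UNIV. \<integral>\<^sup>+ x. ennreal ((x $ i)\<^sup>2 * (x $ k)\<^sup>2) \<partial>(sphere_measure :: (real^'n) measure))"
    by (simp add: nn_integral_sum del: sum_ennreal)
  finally show ?thesis .
qed

text \<open>An index that occurs an odd number of times makes the integral vanish by reflection.\<close>

lemma sphere_fourth_moments:
  fixes i j k l :: "'n::finite"
  assumes "CARD('n) \<ge> 2"
  defines "V \<equiv> measure (sphere_measure :: (real^'n) measure) (sphere 0 1)"
  shows "integrable (sphere_measure :: (real^'n) measure) (\<lambda>x. x $ i * x $ j * x $ k * x $ l)"
    and "(\<integral>x. x $ i * x $ j * x $ k * x $ l \<partial>(sphere_measure :: (real^'n) measure)) =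
      V / (real CARD('n) * (real CARD('n) + 2)) *
        ((if i = j \<and> k = l then 1 else 0) + (if i = k \<and> j = l then 1 else 0) + (if i = l \<and> j = k then 1 else 0))"
proof -
  obtain C where C0: "0 \<le> C" and C1: "\<forall>i k. (\<integral>\<^sup>+ x. ennreal ((x $ i)\<^sup>2 * (x $ k)\<^sup>2) \<partial>(sphere_measure :: (real^'n) measure)) =
    ennreal (if i = k then 3 * C else C)"
    using sphere_moments[OF assms(1)] by blast
  note C = C0 C1[rule_format]
  let ?n = "real CARD('n)"
  have row: "(\<Sum>k\<in>UNIV. (if i = k then 3 * C else C)) = (?n + 2) * C" for i :: 'n
  proof -
    have "(\<Sum>k\<in>UNIV. (if i = k then 3 * C else C)) = (\<Sum>k\<in>UNIV. C + (if k = i then 2 * C else 0))"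
      by (intro sum.cong) auto
    then show ?thesis by (simp add: sum.distrib algebra_simps)
  qed
  have "emeasure (sphere_measure :: (real^'n) measure) (sphere 0 1) = ennreal (?n * (?n + 2) * C)"
  proof -
    have "emeasure (sphere_measure :: (real^'n) measure) (sphere 0 1) =
        (\<Sum>i\<in>(UNIV :: 'n set). \<Sum>k\<in>UNIV. ennreal (if i = k then 3 * C else C))"
      unfolding C(2)[symmetric] by (rule emeasure_sphere_measure) simp_all
    also have "\<dots> = ennreal (\<Sum>i\<in>(UNIV :: 'n set). \<Sum>k\<in>UNIV. if i = k then 3 * C else C)"
      using C(1) by (simp add: sum_nonneg del: sum.delta sum.delta')
    also have "\<dots> = ennreal (?n * (?n + 2) * C)" unfolding row by (simp add: mult.assoc)
    finally show ?thesis .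
  qed
  then have "V = ?n * (?n + 2) * C" using C(1) by (simp add: V_def measure_def)
  then have VC: "V / (?n * (?n + 2)) = C" using assms(1) by simp
  have int: "integrable (sphere_measure :: (real^'n) measure) (\<lambda>x. (x $ a)\<^sup>2 * (x $ b)\<^sup>2)"
    and val: "(\<integral>x. (x $ a)\<^sup>2 * (x $ b)\<^sup>2 \<partial>(sphere_measure :: (real^'n) measure)) = (if a = b then 3 * C else C)" for a b
  proof -
    show "integrable (sphere_measure :: (real^'n) measure) (\<lambda>x. (x $ a)\<^sup>2 * (x $ b)\<^sup>2)"
      by (rule integrableI_nonneg) (auto simp: C(2))
    show "(\<integral>x. (x $ a)\<^sup>2 * (x $ b)\<^sup>2 \<partial>(sphere_measure :: (real^'n) measure)) = (if a = b then 3 * C else C)"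
      by (subst integral_eq_nn_integral) (auto simp: C)
  qed
  show "integrable (sphere_measure :: (real^'n) measure) (\<lambda>x. x $ i * x $ j * x $ k * x $ l)"
  proof (rule Bochner_Integration.integrable_bound)
    show "integrable (sphere_measure :: (real^'n) measure) (\<lambda>x. (x $ i)\<^sup>2 * (x $ j)\<^sup>2 + (x $ k)\<^sup>2 * (x $ l)\<^sup>2)"
      by (intro Bochner_Integration.integrable_add int)
    \<comment> \<open>Applied to the products \<open>x_i x_j\<close> and \<open>x_k x_l\<close>, it
      dominates any fourth-order monomial by even ones.\<close>
    have "\<bar>a * b\<bar> \<le> a\<^sup>2 + b\<^sup>2" for a b :: real
    proof -
      have "2 * \<bar>a\<bar> * \<bar>b\<bar> \<le> a\<^sup>2 + b\<^sup>2" using sum_squares_bound[of "\<bar>a\<bar>" "\<bar>b\<bar>"] by simp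
      moreover have "0 \<le> \<bar>a\<bar> * \<bar>b\<bar>" by simp
      ultimately show ?thesis unfolding abs_mult by linarith
    qed
    from this[of "_ * _" "_ * _"]
    show "AE x in sphere_measure. norm (x $ i * x $ j * x $ k * x $ l) \<le>
        norm ((x $ i)\<^sup>2 * (x $ j)\<^sup>2 + (x $ k)\<^sup>2 * (x $ l)\<^sup>2)"
      by (auto simp: power_mult_distrib mult.assoc)
  qed measurable
  have odd: "(\<integral>x. x $ i * x $ j * x $ k * x $ l \<partial>(sphere_measure :: (real^'n) measure)) = 0"
    if "\<And>x :: real^'n. reflect a x $ i * reflect a x $ j * reflect a x $ k * reflect a x $ l =
      - (x $ i * x $ j * x $ k * x $ l)" for a
    by (rule integral_sphere_odd[of _ a]) (use that in auto)
  have pair: "(\<integral>x. x $ a * x $ a * x $ b * x $ b \<partial>(sphere_measure :: (real^'n) measure)) = (if a = b then 3 * C else C)"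
    "(\<integral>x. x $ a * x $ b * x $ a * x $ b \<partial>(sphere_measure :: (real^'n) measure)) = (if a = b then 3 * C else C)"
    "(\<integral>x. x $ a * x $ b * x $ b * x $ a \<partial>(sphere_measure :: (real^'n) measure)) = (if a = b then 3 * C else C)" for a b
    unfolding val[symmetric]
    by (rule Bochner_Integration.integral_cong[OF refl], simp add: power2_eq_square)+
  have "(\<integral>x. x $ i * x $ j * x $ k * x $ l \<partial>(sphere_measure :: (real^'n) measure)) =
      C * ((if i = j \<and> k = l then 1 else 0) + (if i = k \<and> j = l then 1 else 0) + (if i = l \<and> j = k then 1 else 0))"
  proof (cases "(i = j \<and> k = l) \<or> (i = k \<and> j = l) \<or> (i = l \<and> j = k)")
    case True
    \<comment> \<open>Four equal indices fall under the first case, where all three indicators are 1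
      and match the moment \<open>3 * C\<close>. The condition \<open>i \<noteq> j\<close> ensures
      that exactly one indicator is 1 in the other cases.\<close>
    then consider "j = i" "l = k" | "k = i" "l = j" "i \<noteq> j" | "l = i" "k = j" "i \<noteq> j" by blast
    then show ?thesis
    proof cases
      case 1 show ?thesis unfolding 1 pair(1) by simp
    next
      case 2 show ?thesis unfolding 2(1,2) pair(2) using 2(3) by simp
    next
      case 3 show ?thesis unfolding 3(1,2) pair(3) using 3(3) by simp
    qed
  next
    case False
    \<comment> \<open>If the indices do not pair off, some index differs from the other three;
      reflecting in it changes the sign of the monomial.\<close>
    then consider "i \<notin> {j, k, l}" | "j \<notin> {i, k, l}" | "k \<notin> {i, j, l}" | "l \<notin> {i, j, k}" by auto
    then have "\<exists>a. \<forall>x :: real^'n. reflect a x $ i * reflect a x $ j * reflect a x $ k * reflect a x $ l =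
      - (x $ i * x $ j * x $ k * x $ l)"
    proof cases
      case 1 then show ?thesis by (intro exI[of _ i]) (auto simp: reflect_nth)
    next
      case 2 then show ?thesis by (intro exI[of _ j]) (auto simp: reflect_nth)
    next
      case 3 then show ?thesis by (intro exI[of _ k]) (auto simp: reflect_nth)
    next
      case 4 then show ?thesis by (intro exI[of _ l]) (auto simp: reflect_nth)
    qed
    then obtain a where a: "\<forall>x :: real^'n. reflect a x $ i * reflect a x $ j * reflect a x $ k * reflect a x $ l =
      - (x $ i * x $ j * x $ k * x $ l)" by blast
    have "\<not> (i = j \<and> k = l)" "\<not> (i = k \<and> j = l)" "\<not> (i = l \<and> j = k)" using False by blast+
    then show ?thesis unfolding odd[OF a[rule_format]] by (simp only: if_False add_0_left mult_zero_right)
  qed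
  then show "(\<integral>x. x $ i * x $ j * x $ k * x $ l \<partial>(sphere_measure :: (real^'n) measure)) =
      V / (?n * (?n + 2)) *
        ((if i = j \<and> k = l then 1 else 0) + (if i = k \<and> j = l then 1 else 0) + (if i = l \<and> j = k then 1 else 0))"
    unfolding VC .
qed


section \<open>Contraction of the curvature tensor\<close>

lemma linear_axis_expansion:
  fixes h :: "real^'n::finite \<Rightarrow> real"
  assumes "linear h"
  shows "h x = (\<Sum>i\<in>UNIV. x $ i * h (axis i 1))"
proof -
  have "h (\<Sum>i\<in>UNIV. (x $ i) *\<^sub>R axis i 1) = (\<Sum>i\<in>UNIV. x $ i * h (axis i 1))"
    using assms by (simp add: linear_sum linear_scale)
  then show ?thesis using basis_expansion[of x] by (simp add: scalar_mult_eq_scaleR)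
qed

text \<open>The matrix \<open>M\<close> with rows \<open>f i\<close> satisfies
  \<open>M M^T = 1\<close>, hence also \<open>M^T M = 1\<close>. Its columns are therefore
  orthonormal, and this is what collapses the double expansion of \<open>B\<close> to the
  diagonal.\<close>

lemma trace_orthonormal:
  fixes B :: "real^'n::finite \<Rightarrow> real^'n \<Rightarrow> real" and f :: "'n \<Rightarrow> real^'n"
  assumes 1: "\<And>y. linear (\<lambda>x. B x y)" and 2: "\<And>x. linear (B x)"
    and f: "\<And>i j. f i \<bullet> f j = (if i = j then 1 else 0)"
  shows "(\<Sum>i\<in>UNIV. B (f i) (f i)) = (\<Sum>i\<in>UNIV. B (axis i 1) (axis i 1))"
proof -
  define M :: "real^'n^'n" where "M = (\<chi> i j. f i $ j)"
  have "M ** transpose M = mat 1"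
    using f by (simp add: M_def matrix_matrix_mult_def transpose_def mat_def vec_eq_iff inner_vec_def)
  then have "transpose M ** M = mat 1" by (rule matrix_left_right_inverse[THEN iffD1])
  then have "(transpose M ** M) $ j $ k = (mat 1 :: real^'n^'n) $ j $ k" for j k by simp
  then have M: "(\<Sum>i\<in>UNIV. f i $ j * f i $ k) = (if j = k then 1 else 0)" for j k
    by (simp add: M_def matrix_matrix_mult_def transpose_def mat_def)
  have "B (f i) (f i) = (\<Sum>j\<in>UNIV. \<Sum>k\<in>UNIV. (f i $ j * f i $ k) * B (axis j 1) (axis k 1))" for i
  proof -
    have "B (f i) (f i) = (\<Sum>j\<in>UNIV. f i $ j * B (axis j 1) (f i))"
      by (rule linear_axis_expansion[OF 1])
    also have "\<dots> = (\<Sum>j\<in>UNIV. f i $ j * (\<Sum>k\<in>UNIV. f i $ k * B (axis j 1) (axis k 1)))"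
      by (intro sum.cong refl arg_cong2[where f = "(*)"] linear_axis_expansion[OF 2])
    finally show ?thesis by (simp add: sum_distrib_left mult.assoc)
  qed
  then have "(\<Sum>i\<in>UNIV. B (f i) (f i)) =
      (\<Sum>i\<in>UNIV. \<Sum>j\<in>UNIV. \<Sum>k\<in>UNIV. (f i $ j * f i $ k) * B (axis j 1) (axis k 1))" by simp
  also have "\<dots> = (\<Sum>j\<in>UNIV. \<Sum>i\<in>UNIV. \<Sum>k\<in>UNIV. (f i $ j * f i $ k) * B (axis j 1) (axis k 1))"
    by (rule sum.swap)
  also have "\<dots> = (\<Sum>j\<in>UNIV. \<Sum>k\<in>UNIV. \<Sum>i\<in>UNIV. (f i $ j * f i $ k) * B (axis j 1) (axis k 1))"
    by (intro sum.cong refl sum.swap)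
  also have "\<dots> = (\<Sum>j\<in>UNIV. \<Sum>k\<in>UNIV. (if j = k then 1 else 0) * B (axis j 1) (axis k 1))"
    by (simp add: sum_distrib_right[symmetric] M)
  also have "\<dots> = (\<Sum>j\<in>UNIV. B (axis j 1) (axis j 1))"
  proof (intro sum.cong refl)
    fix j :: 'n
    have "(\<Sum>k\<in>UNIV. (if j = k then 1 else 0) * B (axis j 1) (axis k 1)) =
        (\<Sum>k\<in>UNIV. if k = j then B (axis j 1) (axis k 1) else 0)"
      by (intro sum.cong) auto
    then show "(\<Sum>k\<in>UNIV. (if j = k then 1 else 0) * B (axis j 1) (axis k 1)) = B (axis j 1) (axis j 1)" by simp
  qed
  finally show ?thesis .
qed

lemma sum_double_delta:
  fixes F :: "'n::finite \<Rightarrow> 'n \<Rightarrow> 'n \<Rightarrow> real"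
  shows "(\<Sum>j\<in>UNIV. \<Sum>k\<in>UNIV. \<Sum>l\<in>UNIV. (if i = j \<and> k = l then 1 else 0) * F j k l) = (\<Sum>k\<in>UNIV. F i k k)"
    and "(\<Sum>j\<in>UNIV. \<Sum>k\<in>UNIV. \<Sum>l\<in>UNIV. (if i = k \<and> j = l then 1 else 0) * F j k l) = (\<Sum>k\<in>UNIV. F k i k)"
    and "(\<Sum>j\<in>UNIV. \<Sum>k\<in>UNIV. \<Sum>l\<in>UNIV. (if i = l \<and> j = k then 1 else 0) * F j k l) = (\<Sum>k\<in>UNIV. F k k i)"
proof -
  have d: "(\<Sum>l\<in>UNIV. (if P \<and> k = l then 1 else 0) * G l) = (if P then G k else 0)"
    "(\<Sum>l\<in>UNIV. (if k = l \<and> P then 1 else 0) * G l) = (if P then G k else 0)" for P and k :: 'n and G :: "'n \<Rightarrow> real"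
  proof -
    have "(\<Sum>l\<in>UNIV. (if P \<and> k = l then 1 else 0) * G l) = (\<Sum>l\<in>UNIV. if l = k then (if P then G l else 0) else 0)"
      "(\<Sum>l\<in>UNIV. (if k = l \<and> P then 1 else 0) * G l) = (\<Sum>l\<in>UNIV. if l = k then (if P then G l else 0) else 0)"
      by (intro sum.cong; auto)+
    then show "(\<Sum>l\<in>UNIV. (if P \<and> k = l then 1 else 0) * G l) = (if P then G k else 0)"
      "(\<Sum>l\<in>UNIV. (if k = l \<and> P then 1 else 0) * G l) = (if P then G k else 0)" by simp_all
  qed
  have e: "(\<Sum>j\<in>UNIV. \<Sum>k\<in>UNIV. if i = j then H j k else 0) = (\<Sum>k\<in>UNIV. H i k)" for H :: "'n \<Rightarrow> 'n \<Rightarrow> real"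
    by (subst sum.swap) simp
  show "(\<Sum>j\<in>UNIV. \<Sum>k\<in>UNIV. \<Sum>l\<in>UNIV. (if i = j \<and> k = l then 1 else 0) * F j k l) = (\<Sum>k\<in>UNIV. F i k k)"
    unfolding d by (rule e)
  show "(\<Sum>j\<in>UNIV. \<Sum>k\<in>UNIV. \<Sum>l\<in>UNIV. (if i = k \<and> j = l then 1 else 0) * F j k l) = (\<Sum>k\<in>UNIV. F k i k)"
    unfolding d by simp
  show "(\<Sum>j\<in>UNIV. \<Sum>k\<in>UNIV. \<Sum>l\<in>UNIV. (if i = l \<and> j = k then 1 else 0) * F j k l) = (\<Sum>k\<in>UNIV. F k k i)"
    unfolding d by simp
qed

text \<open>\<open>P\<close> need not be symmetric in its arguments, so the three pairings of the
  indices stay separate contractions.\<close>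

lemma integral_sphere_quartic:
  fixes P :: "real^'n::finite \<Rightarrow> real^'n \<Rightarrow> real^'n \<Rightarrow> real^'n \<Rightarrow> real"
  assumes n: "CARD('n) \<ge> 2"
    and lin: "\<And>b c d. linear (\<lambda>a. P a b c d)" "\<And>a c d. linear (\<lambda>b. P a b c d)"
      "\<And>a b d. linear (\<lambda>c. P a b c d)" "\<And>a b c. linear (\<lambda>d. P a b c d)"
  defines "p \<equiv> (\<lambda>i j k l. P (axis i 1) (axis j 1) (axis k 1) (axis l 1))"
  shows "(\<integral>x. P x x x x \<partial>sphere_measure) =
    measure (sphere_measure :: (real^'n) measure) (sphere 0 1) / (real CARD('n) * (real CARD('n) + 2)) *
    (\<Sum>i\<in>UNIV. \<Sum>k\<in>UNIV. p i i k k + p i k i k + p i k k i)"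
proof -
  define K where "K = measure (sphere_measure :: (real^'n) measure) (sphere 0 1) / (real CARD('n) * (real CARD('n) + 2))"
  have expand: "P x x x x = (\<Sum>i\<in>UNIV. \<Sum>j\<in>UNIV. \<Sum>k\<in>UNIV. \<Sum>l\<in>UNIV. (x $ i * x $ j * x $ k * x $ l) * p i j k l)" for x
  proof -
    have 1: "P x b c d = (\<Sum>i\<in>UNIV. x $ i * P (axis i 1) b c d)" for b c d
      by (rule linear_axis_expansion[OF lin(1)])
    have 2: "P a x c d = (\<Sum>i\<in>UNIV. x $ i * P a (axis i 1) c d)" for a c d
      by (rule linear_axis_expansion[OF lin(2)])
    have 3: "P a b x d = (\<Sum>i\<in>UNIV. x $ i * P a b (axis i 1) d)" for a b d
      by (rule linear_axis_expansion[OF lin(3)])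
    have 4: "P a b c x = (\<Sum>i\<in>UNIV. x $ i * P a b c (axis i 1))" for a b c
      by (rule linear_axis_expansion[OF lin(4)])
    have "P x x x x = (\<Sum>i\<in>UNIV. x $ i * (\<Sum>j\<in>UNIV. x $ j * (\<Sum>k\<in>UNIV. x $ k * (\<Sum>l\<in>UNIV. x $ l * p i j k l))))"
      unfolding p_def by (subst 1, subst 2, subst 3, subst 4) (rule refl)
    then show ?thesis by (simp add: sum_distrib_left mult.assoc)
  qed
  define m where "m i j k l = K * ((if i = j \<and> k = l then 1 else 0) + (if i = k \<and> j = l then 1 else 0)
      + (if i = l \<and> j = k then 1 else 0))" for i j k l :: 'n
  have "has_bochner_integral sphere_measure (\<lambda>x :: real^'n. x $ i * x $ j * x $ k * x $ l) (m i j k l)" for i j k l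
    using sphere_fourth_moments[OF n, of i j k l] unfolding has_bochner_integral_iff m_def K_def by blast
  then have "has_bochner_integral sphere_measure
      (\<lambda>x. \<Sum>i\<in>UNIV. \<Sum>j\<in>UNIV. \<Sum>k\<in>UNIV. \<Sum>l\<in>UNIV. (x $ i * x $ j * x $ k * x $ l) * p i j k l)
      (\<Sum>i\<in>UNIV. \<Sum>j\<in>UNIV. \<Sum>k\<in>UNIV. \<Sum>l\<in>UNIV. m i j k l * p i j k l)"
    by (intro has_bochner_integral_sum has_bochner_integral_mult_left)
  then have "(\<integral>x. P x x x x \<partial>sphere_measure) =
      (\<Sum>i\<in>UNIV. \<Sum>j\<in>UNIV. \<Sum>k\<in>UNIV. \<Sum>l\<in>UNIV. m i j k l * p i j k l)"
    unfolding expand by (rule has_bochner_integral_integral_eq)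
  also have "\<dots> = K * (\<Sum>i\<in>UNIV. \<Sum>j\<in>UNIV. \<Sum>k\<in>UNIV. \<Sum>l\<in>UNIV.
      (if i = j \<and> k = l then 1 else 0) * p i j k l + (if i = k \<and> j = l then 1 else 0) * p i j k l +
      (if i = l \<and> j = k then 1 else 0) * p i j k l)"
    unfolding m_def sum_distrib_left by (simp only: distrib_right mult.assoc)
  also have "\<dots> = K * (\<Sum>i\<in>UNIV. (\<Sum>k\<in>UNIV. p i i k k) + (\<Sum>k\<in>UNIV. p i k i k) + (\<Sum>k\<in>UNIV. p i k k i))"
    unfolding sum.distrib sum_double_delta ..
  finally show ?thesis unfolding K_def sum.distrib .
qed

text \<open>The three pairings of the fourth moments contribute \<open>2 s\<^sup>*\<close> (by the Bianchi identity), \<open>s\<close> and \<open>s\<^sup>*\<close>.\<close>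

lemma hermitian_curvature_contractions:
  fixes Q :: "real^'n::finite \<Rightarrow> real^'n \<Rightarrow> real^'n \<Rightarrow> real^'n \<Rightarrow> real" and j :: "real^'n \<Rightarrow> real^'n"
  assumes lin: "\<And>b c d. linear (\<lambda>a. Q a b c d)" "\<And>a c d. linear (\<lambda>b. Q a b c d)"
      "\<And>a b d. linear (\<lambda>c. Q a b c d)" "\<And>a b c. linear (\<lambda>d. Q a b c d)"
    and antisym: "\<And>a b c d. Q a b c d = - Q b a c d"
    and bianchi: "\<And>a b c d. Q a b c d + Q b c a d + Q c a b d = 0"
    and j: "linear j" "\<And>x y. j x \<bullet> j y = x \<bullet> y" "\<And>x. j (j x) = - x"
  defines "e \<equiv> (\<lambda>i. axis i 1)"
  shows "(\<Sum>i\<in>UNIV. \<Sum>k\<in>UNIV. Q (e i) (j (e i)) (e k) (j (e k)) + Q (e i) (j (e k)) (e i) (j (e k)) +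
      Q (e i) (j (e k)) (e k) (j (e i))) =
    3 * (\<Sum>i\<in>UNIV. \<Sum>a\<in>UNIV. Q (e a) (j (e i)) (e i) (j (e a))) +
    (\<Sum>i\<in>UNIV. \<Sum>a\<in>UNIV. Q (e i) (e a) (e i) (e a))"
proof -
  have je: "j (e i) \<bullet> j (e k) = (if i = k then 1 else 0)" for i k
    by (simp add: j(2) e_def inner_axis_axis)
  define S where "S = (\<Sum>i\<in>UNIV. \<Sum>a\<in>UNIV. Q (e a) (j (e i)) (e i) (j (e a)))"
  have S': "(\<Sum>i\<in>UNIV. \<Sum>k\<in>UNIV. Q (e i) (j (e k)) (e k) (j (e i))) = S"
    unfolding S_def by (rule sum.swap)
  \<comment> \<open>The vectors \<open>j (e k)\<close> form another orthonormal basis, and the trace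
    over it is the trace over the \<open>e k\<close>.\<close>
  have "(\<Sum>k\<in>UNIV. Q (e i) (j (e k)) (e i) (j (e k))) = (\<Sum>a\<in>UNIV. Q (e i) (e a) (e i) (e a))" for i
    unfolding e_def
  proof (rule trace_orthonormal[where B = "\<lambda>x y. Q (axis i 1) x (axis i 1) y"])
    show "j (axis i 1) \<bullet> j (axis k 1) = (if i = k then 1 else 0)" for i k using je by (simp add: e_def)
  qed (rule lin)+
  then have s: "(\<Sum>i\<in>UNIV. \<Sum>k\<in>UNIV. Q (e i) (j (e k)) (e i) (j (e k))) = (\<Sum>i\<in>UNIV. \<Sum>a\<in>UNIV. Q (e i) (e a) (e i) (e a))"
    by simp
  \<comment> \<open>The trace of \<open>Q (e k) x (j y) (j (e k))\<close> is taken over the basis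
    \<open>j (e i)\<close> instead of \<open>e i\<close>; the minus sign is
    \<open>j (j x) = - x\<close>.\<close>
  have tr: "(\<Sum>i\<in>UNIV. Q (e k) (e i) (j (e i)) (j (e k))) = - (\<Sum>i\<in>UNIV. Q (e k) (j (e i)) (e i) (j (e k)))" for k
  proof -
    have "(\<Sum>i\<in>UNIV. Q (e k) (j (e i)) (j (j (e i))) (j (e k))) = (\<Sum>i\<in>UNIV. Q (e k) (e i) (j (e i)) (j (e k)))"
      unfolding e_def
    proof (rule trace_orthonormal[where B = "\<lambda>x y. Q (axis k 1) x (j y) (j (axis k 1))"])
      show "linear (\<lambda>y. Q (axis k 1) x (j y) (j (axis k 1)))" for x
        using linear_compose[OF j(1) lin(3)] by (simp add: o_def)
      show "j (axis i 1) \<bullet> j (axis k 1) = (if i = k then 1 else 0)" for i k using je by (simp add: e_def)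
    qed (rule lin)
    then show ?thesis by (simp add: j(3) linear_neg[OF lin(3)] sum_negf)
  qed
  \<comment> \<open>The Bianchi identity on the first three arguments. Of the two resulting sums one
    is \<open>S\<close> and the other, by \<open>tr\<close>, is \<open>- S\<close>, so the
    difference is \<open>2 * S\<close>.\<close>
  have "Q (e i) (j (e i)) (e k) (j (e k)) = Q (e k) (j (e i)) (e i) (j (e k)) - Q (e k) (e i) (j (e i)) (j (e k))" for i k
    using bianchi[of "e i" "j (e i)" "e k" "j (e k)"] antisym[of "j (e i)" "e k" "e i" "j (e k)"] by simp
  then have "(\<Sum>i\<in>UNIV. \<Sum>k\<in>UNIV. Q (e i) (j (e i)) (e k) (j (e k))) =
      S - (\<Sum>i\<in>UNIV. \<Sum>k\<in>UNIV. Q (e k) (e i) (j (e i)) (j (e k)))"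
    by (simp add: S_def sum_subtractf)
  also have "(\<Sum>i\<in>UNIV. \<Sum>k\<in>UNIV. Q (e k) (e i) (j (e i)) (j (e k))) =
      (\<Sum>k\<in>UNIV. \<Sum>i\<in>UNIV. Q (e k) (e i) (j (e i)) (j (e k)))" by (rule sum.swap)
  also have "\<dots> = - S" unfolding tr sum_negf S' ..
  finally show ?thesis unfolding sum.distrib s S' S_def[symmetric] by simp
qed

context levi_civita_manifold
begin

section \<open>Existence of orthonormal bases\<close>

lemma metric_zero_left: "w \<in> tangent_space A p \<Longrightarrow> g p 0 w = 0"
  using metric_scale_left[of w p w w 0] by (simp only: scaleR_zero_left mult_zero_left)

lemma metric_sum_left:
  assumes "\<And>i. i \<in> I \<Longrightarrow> f i \<in> tangent_space A p" "w \<in> tangent_space A p"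
  shows "g p (\<Sum>i\<in>I. f i) w = (\<Sum>i\<in>I. g p (f i) w)"
  using assms
proof (induction I rule: infinite_finite_induct)
  case (insert i I)
  then have "g p (f i + (\<Sum>i\<in>I. f i)) w = g p (f i) w + g p (\<Sum>i\<in>I. f i) w"
    by (intro metric_add_left tangent_space_closed) auto
  moreover have "g p (\<Sum>i\<in>I. f i) w = (\<Sum>i\<in>I. g p (f i) w)"
    by (rule insert.IH) (use insert.prems in auto)
  ultimately show ?case by (simp only: sum.insert[OF insert.hyps])
qed (simp_all only: sum.empty sum.infinite metric_zero_left not_False_eq_True)

text \<open>Gram-Schmidt, one index of \<open>'n\<close> at a time. A chart supplies the dimension
  count: fewer than \<open>CARD('n)\<close> coordinate vectors cannot span
  \<open>real^'n\<close>.\<close>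

lemma ex_orthonormal_family:
  fixes I :: "'n set"
  shows "\<exists>e. (\<forall>i\<in>I. e i \<in> tangent_space A p) \<and> (\<forall>i\<in>I. \<forall>j\<in>I. g p (e i) (e j) = (if i = j then 1 else 0))"
proof (induction I rule: finite_induct[OF finite])
  case (2 a I)
  then obtain e where e: "\<And>i. i \<in> I \<Longrightarrow> e i \<in> tangent_space A p"
    "\<And>i j. i \<in> I \<Longrightarrow> j \<in> I \<Longrightarrow> g p (e i) (e j) = (if i = j then 1 else 0)" by blast
  obtain c where c: "c \<in> charts_at A p" using ex_chart_at by blast
  have "dim ((\<lambda>i. e i c) ` I) \<le> card I"
    using dim_le_card[of "(\<lambda>i. e i c) ` I" "(\<lambda>i. e i c) ` I"] card_image_le[of I "\<lambda>i. e i c"]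
    by (meson finite finite_imageI order_trans span_superset)
  also have "card I < CARD('n)"
    using 2(2) by (intro psubset_card_mono) auto
  finally have "span ((\<lambda>i. e i c) ` I) \<noteq> UNIV"
    by (metis dim_span dim_UNIV DIM_cart DIM_real mult.right_neutral less_irrefl)
  \<comment> \<open>A vector outside the span of the earlier ones; its orthogonal remainder
    \<open>u\<close> is therefore nonzero and can be normalised.\<close>
  then obtain w where w: "w \<notin> span ((\<lambda>i. e i c) ` I)" by blast
  define v where "v = tvec_of c p w"
  have v: "v \<in> tangent_space A p" "v c = w" using c by (simp_all add: v_def tvec_of_in_tangent_space tvec_of_chart)
  define z where "z = (\<Sum>i\<in>I. g p v (e i) *\<^sub>R e i)"
  have z: "z \<in> tangent_space A p" unfolding z_def by (intro tangent_space_closed e)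
  define u where "u = v - z"
  have u: "u \<in> tangent_space A p" unfolding u_def by (intro tangent_space_closed v z)
  have "u \<noteq> 0"
  proof
    assume "u = 0"
    then have "w = z c" using v(2) by (simp add: u_def)
    also have "\<dots> = (\<Sum>i\<in>I. g p v (e i) *\<^sub>R e i c)" by (simp add: z_def)
    also have "\<dots> \<in> span ((\<lambda>i. e i c) ` I)" by (intro span_sum span_scale span_base) auto
    finally show False using w by simp
  qed
  then have pos: "g p u u > 0" using metric_pos[OF u u u] by simp
  have orth: "g p u (e j) = 0" if j: "j \<in> I" for j
  proof -
    have "g p z (e j) = (\<Sum>i\<in>I. g p (g p v (e i) *\<^sub>R e i) (e j))"
      unfolding z_def by (intro metric_sum_left tangent_space_closed e j)
    also have "\<dots> = (\<Sum>i\<in>I. if i = j then g p v (e i) else 0)"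
      by (intro sum.cong refl) (simp add: metric_scale_left[OF e(1) e(1)[OF j] e(1)[OF j]] e(2) j)
    also have "\<dots> = g p v (e j)" using j by simp
    finally have "g p z (e j) = g p v (e j)" .
    moreover have "g p (u + z) (e j) = g p u (e j) + g p z (e j)"
      by (rule metric_add_left[OF u z e(1)[OF j]])
    ultimately show ?thesis by (simp add: u_def)
  qed
  define u' where "u' = (1 / sqrt (g p u u)) *\<^sub>R u"
  have u': "u' \<in> tangent_space A p" unfolding u'_def by (intro tangent_space_closed u)
  have "g p u' u' = 1"
    using pos by (simp add: u'_def metric_scale_left[OF u tangent_space_closed(4)[OF u] u] metric_scale_right[OF u u])
  moreover have "g p u' (e j) = 0" "g p (e j) u' = 0" if "j \<in> I" for j
    using orth[OF that] metric_scale_left[OF u e(1)[OF that] u] metric_sym[OF u' e(1)[OF that] u] by (simp_all add: u'_def)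
  ultimately show ?case
    using e u' 2(2) by (intro exI[of _ "e(a := u')"]) auto
qed simp

lemma ex_orthonormal_basis: "\<exists>e. orthonormal_basis_at A g p e"
  using ex_orthonormal_family[of UNIV p] by (simp add: orthonormal_basis_at_def)

end

section \<open>Transport to Euclidean space by an orthonormal frame\<close>

locale almost_hermitian_manifold = levi_civita_manifold A g nabla
  for A :: "('m::t2_space, 'n::finite) chart set"
    and g :: "'m \<Rightarrow> ('m, 'n) tvec \<Rightarrow> ('m, 'n) tvec \<Rightarrow> real"
    and nabla :: "('m, 'n) vfield \<Rightarrow> ('m, 'n) vfield \<Rightarrow> ('m, 'n) vfield" +
  fixes J :: "'m \<Rightarrow> ('m, 'n) tvec \<Rightarrow> ('m, 'n) tvec"
  assumes hermitian: "almost_hermitian A g J"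

text \<open>Once a frame is fixed, \<open>L\<close> carries the inner product to \<open>g p\<close>,
  and \<open>j\<close> and \<open>Q\<close> are the almost complex structure and the curvature read
  in \<open>real^'n\<close>, where the contraction and integration results apply.\<close>

locale orthonormal_frame = almost_hermitian_manifold A g nabla J
  for A :: "('m::t2_space, 'n::finite) chart set"
    and g :: "'m \<Rightarrow> ('m, 'n) tvec \<Rightarrow> ('m, 'n) tvec \<Rightarrow> real"
    and nabla :: "('m, 'n) vfield \<Rightarrow> ('m, 'n) vfield \<Rightarrow> ('m, 'n) vfield"
    and J :: "'m \<Rightarrow> ('m, 'n) tvec \<Rightarrow> ('m, 'n) tvec" +
  fixes p :: 'm and e :: "'n \<Rightarrow> ('m, 'n) tvec"
  assumes onb: "orthonormal_basis_at A g p e"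
begin

abbreviation "T \<equiv> tangent_space A p"

lemma J_T: "v \<in> T \<Longrightarrow> J p v \<in> T"
  and J_add: "v \<in> T \<Longrightarrow> w \<in> T \<Longrightarrow> J p (v + w) = J p v + J p w"
  and J_scale: "v \<in> T \<Longrightarrow> J p (a *\<^sub>R v) = a *\<^sub>R J p v"
  and J_J: "v \<in> T \<Longrightarrow> J p (J p v) = - v"
  and J_metric: "v \<in> T \<Longrightarrow> w \<in> T \<Longrightarrow> g p (J p v) (J p w) = g p v w"
  using hermitian unfolding almost_hermitian_def almost_complex_structure_def by blast+

lemma e_T: "e i \<in> T" and e_e: "g p (e i) (e j) = (if i = j then 1 else 0)"
  using onb by (auto simp: orthonormal_basis_at_def)

definition L :: "real^'n \<Rightarrow> ('m, 'n) tvec" where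
  "L x = (\<Sum>i\<in>UNIV. x $ i *\<^sub>R e i)"

lemma L_T: "L x \<in> T"
  unfolding L_def by (intro tangent_space_closed e_T)

lemma L_add: "L (x + y) = L x + L y"
  and L_scale: "L (a *\<^sub>R x) = a *\<^sub>R L x"
  unfolding L_def by (simp_all only: vector_add_component vector_scaleR_component scaleR_add_left
      sum.distrib scaleR_sum_right scaleR_scaleR real_scaleR_def)

lemma metric_L: "g p (L x) (L y) = x \<bullet> y"
proof -
  have *: "g p (e i) (L y) = y $ i" for i
  proof -
    have "g p (e i) (L y) = g p (L y) (e i)" by (rule metric_sym[OF e_T L_T L_T])
    also have "\<dots> = (\<Sum>k\<in>UNIV. y $ k * g p (e k) (e i))"
      unfolding L_def[of y]
      by (subst metric_sum_left) (auto intro!: tangent_space_closed(4) e_T sum.cong simp: metric_scale_left[OF e_T e_T e_T])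
    also have "\<dots> = (\<Sum>k\<in>UNIV. if k = i then y $ k else 0)"
      by (intro sum.cong) (auto simp: e_e)
    finally show ?thesis by simp
  qed
  have "g p (L x) (L y) = (\<Sum>i\<in>UNIV. x $ i * g p (e i) (L y))"
    unfolding L_def[of x]
    by (subst metric_sum_left) (auto intro!: tangent_space_closed(4) e_T L_T sum.cong simp: metric_scale_left[OF e_T L_T L_T])
  then show ?thesis by (simp add: * inner_vec_def)
qed

lemma L_inj: "L x = L y \<Longrightarrow> x = y"
proof -
  assume "L x = L y"
  then have "L (x - y) = 0" using L_add[of "x - y" y] by simp
  moreover have "g p 0 0 = 0" by (rule metric_zero_left[OF tangent_space_closed(1)])
  ultimately have "(x - y) \<bullet> (x - y) = 0" using metric_L[of "x - y" "x - y"] by simp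
  then show "x = y" by simp
qed

text \<open>Read in a chart, \<open>L\<close> is an injective linear map of \<open>real^'n\<close>
  to itself, hence surjective. This is how an orthonormal family indexed by \<open>'n\<close> is
  known to be a basis.\<close>

lemma L_surj:
  assumes "v \<in> T"
  shows "\<exists>x. L x = v"
proof -
  obtain c where c: "c \<in> charts_at A p" using ex_chart_at by blast
  have lin: "linear (\<lambda>x. L x c)" by (rule linearI) (simp_all add: L_add L_scale)
  have "inj (\<lambda>x. L x c)"
    by (rule injI) (rule L_inj, rule tangent_space_eqI[OF L_T L_T c])
  then have "surj (\<lambda>x. L x c)" by (rule linear_injective_imp_surjective[OF lin]) simp
  then obtain x where "v c = L x c" by (metis surjD)
  then have "L x = v" by (intro tangent_space_eqI[OF L_T assms c]) simp
  then show ?thesis ..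
qed

definition j :: "real^'n \<Rightarrow> real^'n" where
  "j x = (SOME y. L y = J p (L x))"

lemma L_j: "L (j x) = J p (L x)"
  unfolding j_def by (rule someI_ex) (rule L_surj[OF J_T[OF L_T]])

lemma linear_j: "linear j"
  by (rule linearI; rule L_inj) (simp_all only: L_j L_add L_scale J_add[OF L_T L_T] J_scale[OF L_T])

lemma j_inner: "j x \<bullet> j y = x \<bullet> y"
  unfolding metric_L[symmetric] L_j by (rule J_metric[OF L_T L_T])

lemma j_j: "j (j x) = - x"
proof (rule L_inj)
  have "L (- x) = - L x" using L_scale[of "-1" x] by simp
  then show "L (j (j x)) = L (- x)" by (simp only: L_j J_J[OF L_T])
qed

definition Q where "Q a b c d = R p (L a) (L b) (L c) (L d)"

lemma linear_Q:
  "linear (\<lambda>a. Q a b c d)" "linear (\<lambda>b. Q a b c d)" "linear (\<lambda>c. Q a b c d)" "linear (\<lambda>d. Q a b c d)"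
  by (rule linearI; simp only: Q_def L_add L_scale real_scaleR_def
      curvature_linear1[OF L_T L_T L_T L_T L_T] curvature_linear2[OF L_T L_T L_T L_T L_T]
      curvature_linear3[OF L_T L_T L_T L_T L_T] curvature_linear4[OF L_T L_T L_T L_T L_T])+

definition s where "s = (\<Sum>i\<in>UNIV. \<Sum>a\<in>UNIV. Q (axis i 1) (axis a 1) (axis i 1) (axis a 1))"

definition s_star where
  "s_star = (\<Sum>i\<in>UNIV. \<Sum>a\<in>UNIV. Q (axis a 1) (j (axis i 1)) (axis i 1) (j (axis a 1)))"

text \<open>Another orthonormal basis is the image under \<open>L\<close> of an orthonormal family
  of \<open>real^'n\<close>. Invariance of the trace is applied to one summation index at a
  time.\<close>

lemma frame_sums:
  assumes "orthonormal_basis_at A g p e'"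
  shows "(\<Sum>i\<in>UNIV. \<Sum>a\<in>UNIV. R p (e' i) (e' a) (e' i) (e' a)) = s"
    and "(\<Sum>i\<in>UNIV. \<Sum>a\<in>UNIV. R p (e' a) (J p (e' i)) (e' i) (J p (e' a))) = s_star"
proof -
  have "\<forall>i. \<exists>x. L x = e' i"
    using assms L_surj unfolding orthonormal_basis_at_def by blast
  from choice[OF this] obtain f where f: "\<And>i. e' i = L (f i)" by (auto dest: sym)
  have ff: "f i \<bullet> f k = (if i = k then 1 else 0)" for i k
    using assms unfolding metric_L[symmetric] f[symmetric] orthonormal_basis_at_def by blast
  have Qj2: "linear (\<lambda>x. Q a (j x) c d)" and Qj4: "linear (\<lambda>x. Q a b c (j x))" for a b c d
    using linear_compose[OF linear_j linear_Q(2)] linear_compose[OF linear_j linear_Q(4)] by (simp_all add: o_def)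
  have sumlin: "linear (\<lambda>x. \<Sum>i\<in>UNIV. h i x)" if "\<And>i. linear (h i)" for h :: "'n \<Rightarrow> real^'n \<Rightarrow> real"
    using that by (intro linear_compose_sum) auto
  have "(\<Sum>i\<in>UNIV. \<Sum>a\<in>UNIV. R p (e' i) (e' a) (e' i) (e' a)) = (\<Sum>i\<in>UNIV. \<Sum>a\<in>UNIV. Q (f i) (f a) (f i) (f a))"
    by (simp add: Q_def f)
  also have "\<dots> = (\<Sum>i\<in>UNIV. \<Sum>a\<in>UNIV. Q (f i) (axis a 1) (f i) (axis a 1))"
    by (intro sum.cong refl trace_orthonormal[where B = "\<lambda>x y. Q (f _) x (f _) y"] linear_Q ff)
  also have "\<dots> = s"
    unfolding s_def
    by (rule trace_orthonormal[where B = "\<lambda>x y. \<Sum>a\<in>UNIV. Q x (axis a 1) y (axis a 1)"])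
      (intro sumlin linear_Q ff)+
  finally show "(\<Sum>i\<in>UNIV. \<Sum>a\<in>UNIV. R p (e' i) (e' a) (e' i) (e' a)) = s" .
  have "(\<Sum>i\<in>UNIV. \<Sum>a\<in>UNIV. R p (e' a) (J p (e' i)) (e' i) (J p (e' a))) =
      (\<Sum>i\<in>UNIV. \<Sum>a\<in>UNIV. Q (f a) (j (f i)) (f i) (j (f a)))"
    by (simp add: Q_def f L_j)
  also have "\<dots> = (\<Sum>i\<in>UNIV. \<Sum>a\<in>UNIV. Q (axis a 1) (j (f i)) (f i) (j (axis a 1)))"
    by (intro sum.cong refl trace_orthonormal[where B = "\<lambda>x y. Q x (j (f _)) (f _) (j y)"] linear_Q Qj4 ff)
  also have "\<dots> = s_star"
    unfolding s_star_def
    by (rule trace_orthonormal[where B = "\<lambda>x y. \<Sum>a\<in>UNIV. Q (axis a 1) (j x) y (j (axis a 1))"])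
      (intro sumlin linear_Q Qj2 ff)+
  finally show "(\<Sum>i\<in>UNIV. \<Sum>a\<in>UNIV. R p (e' a) (J p (e' i)) (e' i) (J p (e' a))) = s_star" .
qed

lemma scalar_curvature_eq: "scalar_curvature A g nabla p = s"
  unfolding scalar_curvature_def using frame_sums(1) onb by (intro the_equality) auto

lemma star_scalar_curvature_eq: "star_scalar_curvature A g J nabla p = s_star"
  unfolding star_scalar_curvature_def star_ricci_def using frame_sums(2) onb by (intro the_equality) auto

lemma integral_hol_sec_curvature:
  assumes "CARD('n) \<ge> 2"
  shows "(\<integral>x. hol_sec_curvature A g J nabla p (\<Sum>i\<in>UNIV. x $ i *\<^sub>R e i) \<partial>sphere_measure) =
    measure (sphere_measure :: (real^'n) measure) (sphere 0 1) / (real CARD('n) * (real CARD('n) + 2)) *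
    (3 * s_star + s)"
proof -
  have H: "hol_sec_curvature A g J nabla p (\<Sum>i\<in>UNIV. x $ i *\<^sub>R e i) = Q x (j x) x (j x)" for x
    by (simp only: hol_sec_curvature_def L_def[symmetric] Q_def L_j)
  have Qj: "linear (\<lambda>x. Q a (j x) c d)" "linear (\<lambda>x. Q a b c (j x))" for a b c d
    using linear_compose[OF linear_j linear_Q(2)] linear_compose[OF linear_j linear_Q(4)] by (simp_all add: o_def)
  have antisym: "Q a b c d = - Q b a c d" for a b c d
    unfolding Q_def by (rule curvature_antisym) (rule L_T)+
  have bianchi: "Q a b c d + Q b c a d + Q c a b d = 0" for a b c d
    unfolding Q_def by (rule bianchi) (rule L_T)+
  show ?thesis
    unfolding H
    \<comment> \<open>The holomorphic sectional curvature is the diagonal of this four-linear form;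
      the factors \<open>j\<close> are absorbed into the second and fourth arguments.\<close>
    by (subst integral_sphere_quartic[where P = "\<lambda>a b c d. Q a (j b) c (j d)", OF assms linear_Q(1) Qj(1) linear_Q(3) Qj(2)])
      (simp only: s_def s_star_def
        hermitian_curvature_contractions[of Q j, OF linear_Q antisym bianchi linear_j j_inner j_j])
qed

end

context almost_hermitian_manifold
begin

text \<open>The value found in a frame involves that frame only through \<open>s\<close> and
  \<open>s_star\<close>, which equal the two scalar curvatures. All frames thus give the same
  integral, and at least one frame exists.\<close>

lemma unit_sphere_integral_hol_sec_curvature:
  assumes "CARD('n) = 2 * N"
  shows "unit_sphere_integral A g p (hol_sec_curvature A g J nabla p) =
           (3 * star_scalar_curvature A g J nabla p + scalar_curvature A g nabla p)
             / (4 * real N * (real N + 1))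
           * measure (sphere_measure :: (real^'n) measure) (sphere 0 1)" (is "_ = ?r")
proof -
  have "CARD('n) > 0" by simp
  then have n: "CARD('n) \<ge> 2" using assms by (cases N) auto
  have "(\<integral>x. hol_sec_curvature A g J nabla p (\<Sum>i\<in>UNIV. x $ i *\<^sub>R e i) \<partial>sphere_measure) = ?r"
    if "orthonormal_basis_at A g p e" for e
  proof -
    interpret orthonormal_frame A g nabla J p e using that by unfold_locales
    have c: "real CARD('n) * (real CARD('n) + 2) = 4 * real N * (real N + 1)"
      by (simp add: assms algebra_simps)
    show ?thesis
      unfolding integral_hol_sec_curvature[OF n] c scalar_curvature_eq star_scalar_curvature_eq by simp
  qed
  then show ?thesis
    unfolding unit_sphere_integral_def using ex_orthonormal_basis[of p] by (intro the_equality) auto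
qed

end

theorem theorem1p4:
  fixes A :: "('m::{t2_space, second_countable_topology}, 'n::finite) chart set"
    and g :: "'m \<Rightarrow> ('m, 'n) tvec \<Rightarrow> ('m, 'n) tvec \<Rightarrow> real"
    and J :: "'m \<Rightarrow> ('m, 'n) tvec \<Rightarrow> ('m, 'n) tvec"
    and nabla :: "('m, 'n) vfield \<Rightarrow> ('m, 'n) vfield \<Rightarrow> ('m, 'n) vfield"
    and N :: nat
  assumes "smooth_atlas A"
    and "compact (UNIV :: 'm set)"
    and "connected (UNIV :: 'm set)"
    and "CARD('n) = 2 * N"
    and "almost_hermitian A g J"
    and "levi_civita A g nabla"
  shows "\<forall>p. unit_sphere_integral A g p (hol_sec_curvature A g J nabla p) =
           (3 * star_scalar_curvature A g J nabla p + scalar_curvature A g nabla p)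
             / (4 * real N * (real N + 1))
           * measure (sphere_measure :: (real^'n) measure) (sphere 0 1)"
proof -
  interpret almost_hermitian_manifold A g nabla J
    using assms by unfold_locales (auto simp: almost_hermitian_def)
  show ?thesis using unit_sphere_integral_hol_sec_curvature[OF assms(4)] by blast
qed

end
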